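(* Let $\mathcal{K}$ be a class of algebraic groups over algebraically closed fields (the fields may be different for different groups from $\mathcal{K}$). Then every $\mathcal{K}$-approximable group is $Fin$-approximable (that is, weakly sofic).
   Context: An algebraic group over an algebraically closed field $k$ is identified with its group of $k$-points, regarded as an abstract group. $Fin$ is the class of all finite groups. For a group $H$, $X\subseteq H$ and $n\in\mathbb{N}$, put $C_n(X,H)=\{x_1^{g_1}\cdots x_n^{g_n} : x_i\in X\text{ or }x_i^{-1}\in X,\ g_i\in H\}$, where $x^g=g^{-1}xg$. A set $Y\subseteq H$ is $n$-separated from $X$ in $H$ if $Y\cap C_n(X,H)=\emptyset$. For a class of groups $\mathcal{K}$, a group $G$ is $\mathcal{K}$-approximable if for every finite $\Phi\subset G$ and every $n\in\mathbb{N}$ there exist $H\in\mathcal{K}$ and a map $\phi:\Phi\to H$ such that $\phi(1)=1$ (when $1\in\Phi$) and $\phi(\Phi\setminus\{1\})$ is $n$-separated in $H$ from $\{\phi(g)\phi(h)(\phi(gh))^{-1} : g,h,gh\in\Phi\}$. $Fin$-approximable groups are called weakly sofic. *)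

theory Defs
  imports "HOL-Algebra.Algebraic_Closure"
begin

section \<open>Approximable groups\<close>

text \<open>The set \<open>C\<^sub>n(S,H)\<close>: the list collects the pairs \<open>(x\<^sub>i, g\<^sub>i)\<close>, and \<open>foldr\<close> is the
  ordered product in \<open>H\<close>.\<close>

definition conj_products ::
    "('h, 'b) monoid_scheme \<Rightarrow> nat \<Rightarrow> 'h set \<Rightarrow> 'h set" where
  "conj_products H n S =
     {foldr (\<otimes>\<^bsub>H\<^esub>) (map (\<lambda>(x, g). inv\<^bsub>H\<^esub> g \<otimes>\<^bsub>H\<^esub> x \<otimes>\<^bsub>H\<^esub> g) ps) \<one>\<^bsub>H\<^esub> | ps.
        length ps = n \<and>
        (\<forall>(x, g) \<in> set ps. x \<in> carrier H \<and> g \<in> carrier H \<and> (x \<in> S \<or> inv\<^bsub>H\<^esub> x \<in> S))}"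

definition separated ::
    "('h, 'b) monoid_scheme \<Rightarrow> nat \<Rightarrow> 'h set \<Rightarrow> 'h set \<Rightarrow> bool" where
  "separated H n Y S \<longleftrightarrow> Y \<inter> conj_products H n S = {}"

definition defects ::
    "('g, 'a) monoid_scheme \<Rightarrow> ('h, 'b) monoid_scheme \<Rightarrow> 'g set \<Rightarrow> ('g \<Rightarrow> 'h) \<Rightarrow> 'h set" where
  "defects G H \<Phi> \<phi> =
     {\<phi> g \<otimes>\<^bsub>H\<^esub> \<phi> h \<otimes>\<^bsub>H\<^esub> inv\<^bsub>H\<^esub> (\<phi> (g \<otimes>\<^bsub>G\<^esub> h)) | g h.
        g \<in> \<Phi> \<and> h \<in> \<Phi> \<and> g \<otimes>\<^bsub>G\<^esub> h \<in> \<Phi>}"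

definition approximable ::
    "'h monoid set \<Rightarrow> ('g, 'a) monoid_scheme \<Rightarrow> bool" where
  "approximable K G \<longleftrightarrow>
     (\<forall>\<Phi> n. finite \<Phi> \<and> \<Phi> \<subseteq> carrier G \<longrightarrow>
        (\<exists>H \<in> K. \<exists>\<phi>. \<phi> \<in> \<Phi> \<rightarrow> carrier H \<and>
           (\<one>\<^bsub>G\<^esub> \<in> \<Phi> \<longrightarrow> \<phi> \<one>\<^bsub>G\<^esub> = \<one>\<^bsub>H\<^esub>) \<and>
           separated H n (\<phi> ` (\<Phi> - {\<one>\<^bsub>G\<^esub>})) (defects G H \<Phi> \<phi>)))"

text \<open>Every finite group is isomorphic to one carried by a set of natural numbers, and
  \<^const>\<open>approximable\<close> depends on the members of the class only up to isomorphism.\<close>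

definition Fin :: "nat monoid set" where
  "Fin = {H. group H \<and> finite (carrier H)}"

definition weakly_sofic :: "('g, 'a) monoid_scheme \<Rightarrow> bool" where
  "weakly_sofic G \<longleftrightarrow> approximable Fin G"


section \<open>Affine algebraic sets and regular functions\<close>

definition affine_space :: "('f, 'c) ring_scheme \<Rightarrow> nat \<Rightarrow> 'f list set" where
  "affine_space k n = {x. length x = n \<and> set x \<subseteq> carrier k}"

text \<open>Polynomial functions in \<open>n\<close> variables with coefficients in \<open>k\<close>; over an infinite field
  these are the same as formal polynomials.\<close>

inductive_set poly_funs :: "('f, 'c) ring_scheme \<Rightarrow> nat \<Rightarrow> ('f list \<Rightarrow> 'f) set"
  for k :: "('f, 'c) ring_scheme" and n :: nat where
  poly_const: "c \<in> carrier k \<Longrightarrow> (\<lambda>x. c) \<in> poly_funs k n"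
| poly_var: "i < n \<Longrightarrow> (\<lambda>x. x ! i) \<in> poly_funs k n"
| poly_add: "p \<in> poly_funs k n \<Longrightarrow> q \<in> poly_funs k n \<Longrightarrow> (\<lambda>x. p x \<oplus>\<^bsub>k\<^esub> q x) \<in> poly_funs k n"
| poly_mult: "p \<in> poly_funs k n \<Longrightarrow> q \<in> poly_funs k n \<Longrightarrow> (\<lambda>x. p x \<otimes>\<^bsub>k\<^esub> q x) \<in> poly_funs k n"

definition algebraic_set :: "('f, 'c) ring_scheme \<Rightarrow> nat \<Rightarrow> 'f list set \<Rightarrow> bool" where
  "algebraic_set k n Z \<longleftrightarrow>
     (\<exists>S \<subseteq> poly_funs k n. Z = {x \<in> affine_space k n. \<forall>p \<in> S. p x = \<zero>\<^bsub>k\<^esub>})"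

definition zariski_open :: "('f, 'c) ring_scheme \<Rightarrow> nat \<Rightarrow> 'f list set \<Rightarrow> bool" where
  "zariski_open k n W \<longleftrightarrow>
     W \<subseteq> affine_space k n \<and> algebraic_set k n (affine_space k n - W)"

definition zariski_open_in ::
    "('f, 'c) ring_scheme \<Rightarrow> nat \<Rightarrow> 'f list set \<Rightarrow> 'f list set \<Rightarrow> bool" where
  "zariski_open_in k n Z W \<longleftrightarrow> (\<exists>T. zariski_open k n T \<and> W = Z \<inter> T)"

definition regular_fun ::
    "('f, 'c) ring_scheme \<Rightarrow> nat \<Rightarrow> 'f list set \<Rightarrow> ('f list \<Rightarrow> 'f) \<Rightarrow> bool" where
  "regular_fun k n W f \<longleftrightarrow>
     (\<forall>x \<in> W. \<exists>T. zariski_open k n T \<and> x \<in> T \<and>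
        (\<exists>p \<in> poly_funs k n. \<exists>q \<in> poly_funs k n.
           \<forall>y \<in> W \<inter> T. q y \<noteq> \<zero>\<^bsub>k\<^esub> \<and> f y = p y \<otimes>\<^bsub>k\<^esub> inv\<^bsub>k\<^esub> (q y)))"


section \<open>Varieties and algebraic groups\<close>

text \<open>A chart \<open>(U, n, \<phi>)\<close> identifies \<open>U\<close> with the algebraic set \<open>\<phi> ` U\<close> in affine
  \<open>n\<close>-space; a variety is given by a finite set of charts.\<close>

type_synonym ('x, 'f) chart = "'x set \<times> nat \<times> ('x \<Rightarrow> 'f list)"

text \<open>A morphism is continuous (preimages of chart domains are open) and regular in the
  coordinates of any two charts.\<close>

definition morphism ::
    "('f, 'c) ring_scheme \<Rightarrow> ('x, 'f) chart set \<Rightarrow> ('y, 'f) chart set \<Rightarrow> ('x \<Rightarrow> 'y) \<Rightarrow> bool" where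
  "morphism k A B f \<longleftrightarrow>
     (\<forall>(U, n, \<phi>) \<in> A. \<forall>(V, m, \<psi>) \<in> B.
        zariski_open_in k n (\<phi> ` U) (\<phi> ` (U \<inter> f -` V)) \<and>
        (\<forall>i < m. regular_fun k n (\<phi> ` (U \<inter> f -` V)) (\<lambda>z. \<psi> (f (inv_into U \<phi> z)) ! i)))"

text \<open>A variety need not be irreducible.  That the identity is a morphism says that chart
  domains have open overlaps and that coordinate changes are regular.  Separatedness is not
  required: it is automatic for group objects.\<close>

definition variety ::
    "('f, 'c) ring_scheme \<Rightarrow> 'x set \<Rightarrow> ('x, 'f) chart set \<Rightarrow> bool" where
  "variety k V A \<longleftrightarrow>
     finite A \<and> (\<Union>(U, n, \<phi>) \<in> A. U) = V \<and>
     (\<forall>(U, n, \<phi>) \<in> A. inj_on \<phi> U \<and> algebraic_set k n (\<phi> ` U)) \<and>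
     morphism k A A (\<lambda>x. x)"

definition product_atlas ::
    "('x, 'f) chart set \<Rightarrow> ('y, 'f) chart set \<Rightarrow> ('x \<times> 'y, 'f) chart set" where
  "product_atlas A B =
     {(U \<times> V, n + m, \<lambda>(x, y). \<phi> x @ \<psi> y) | U n \<phi> V m \<psi>. (U, n, \<phi>) \<in> A \<and> (V, m, \<psi>) \<in> B}"

text \<open>Over an algebraically closed field \<open>k\<close>, the points of an algebraic group form a group on a
  variety, not necessarily affine, whose multiplication and inversion are morphisms.\<close>

definition algebraic_group :: "('f, 'c) ring_scheme \<Rightarrow> ('h, 'b) monoid_scheme \<Rightarrow> bool" where
  "algebraic_group k H \<longleftrightarrow>
     group H \<and>
     (\<exists>A. variety k (carrier H) A \<and>
          morphism k (product_atlas A A) A (\<lambda>(x, y). x \<otimes>\<^bsub>H\<^esub> y) \<and>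
          morphism k A A (\<lambda>x. inv\<^bsub>H\<^esub> x))"

end

theory Submission
  imports Defs "HOL-Number_Theory.Residues"
begin

text \<open>The underlying set and the multiplication of an algebraic group over \<open>k\<close> are definable in the
  field \<open>k\<close> with parameters from \<open>k\<close>: algebraic sets are cut out by finitely many equations
  (Hilbert's basis theorem), and by quasi-compactness a regular function is given by finitely many
  quotients of polynomials. That the multiplication is a group law and that the images of finitely
  many elements are separated is then a first-order property of the parameters. By quantifier
  elimination, uniform in the algebraically closed field, the existence of such parameters depends only
  on the characteristic, and passes from characteristic 0 to some prime characteristic. So there are
  such parameters in the algebraic closure of a finite prime field. There, a power of the Frobenius
  endomorphism fixes the parameters, and its fixed points form a finite subgroup of the definable
  group. This subgroup contains the images of the given elements, and separation is inherited by
  subgroups.\<close>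

section \<open>Coefficient lists and algebraically closed fields\<close>

text \<open>The groups need not be linear, so there is no embedding into matrices to start from;
  what is available for every member of the class is definability in charts. Formulas are not given
  by syntax. A formula is a predicate that takes the field as an argument and belongs to the
  inductive class \<open>upred\<close>, so that uniform quantifier elimination becomes a closure
  property of \<open>upred\<close>. Such a predicate can be evaluated only in fields whose elements
  share one type; that type is therefore a disjoint sum, with one summand for k and one for the
  algebraic closures of all prime fields. A formula with all variables quantified can only test
  whether finitely many integers vanish in the field. This explains the choice of the prime: the
  characteristic of k if it is positive, and otherwise any prime larger than all these integers. The
  coordinates of the images of \<Phi> in k are themselves parameters of the formula. Hence an
  endomorphism that fixes the parameters fixes the corresponding elements in the new field, and no
  separate argument is needed to place them in the finite subgroup.\<close>

primrec peval :: "('a, 'b) ring_scheme \<Rightarrow> 'a list \<Rightarrow> 'a \<Rightarrow> 'a" where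
  "peval R [] c = \<zero>\<^bsub>R\<^esub>"
| "peval R (a # as) c = a \<oplus>\<^bsub>R\<^esub> c \<otimes>\<^bsub>R\<^esub> peval R as c"

context cring
begin

text \<open>Rewrite rules that expand both sides of a commutative ring identity into sums of
  monomials in a fixed order, with cancellation of opposite terms.\<close>

lemmas cring_norm =
  a_minus_def l_distr r_distr l_minus r_minus minus_add a_ac m_ac r_neg1 r_neg2

lemma peval_closed [simp, intro]:
  "set as \<subseteq> carrier R \<Longrightarrow> c \<in> carrier R \<Longrightarrow> peval R as c \<in> carrier R"
  by (induction as) auto

lemma peval_append:
  assumes "set as \<subseteq> carrier R" "set bs \<subseteq> carrier R" "c \<in> carrier R"
  shows "peval R (as @ bs) c = peval R as c \<oplus> c [^] length as \<otimes> peval R bs c"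
  using assms
proof (induction as)
  case (Cons a as)
  have "c \<otimes> (peval R as c \<oplus> c [^] length as \<otimes> peval R bs c)
      = c \<otimes> peval R as c \<oplus> (c [^] length as \<otimes> c) \<otimes> peval R bs c"
    using Cons.prems by (simp add: r_distr m_ac)
  then show ?case using Cons by (simp add: a_assoc m_assoc)
qed auto

lemma peval_replicate_zero: "c \<in> carrier R \<Longrightarrow> peval R (replicate k \<zero>) c = \<zero>"
  by (induction k) auto

lemma peval_all_zero: "\<forall>a \<in> set as. a = \<zero> \<Longrightarrow> c \<in> carrier R \<Longrightarrow> peval R as c = \<zero>"
  by (induction as) auto

lemma peval_smult:
  "set as \<subseteq> carrier R \<Longrightarrow> a \<in> carrier R \<Longrightarrow> c \<in> carrier R \<Longrightarrow>
     peval R (map ((\<otimes>) a) as) c = a \<otimes> peval R as c"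
  by (induction as) (auto simp: r_distr m_lcomm)

text \<open>Serves two purposes: multiplication by a linear factor, with l and its shift as the two
  lists, and one step of pseudo-division.\<close>

lemma peval_lincomb:
  assumes "length xs = length ys" "set xs \<subseteq> carrier R" "set ys \<subseteq> carrier R"
    "a \<in> carrier R" "b \<in> carrier R" "c \<in> carrier R"
  shows "peval R (map2 (\<lambda>x y. a \<otimes> x \<ominus> b \<otimes> y) xs ys) c
       = a \<otimes> peval R xs c \<ominus> b \<otimes> peval R ys c"
  using assms
proof (induction xs ys rule: list_induct2)
  case Nil
  then show ?case by (simp add: a_minus_def)
next
  case (Cons x xs y ys)
  have [simp]: "peval R xs c \<in> carrier R" "peval R ys c \<in> carrier R" using Cons.prems by auto
  have "a \<otimes> x \<ominus> b \<otimes> y \<oplus> c \<otimes> (a \<otimes> peval R xs c \<ominus> b \<otimes> peval R ys c)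
      = a \<otimes> (x \<oplus> c \<otimes> peval R xs c) \<ominus> b \<otimes> (y \<oplus> c \<otimes> peval R ys c)"
    if "x \<in> carrier R" "y \<in> carrier R" "a \<in> carrier R" "b \<in> carrier R" "c \<in> carrier R"
    using that \<open>peval R xs c \<in> carrier R\<close> \<open>peval R ys c \<in> carrier R\<close> by (simp add: cring_norm)
  then show ?case using Cons by simp
qed

lemma lincomb_closed:
  assumes "set xs \<subseteq> carrier R" "set ys \<subseteq> carrier R" "a \<in> carrier R" "b \<in> carrier R"
  shows "set (map2 (\<lambda>x y. a \<otimes> x \<ominus> b \<otimes> y) xs ys) \<subseteq> carrier R"
proof -
  have "set (zip xs ys) \<subseteq> carrier R \<times> carrier R"
    using assms(1,2) by (auto dest: set_zip_leftD set_zip_rightD)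
  then show ?thesis using assms(3,4) by auto
qed

text \<open>Division by X - r. The length and the leading coefficient of the quotient are recorded
  because the applications are inductions on the degree.\<close>

lemma peval_divide_linear:
  assumes "set as \<subseteq> carrier R" "r \<in> carrier R"
  shows "\<exists>bs. set bs \<subseteq> carrier R \<and> length bs = length as - 1 \<and>
      (length as \<ge> 2 \<longrightarrow> last bs = last as) \<and>
      (\<forall>c \<in> carrier R. peval R as c = (c \<ominus> r) \<otimes> peval R bs c \<oplus> peval R as r)"
  using assms(1)
proof (induction as)
  case Nil
  then show ?case using assms(2) by (intro exI[of _ "[]"]) auto
next
  case (Cons a as)
  then obtain bs where bs: "set bs \<subseteq> carrier R" "length bs = length as - 1"
    "length as \<ge> 2 \<longrightarrow> last bs = last as"
    "\<And>c. c \<in> carrier R \<Longrightarrow> peval R as c = (c \<ominus> r) \<otimes> peval R bs c \<oplus> peval R as r"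
    by auto
  show ?case
  proof (cases "as = []")
    case True
    then show ?thesis using assms(2) Cons.prems by (intro exI[of _ "[]"]) auto
  next
    case False
    \<comment> \<open>Horner's scheme: the new coefficient of the quotient is the value of the tail
      at r.\<close>
    let ?bs = "peval R as r # bs"
    have r: "peval R as r \<in> carrier R" using Cons.prems assms(2) by auto
    have "peval R (a # as) c = (c \<ominus> r) \<otimes> peval R ?bs c \<oplus> peval R (a # as) r"
      if c: "c \<in> carrier R" for c
    proof -
      have [simp]: "peval R bs c \<in> carrier R" "a \<in> carrier R" using bs(1) c Cons.prems by auto
      have "a \<oplus> c \<otimes> ((c \<ominus> r) \<otimes> peval R bs c \<oplus> peval R as r)
        = (c \<ominus> r) \<otimes> (peval R as r \<oplus> c \<otimes> peval R bs c) \<oplus> (a \<oplus> r \<otimes> peval R as r)"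
        using c r assms(2) \<open>peval R bs c \<in> carrier R\<close> \<open>a \<in> carrier R\<close> by (simp add: cring_norm)
      then show ?thesis using bs(4)[OF c] by simp
    qed
    moreover have "last ?bs = last (a # as)"
    proof (cases "length as \<ge> 2")
      case True
      then have "bs \<noteq> []" using bs(2) by auto
      then show ?thesis using True bs(3) False by simp
    next
      case 2: False
      then obtain z where z: "as = [z]" using False
        by (cases as; cases "tl as") auto
      then have "bs = []" using bs(2) by simp
      then show ?thesis using z Cons.prems assms(2) by simp
    qed
    moreover have "set ?bs \<subseteq> carrier R" "length ?bs = length (a # as) - 1"
      using bs(1,2) r False by (auto simp: Suc_le_eq)
    ultimately show ?thesis by blast
  qed
qed

end

context domain
begin

text \<open>A root r splits off the factor X - r, and in a domain every other root is a root of the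
  quotient, which has the same leading coefficient.\<close>

lemma finite_roots_peval:
  assumes "set as \<subseteq> carrier R" "as \<noteq> []" "last as \<noteq> \<zero>"
  shows "finite {c \<in> carrier R. peval R as c = \<zero>}"
  using assms
proof (induction "length as" arbitrary: as)
  case (Suc n)
  show ?case
  proof (cases "\<exists>r \<in> carrier R. peval R as r = \<zero>")
    case True
    then obtain r where r: "r \<in> carrier R" "peval R as r = \<zero>" by blast
    obtain bs where bs: "set bs \<subseteq> carrier R" "length bs = length as - 1"
      "length as \<ge> 2 \<Longrightarrow> last bs = last as"
      "\<And>c. c \<in> carrier R \<Longrightarrow> peval R as c = (c \<ominus> r) \<otimes> peval R bs c \<oplus> peval R as r"
      using peval_divide_linear[OF Suc.prems(1) r(1)] by blast
    show ?thesis
    proof (cases "length as \<ge> 2")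
      case True
      then have "finite {c \<in> carrier R. peval R bs c = \<zero>}"
        using Suc bs(1,2) bs(3)[OF True] by (intro Suc.hyps(1)) auto
      moreover have "{c \<in> carrier R. peval R as c = \<zero>}
          \<subseteq> insert r {c \<in> carrier R. peval R bs c = \<zero>}"
      proof
        fix c assume "c \<in> {c \<in> carrier R. peval R as c = \<zero>}"
        then have c: "c \<in> carrier R" "(c \<ominus> r) \<otimes> peval R bs c = \<zero>"
          using bs(4)[of c] r bs(1) by auto
        then have "c \<ominus> r = \<zero> \<or> peval R bs c = \<zero>"
          using integral bs(1) r(1) by (meson minus_closed peval_closed)
        then show "c \<in> insert r {c \<in> carrier R. peval R bs c = \<zero>}"
          using c(1) r(1) by auto
      qed
      ultimately show ?thesis by (meson finite.insertI finite_subset)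
    next
      case False
      then obtain z where "as = [z]" using Suc.prems(2) by (cases as; cases "tl as") auto
      then show ?thesis using Suc.prems r by simp
    qed
  next
    case False
    then have "{c \<in> carrier R. peval R as c = \<zero>} = {}" by blast
    then show ?thesis by (metis finite.emptyI)
  qed
qed simp

text \<open>Infinitely many roots force the last coefficient to vanish; it is dropped without
  changing the values, and the argument repeats. This is what lets lists and the functions they
  define be identified over infinite fields.\<close>

lemma infinite_roots_peval:
  assumes "set as \<subseteq> carrier R" "infinite {c \<in> carrier R. peval R as c = \<zero>}"
  shows "\<forall>a \<in> set as. a = \<zero>"
  using assms
proof (induction as rule: rev_induct)
  case (snoc a as)
  have az: "a = \<zero>" using finite_roots_peval[of "as @ [a]"] snoc.prems by auto
  have "peval R (as @ [a]) c = peval R as c" if "c \<in> carrier R" for c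
    using peval_append[of as "[a]" c] that snoc.prems(1) az by simp
  then have "{c \<in> carrier R. peval R (as @ [a]) c = \<zero>} = {c \<in> carrier R. peval R as c = \<zero>}"
    by auto
  then have "\<forall>a \<in> set as. a = \<zero>" using snoc.prems by (intro snoc.IH) auto
  then show ?case using az by (metis Un_iff empty_iff insert_iff list.set set_append)
qed simp

end

section \<open>Polynomials with coefficients in a ring of functions\<close>

text \<open>Lists of coefficients in a set \<open>A\<close> of functions, all evaluated at a point \<open>p\<close>; the base
  ring may vary with \<open>p\<close>.\<close>

definition poly_rep ::
    "('p \<Rightarrow> 'c ring) \<Rightarrow> 'p set \<Rightarrow> ('p \<Rightarrow> 'c) set \<Rightarrow> ('p \<Rightarrow> 'c) \<Rightarrow> ('p \<Rightarrow> 'c) \<Rightarrow> bool" where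
  "poly_rep R V A y f \<longleftrightarrow>
     (\<exists>as. set as \<subseteq> A \<and> (\<forall>p \<in> V. f p = peval (R p) (map (\<lambda>a. a p) as) (y p)))"

text \<open>Closure of polynomials in \<open>y\<close> under the ring operations is needed for three
  coefficient rings: constants of a single field, terms uniform in the field, and polynomial
  functions in one variable fewer. It is proved once here.\<close>

locale function_ring =
  fixes R :: "'p \<Rightarrow> 'c ring" and V :: "'p set" and A :: "('p \<Rightarrow> 'c) set" and y :: "'p \<Rightarrow> 'c"
  assumes cring_R: "p \<in> V \<Longrightarrow> cring (R p)"
    and A_closed: "a \<in> A \<Longrightarrow> p \<in> V \<Longrightarrow> a p \<in> carrier (R p)"
    and y_closed: "p \<in> V \<Longrightarrow> y p \<in> carrier (R p)"
    and A_zero: "(\<lambda>p. \<zero>\<^bsub>R p\<^esub>) \<in> A"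
    and A_one: "(\<lambda>p. \<one>\<^bsub>R p\<^esub>) \<in> A"
    and A_add: "a \<in> A \<Longrightarrow> b \<in> A \<Longrightarrow> (\<lambda>p. a p \<oplus>\<^bsub>R p\<^esub> b p) \<in> A"
    and A_mult: "a \<in> A \<Longrightarrow> b \<in> A \<Longrightarrow> (\<lambda>p. a p \<otimes>\<^bsub>R p\<^esub> b p) \<in> A"
begin

lemma peval_A_closed:
  assumes "set as \<subseteq> A" "p \<in> V"
  shows "peval (R p) (map (\<lambda>a. a p) as) (y p) \<in> carrier (R p)"
proof -
  interpret cring "R p" using cring_R assms(2) .
  show ?thesis using assms A_closed y_closed by (intro peval_closed) auto
qed

lemma poly_rep_const: "a \<in> A \<Longrightarrow> poly_rep R V A y a"
proof -
  assume a: "a \<in> A"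
  have "a p = peval (R p) (map (\<lambda>a. a p) [a]) (y p)" if p: "p \<in> V" for p
  proof -
    interpret cring "R p" using cring_R p .
    show ?thesis using a p A_closed y_closed by simp
  qed
  then show ?thesis unfolding poly_rep_def using a by (intro exI[of _ "[a]"]) auto
qed

lemma poly_rep_point: "poly_rep R V A y y"
proof -
  let ?l = "[(\<lambda>p. \<zero>\<^bsub>R p\<^esub>), (\<lambda>p. \<one>\<^bsub>R p\<^esub>)]"
  have "y p = peval (R p) (map (\<lambda>a. a p) ?l) (y p)" if p: "p \<in> V" for p
  proof -
    interpret cring "R p" using cring_R p .
    show ?thesis using p y_closed by simp
  qed
  then show ?thesis unfolding poly_rep_def using A_zero A_one by (intro exI[of _ ?l]) auto
qed

lemma poly_rep_add:
  assumes "poly_rep R V A y f" "poly_rep R V A y g"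
  shows "poly_rep R V A y (\<lambda>p. f p \<oplus>\<^bsub>R p\<^esub> g p)"
proof -
  have *: "\<exists>cs. set cs \<subseteq> A \<and> (\<forall>p \<in> V. peval (R p) (map (\<lambda>a. a p) as) (y p) \<oplus>\<^bsub>R p\<^esub>
      peval (R p) (map (\<lambda>a. a p) bs) (y p) = peval (R p) (map (\<lambda>a. a p) cs) (y p))"
    if "set as \<subseteq> A" "set bs \<subseteq> A" for as bs
    using that
  proof (induction as arbitrary: bs)
    case Nil
    have "\<zero>\<^bsub>R p\<^esub> \<oplus>\<^bsub>R p\<^esub> peval (R p) (map (\<lambda>a. a p) bs) (y p) = peval (R p) (map (\<lambda>a. a p) bs) (y p)"
      if p: "p \<in> V" for p
    proof -
      interpret cring "R p" using cring_R p .
      show ?thesis using Nil p y_closed A_closed by (intro l_zero peval_closed) auto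
    qed
    then show ?case using Nil by (intro exI[of _ bs]) auto
  next
    case (Cons a as)
    show ?case
    proof (cases bs)
      case Nil
      have "peval (R p) (map (\<lambda>a. a p) (a # as)) (y p) \<oplus>\<^bsub>R p\<^esub> \<zero>\<^bsub>R p\<^esub>
          = peval (R p) (map (\<lambda>a. a p) (a # as)) (y p)"
        if p: "p \<in> V" for p
      proof -
        interpret cring "R p" using cring_R p .
        show ?thesis using Cons p y_closed A_closed by (intro r_zero peval_closed) auto
      qed
      then show ?thesis using Nil Cons.prems by (intro exI[of _ "a # as"]) auto
    next
      case 2: (Cons b bs')
      obtain cs where cs: "set cs \<subseteq> A"
        "\<And>p. p \<in> V \<Longrightarrow> peval (R p) (map (\<lambda>a. a p) as) (y p) \<oplus>\<^bsub>R p\<^esub>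
            peval (R p) (map (\<lambda>a. a p) bs') (y p) = peval (R p) (map (\<lambda>a. a p) cs) (y p)"
        using Cons.IH[of bs'] Cons.prems 2 by auto
      have "peval (R p) (map (\<lambda>a. a p) (a # as)) (y p) \<oplus>\<^bsub>R p\<^esub> peval (R p) (map (\<lambda>a. a p) bs) (y p)
          = peval (R p) (map (\<lambda>a. a p) ((\<lambda>p. a p \<oplus>\<^bsub>R p\<^esub> b p) # cs)) (y p)" if p: "p \<in> V" for p
      proof -
        interpret cring "R p" using cring_R p .
        define P Q where "P = peval (R p) (map (\<lambda>a. a p) as) (y p)"
          and "Q = peval (R p) (map (\<lambda>a. a p) bs') (y p)"
        have c: "P \<in> carrier (R p)" "Q \<in> carrier (R p)" "a p \<in> carrier (R p)" "b p \<in> carrier (R p)"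
          "y p \<in> carrier (R p)"
          unfolding P_def Q_def using Cons.prems p y_closed A_closed 2 peval_A_closed by auto
        have "(a p \<oplus>\<^bsub>R p\<^esub> y p \<otimes>\<^bsub>R p\<^esub> P) \<oplus>\<^bsub>R p\<^esub> (b p \<oplus>\<^bsub>R p\<^esub> y p \<otimes>\<^bsub>R p\<^esub> Q)
            = (a p \<oplus>\<^bsub>R p\<^esub> b p) \<oplus>\<^bsub>R p\<^esub> y p \<otimes>\<^bsub>R p\<^esub> (P \<oplus>\<^bsub>R p\<^esub> Q)"
          using c by (simp add: cring_norm)
        then show ?thesis using cs(2)[OF p] 2 unfolding P_def Q_def by simp
      qed
      then show ?thesis using cs(1) Cons.prems 2 A_add
        by (intro exI[of _ "(\<lambda>p. a p \<oplus>\<^bsub>R p\<^esub> b p) # cs"]) auto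
    qed
  qed
  from assms obtain as bs where "set as \<subseteq> A" "set bs \<subseteq> A"
    and f: "\<And>p. p \<in> V \<Longrightarrow> f p = peval (R p) (map (\<lambda>a. a p) as) (y p)"
    and g: "\<And>p. p \<in> V \<Longrightarrow> g p = peval (R p) (map (\<lambda>a. a p) bs) (y p)"
    unfolding poly_rep_def by metis
  with * show ?thesis unfolding poly_rep_def by (simp add: f g)
qed

lemma poly_rep_shift:
  assumes "poly_rep R V A y f"
  shows "poly_rep R V A y (\<lambda>p. y p \<otimes>\<^bsub>R p\<^esub> f p)"
proof -
  obtain as where as: "set as \<subseteq> A"
    and f: "\<And>p. p \<in> V \<Longrightarrow> f p = peval (R p) (map (\<lambda>a. a p) as) (y p)"
    using assms unfolding poly_rep_def by metis
  let ?l = "(\<lambda>p. \<zero>\<^bsub>R p\<^esub>) # as"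
  have "y p \<otimes>\<^bsub>R p\<^esub> f p = peval (R p) (map (\<lambda>a. a p) ?l) (y p)" if p: "p \<in> V" for p
  proof -
    interpret cring "R p" using cring_R p .
    have "peval (R p) (map (\<lambda>a. a p) as) (y p) \<in> carrier (R p)"
      using as p y_closed A_closed by (intro peval_closed) auto
    then show ?thesis using f p y_closed by simp
  qed
  then show ?thesis unfolding poly_rep_def using as A_zero by (intro exI[of _ ?l]) auto
qed

lemma poly_rep_cong:
  "poly_rep R V A y f \<Longrightarrow> (\<And>p. p \<in> V \<Longrightarrow> f p = g p) \<Longrightarrow> poly_rep R V A y g"
  unfolding poly_rep_def by auto

lemma poly_rep_smult:
  assumes "poly_rep R V A y f" "a \<in> A"
  shows "poly_rep R V A y (\<lambda>p. a p \<otimes>\<^bsub>R p\<^esub> f p)"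
proof -
  obtain as where as: "set as \<subseteq> A"
    and f: "\<And>p. p \<in> V \<Longrightarrow> f p = peval (R p) (map (\<lambda>a. a p) as) (y p)"
    using assms unfolding poly_rep_def by metis
  let ?l = "map (\<lambda>b p. a p \<otimes>\<^bsub>R p\<^esub> b p) as"
  have "a p \<otimes>\<^bsub>R p\<^esub> f p = peval (R p) (map (\<lambda>a. a p) ?l) (y p)" if p: "p \<in> V" for p
  proof -
    interpret cring "R p" using cring_R p .
    have "peval (R p) (map ((\<otimes>\<^bsub>R p\<^esub>) (a p)) (map (\<lambda>a. a p) as)) (y p)
        = a p \<otimes>\<^bsub>R p\<^esub> peval (R p) (map (\<lambda>a. a p) as) (y p)"
      using as p y_closed A_closed assms(2) by (intro peval_smult) auto
    then show ?thesis using f p by (simp add: comp_def)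
  qed
  moreover have "set ?l \<subseteq> A" using as A_mult assms(2) by auto
  ultimately show ?thesis unfolding poly_rep_def by (intro exI[of _ ?l]) auto
qed

lemma poly_rep_mult:
  assumes "poly_rep R V A y f" "poly_rep R V A y g"
  shows "poly_rep R V A y (\<lambda>p. f p \<otimes>\<^bsub>R p\<^esub> g p)"
proof -
  have *: "poly_rep R V A y (\<lambda>p. peval (R p) (map (\<lambda>a. a p) as) (y p) \<otimes>\<^bsub>R p\<^esub> g p)"
    if "set as \<subseteq> A" for as
    using that
  proof (induction as)
    case Nil
    have "poly_rep R V A y (\<lambda>p. \<zero>\<^bsub>R p\<^esub>)" using poly_rep_const A_zero by blast
    moreover have "\<zero>\<^bsub>R p\<^esub> = \<zero>\<^bsub>R p\<^esub> \<otimes>\<^bsub>R p\<^esub> g p" if p: "p \<in> V" for p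
    proof -
      interpret cring "R p" using cring_R p .
      obtain bs where "set bs \<subseteq> A" "g p = peval (R p) (map (\<lambda>a. a p) bs) (y p)"
        using assms(2) p unfolding poly_rep_def by metis
      then have "g p \<in> carrier (R p)" using p peval_A_closed by auto
      then show ?thesis by simp
    qed
    ultimately show ?case by (auto intro: poly_rep_cong)
  next
    case (Cons a as)
    let ?h = "\<lambda>p. peval (R p) (map (\<lambda>a. a p) as) (y p)"
    \<comment> \<open>Horner form of the first factor: (a + y h) g = a g + y (h g).\<close>
    have "poly_rep R V A y (\<lambda>p. a p \<otimes>\<^bsub>R p\<^esub> g p \<oplus>\<^bsub>R p\<^esub> y p \<otimes>\<^bsub>R p\<^esub> (?h p \<otimes>\<^bsub>R p\<^esub> g p))"
      using poly_rep_add[OF poly_rep_smult[OF assms(2), of a] poly_rep_shift[OF Cons.IH]] Cons.prems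
      by simp
    moreover have "a p \<otimes>\<^bsub>R p\<^esub> g p \<oplus>\<^bsub>R p\<^esub> y p \<otimes>\<^bsub>R p\<^esub> (?h p \<otimes>\<^bsub>R p\<^esub> g p)
        = (a p \<oplus>\<^bsub>R p\<^esub> y p \<otimes>\<^bsub>R p\<^esub> ?h p) \<otimes>\<^bsub>R p\<^esub> g p" if p: "p \<in> V" for p
    proof -
      interpret cring "R p" using cring_R p .
      obtain bs where "set bs \<subseteq> A" "g p = peval (R p) (map (\<lambda>a. a p) bs) (y p)"
        using assms(2) p unfolding poly_rep_def by metis
      then have "g p \<in> carrier (R p)" using p peval_A_closed by auto
      moreover have "?h p \<in> carrier (R p)" "a p \<in> carrier (R p)"
        using Cons.prems p A_closed peval_A_closed by auto
      ultimately show ?thesis using p y_closed[of p] by (simp add: cring_norm)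
    qed
    ultimately show ?case by (auto intro: poly_rep_cong)
  qed
  obtain as where "set as \<subseteq> A" "\<forall>p \<in> V. f p = peval (R p) (map (\<lambda>a. a p) as) (y p)"
    using assms(1) unfolding poly_rep_def by blast
  then show ?thesis using *[of as] by (auto intro: poly_rep_cong)
qed

end

section \<open>Polynomial functions on an algebraically closed field\<close>

text \<open>The leading coefficient \<open>a\<close> is split off and \<open>as \<noteq> []\<close>
  says that the degree is positive. Only evaluation of lists occurs, so the property moves easily
  along a bijection of carriers.\<close>

locale acf = field R for R :: "'a ring" (structure) +
  assumes exists_root: "set as \<subseteq> carrier R \<Longrightarrow> as \<noteq> [] \<Longrightarrow> a \<in> carrier R \<Longrightarrow> a \<noteq> \<zero> \<Longrightarrow>
    \<exists>c \<in> carrier R. peval R (as @ [a]) c = \<zero>"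
begin

abbreviation "pfun \<equiv> poly_rep (\<lambda>_. R) (carrier R) ((\<lambda>a _. a) ` carrier R) (\<lambda>c. c)"

sublocale pf: function_ring "\<lambda>_. R" "carrier R" "(\<lambda>a _. a) ` carrier R" "\<lambda>c. c"
  by unfold_locales (auto intro: is_cring)

lemma pfun_iff: "pfun f \<longleftrightarrow> (\<exists>as. set as \<subseteq> carrier R \<and> (\<forall>c \<in> carrier R. f c = peval R as c))"
proof
  assume "pfun f"
  then obtain as where as: "set as \<subseteq> (\<lambda>a _. a) ` carrier R"
    "\<forall>c \<in> carrier R. f c = peval R (map (\<lambda>a. a c) as) c"
    unfolding poly_rep_def by blast
  define bs where "bs = map (\<lambda>a. a \<zero>) as"
  have "as = map (\<lambda>b _. b) bs" using as(1) unfolding bs_def map_map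
    by (intro map_idI[symmetric]) auto
  moreover have "set bs \<subseteq> carrier R" using as(1) unfolding bs_def by auto
  ultimately show "\<exists>as. set as \<subseteq> carrier R \<and> (\<forall>c \<in> carrier R. f c = peval R as c)"
    using as(2) by (intro exI[of _ bs]) (auto simp: comp_def)
next
  assume "\<exists>as. set as \<subseteq> carrier R \<and> (\<forall>c \<in> carrier R. f c = peval R as c)"
  then obtain as where "set as \<subseteq> carrier R" "\<forall>c \<in> carrier R. f c = peval R as c" by blast
  then show "pfun f" unfolding poly_rep_def
    by (intro exI[of _ "map (\<lambda>b _. b) as"]) (auto simp: comp_def)
qed

lemma pfun_peval: "set as \<subseteq> carrier R \<Longrightarrow> pfun (peval R as)"
  by (auto simp: pfun_iff)

lemma pfun_const: "a \<in> carrier R \<Longrightarrow> pfun (\<lambda>_. a)"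
  by (intro pf.poly_rep_const) auto

lemma pfun_closed: "pfun f \<Longrightarrow> c \<in> carrier R \<Longrightarrow> f c \<in> carrier R"
  by (auto simp: pfun_iff)

lemma pfun_pow: "pfun f \<Longrightarrow> pfun (\<lambda>c. f c [^] (n::nat))"
  by (induction n) (auto intro: pfun_const pf.poly_rep_mult)

text \<open>Over a finite field, 1 plus the product of all X - x would be a polynomial of positive
  degree without a root.\<close>

lemma infinite_carrier: "infinite (carrier R)"
proof
  assume fin: "finite (carrier R)"
  have *: "\<exists>l. set l \<subseteq> carrier R \<and> length l = Suc (card Z) \<and> last l = \<one> \<and> (\<forall>c \<in> Z. peval R l c = \<zero>)"
    if "finite Z" "Z \<subseteq> carrier R" for Z
    using that
  proof (induction Z)
    case empty
    then show ?case by (intro exI[of _ "[\<one>]"]) auto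
  next
    case (insert x Z)
    then obtain l where l: "set l \<subseteq> carrier R" "length l = Suc (card Z)" "last l = \<one>"
      "\<forall>c \<in> Z. peval R l c = \<zero>" by auto
    have x: "x \<in> carrier R" and Z: "Z \<subseteq> carrier R" and ne: "l \<noteq> []" using insert.prems l(2) by auto
    \<comment> \<open>Coefficients of (X - x) l: the list \<open>\<zero> # l\<close> is X l, and
      \<open>l @ [\<zero>]\<close> is l padded to the same length.\<close>
    let ?m = "map2 (\<lambda>u v. \<one> \<otimes> u \<ominus> x \<otimes> v) (\<zero> # l) (l @ [\<zero>])"
    have "peval R ?m c = (c \<ominus> x) \<otimes> peval R l c" if c: "c \<in> carrier R" for c
    proof -
      have "peval R ?m c = \<one> \<otimes> peval R (\<zero> # l) c \<ominus> x \<otimes> peval R (l @ [\<zero>]) c"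
        using l(1) x c by (intro peval_lincomb) auto
      then show ?thesis using l(1) x c peval_closed[OF l(1) c]
        by (simp add: peval_append cring_norm)
    qed
    then have "\<forall>c \<in> insert x Z. peval R ?m c = \<zero>"
      using l(1,4) x Z peval_closed[OF l(1) x] by (auto simp: r_neg a_minus_def)
    moreover have "set ?m \<subseteq> carrier R"
      using l(1) x by (intro lincomb_closed) auto
    moreover have "last ?m = \<one>"
      using l(3) ne x by (simp add: last_map last_zip a_minus_def)
    ultimately show ?case using l(2) insert.hyps by (intro exI[of _ ?m]) auto
  qed
  obtain l where l: "set l \<subseteq> carrier R" "length l = Suc (card (carrier R))" "last l = \<one>"
    "\<forall>c \<in> carrier R. peval R l c = \<zero>" using *[OF fin] by blast
  \<comment> \<open>The carrier is not empty, so the product has positive degree and its constant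
    coefficient \<open>a\<close> is not the leading one; adding 1 to \<open>a\<close> keeps the
    polynomial monic.\<close>
  have "card (carrier R) \<noteq> 0" using fin by auto
  then obtain a m where m: "l = a # m @ [\<one>]" using l(2,3)
    by (cases l; cases "tl l" rule: rev_cases) auto
  obtain c where c: "c \<in> carrier R" "peval R (((a \<oplus> \<one>) # m) @ [\<one>]) c = \<zero>"
    using exists_root[of "(a \<oplus> \<one>) # m" \<one>] l(1) m by auto
  have "peval R ((a \<oplus> \<one>) # m @ [\<one>]) c = peval R l c \<oplus> \<one>"
    using l(1) c(1) unfolding m by (auto simp: cring_norm intro!: peval_closed)
  then show False using c l(4) by auto
qed

text \<open>This makes the condition that all roots of \<open>p\<close> are roots of \<open>q\<close> decidable by one division
  with remainder, of \<open>q ^ deg p\<close> by \<open>p\<close>.\<close>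

lemma roots_subset_imp_divides_power:
  assumes "set p \<subseteq> carrier R" "a \<in> carrier R" "a \<noteq> \<zero>" "set q \<subseteq> carrier R"
    and "\<And>c. c \<in> carrier R \<Longrightarrow> peval R (p @ [a]) c = \<zero> \<Longrightarrow> peval R q c = \<zero>"
  shows "\<exists>s. pfun s \<and> (\<forall>c \<in> carrier R. peval R q c [^] length p = s c \<otimes> peval R (p @ [a]) c)"
  using assms
proof (induction "length p" arbitrary: p q)
  case 0
  then show ?case by (intro exI[of _ "\<lambda>_. inv a"]) (auto intro: pfun_const simp: field_Units)
next
  case (Suc n)
  then obtain r where r: "r \<in> carrier R" "peval R (p @ [a]) r = \<zero>"
    using exists_root[of p a] by fastforce
  obtain bs where bs: "set bs \<subseteq> carrier R" "length bs = length (p @ [a]) - 1"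
      "length (p @ [a]) \<ge> 2 \<Longrightarrow> last bs = last (p @ [a])"
      "\<And>c. c \<in> carrier R \<Longrightarrow> peval R (p @ [a]) c = (c \<ominus> r) \<otimes> peval R bs c \<oplus> peval R (p @ [a]) r"
    using peval_divide_linear[of "p @ [a]" r] Suc.prems(1,2) r(1) by (simp, blast)
  have "bs \<noteq> []" "last bs = a" using bs(2,3) Suc.hyps(2) by auto
  then obtain p' where p': "bs = p' @ [a]" by (cases bs rule: rev_cases) auto
  have p'c: "set p' \<subseteq> carrier R" "length p' = n" using bs(1,2) p' Suc.hyps(2) by auto
  obtain q1 where q1: "set q1 \<subseteq> carrier R"
      "\<And>c. c \<in> carrier R \<Longrightarrow> peval R q c = (c \<ominus> r) \<otimes> peval R q1 c \<oplus> peval R q r"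
    using peval_divide_linear[OF Suc.prems(4) r(1)] by blast
  \<comment> \<open>Since r is also a root of q, the factor X - r splits off both. The additional
    factor q in the power of q pays for the factor that p loses.\<close>
  have qr: "peval R q r = \<zero>" using Suc.prems(5) r by blast
  have pe: "peval R (p @ [a]) c = (c \<ominus> r) \<otimes> peval R (p' @ [a]) c" if "c \<in> carrier R" for c
    using bs(4)[OF that] r bs(1) that p' by auto
  have "peval R q c = \<zero>" if "c \<in> carrier R" "peval R (p' @ [a]) c = \<zero>" for c
    using Suc.prems(5)[of c] pe[of c] that r(1) by simp
  then obtain s where s: "pfun s"
      "\<And>c. c \<in> carrier R \<Longrightarrow> peval R q c [^] n = s c \<otimes> peval R (p' @ [a]) c"
    using Suc.hyps(1)[of p' q] p'c Suc.prems by metis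
  have "peval R q c [^] length p = (peval R q1 c \<otimes> s c) \<otimes> peval R (p @ [a]) c" if c: "c \<in> carrier R" for c
  proof -
    have [simp]: "peval R q1 c \<in> carrier R" "s c \<in> carrier R" "peval R (p' @ [a]) c \<in> carrier R"
      using q1(1) c pfun_closed[OF s(1) c] bs(1) p' by auto
    have "peval R q c = (c \<ominus> r) \<otimes> peval R q1 c" using q1(2)[OF c] qr c r(1) by simp
    then have "peval R q c [^] Suc n = (s c \<otimes> peval R (p' @ [a]) c) \<otimes> ((c \<ominus> r) \<otimes> peval R q1 c)"
      using s(2)[OF c] by simp
    also have "\<dots> = (peval R q1 c \<otimes> s c) \<otimes> ((c \<ominus> r) \<otimes> peval R (p' @ [a]) c)"
      using c r(1) by (simp add: m_ac)
    finally show ?thesis using Suc.hyps(2) pe[OF c] by simp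
  qed
  moreover have "pfun (\<lambda>c. peval R q1 c \<otimes> s c)"
    using s(1) q1(1) by (intro pf.poly_rep_mult pfun_peval)
  ultimately show ?case by blast
qed

text \<open>A degree argument in which the quotient \<open>s\<close> is known only as a function: a
  root of the divisor is cancelled on both sides, which shortens divisor and dividend together,
  until the dividend is the empty list.\<close>

lemma divides_smaller_degree_imp_zero:
  assumes "set p \<subseteq> carrier R" "a \<in> carrier R" "a \<noteq> \<zero>" "set q \<subseteq> carrier R" "length q \<le> length p"
    and "pfun s" "\<And>c. c \<in> carrier R \<Longrightarrow> peval R q c = s c \<otimes> peval R (p @ [a]) c"
  shows "\<forall>b \<in> set q. b = \<zero>"
  using assms
proof (induction "length p" arbitrary: p q)
  case (Suc n)
  then obtain r where r: "r \<in> carrier R" "peval R (p @ [a]) r = \<zero>"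
    using exists_root[of p a] by fastforce
  obtain bs where bs: "set bs \<subseteq> carrier R" "length bs = length (p @ [a]) - 1"
      "length (p @ [a]) \<ge> 2 \<Longrightarrow> last bs = last (p @ [a])"
      "\<And>c. c \<in> carrier R \<Longrightarrow> peval R (p @ [a]) c = (c \<ominus> r) \<otimes> peval R bs c \<oplus> peval R (p @ [a]) r"
    using peval_divide_linear[of "p @ [a]" r] Suc.prems(1,2) r(1) by (simp, blast)
  have "bs \<noteq> []" "last bs = a" using bs(2,3) Suc.hyps(2) by auto
  then obtain p' where p': "bs = p' @ [a]" by (cases bs rule: rev_cases) auto
  have p'c: "set p' \<subseteq> carrier R" "length p' = n" using bs(1,2) p' Suc.hyps(2) by auto
  obtain q1 where q1: "set q1 \<subseteq> carrier R" "length q1 = length q - 1"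
      "\<And>c. c \<in> carrier R \<Longrightarrow> peval R q c = (c \<ominus> r) \<otimes> peval R q1 c \<oplus> peval R q r"
    using peval_divide_linear[OF Suc.prems(4) r(1)] by blast
  have "peval R q r = \<zero>"
  proof -
    have "peval R q r = s r \<otimes> peval R (p @ [a]) r" by (rule Suc.prems(7)[OF r(1)])
    then show ?thesis unfolding r(2) by (rule trans[OF _ r_null[OF pfun_closed[OF Suc.prems(6) r(1)]]])
  qed
  then have qe: "peval R q c = (c \<ominus> r) \<otimes> peval R q1 c" if "c \<in> carrier R" for c
    using q1(3)[OF that] q1(1) that r(1) by simp
  have pe: "peval R (p @ [a]) c = (c \<ominus> r) \<otimes> peval R (p' @ [a]) c" if "c \<in> carrier R" for c
    using bs(4)[OF that] r bs(1) that p' by auto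
  obtain ds where ds: "set ds \<subseteq> carrier R"
    "\<And>c. c \<in> carrier R \<Longrightarrow> peval R q1 c \<oplus> \<ominus> \<one> \<otimes> (s c \<otimes> peval R (p' @ [a]) c) = peval R ds c"
  proof -
    have "pfun (\<lambda>c. peval R q1 c \<oplus> \<ominus> \<one> \<otimes> (s c \<otimes> peval R (p' @ [a]) c))"
      using q1(1) bs(1) p' Suc.prems(6)
      by (intro pf.poly_rep_add pf.poly_rep_mult pfun_peval pfun_const) auto
    then show ?thesis using that unfolding pfun_iff by blast
  qed
  have cl: "peval R q1 c \<in> carrier R" "s c \<otimes> peval R (p' @ [a]) c \<in> carrier R" if "c \<in> carrier R" for c
    using that q1(1) bs(1) p' pfun_closed[OF Suc.prems(6)] by auto
  \<comment> \<open>Cancelling c - r gives the equality only for c \<noteq> r. The difference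
    \<open>ds\<close> is a polynomial with infinitely many zeros, hence zero, so the equality also
    holds at r.\<close>
  have "peval R ds c = \<zero>" if c: "c \<in> carrier R" "c \<noteq> r" for c
  proof -
    have "(c \<ominus> r) \<otimes> peval R q1 c = (c \<ominus> r) \<otimes> (s c \<otimes> peval R (p' @ [a]) c)"
      using qe[OF c(1)] pe[OF c(1)] Suc.prems(7)[OF c(1)] c(1) r(1) pfun_closed[OF Suc.prems(6) c(1)] bs(1) p'
      by (simp add: m_lcomm)
    moreover have "c \<ominus> r \<noteq> \<zero>" using c r(1) by auto
    ultimately have "peval R q1 c = s c \<otimes> peval R (p' @ [a]) c"
      using cl[OF c(1)] c(1) r(1) by (simp add: m_lcancel)
    then show ?thesis using ds(2)[OF c(1)] cl[OF c(1)] by (simp add: l_minus r_neg)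
  qed
  then have "carrier R - {r} \<subseteq> {c \<in> carrier R. peval R ds c = \<zero>}" by blast
  then have "infinite {c \<in> carrier R. peval R ds c = \<zero>}"
    using infinite_carrier by (meson finite_Diff2 finite.emptyI finite.insertI finite_subset)
  then have dz: "\<forall>d \<in> set ds. d = \<zero>" using infinite_roots_peval ds(1) by blast
  have "peval R q1 c = s c \<otimes> peval R (p' @ [a]) c" if c: "c \<in> carrier R" for c
  proof -
    have "peval R q1 c \<oplus> \<ominus> (s c \<otimes> peval R (p' @ [a]) c) = \<zero>"
      using ds(2)[OF c] peval_all_zero[OF dz c] cl[OF c] by (simp add: l_minus)
    then show ?thesis using cl[OF c] by (metis a_minus_def r_right_minus_eq)
  qed
  note q1s = this
  have q1z: "\<forall>b \<in> set q1. b = \<zero>"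
  proof (rule Suc.hyps(1))
    show "n = length p'" "set p' \<subseteq> carrier R" using p'c by auto
    show "length q1 \<le> length p'" using p'c q1(2) Suc.prems(5) Suc.hyps(2) by simp
  qed (fact q1s q1(1) Suc.prems(2,3,6))+
  have "peval R q c = \<zero>" if "c \<in> carrier R" for c
    using qe[OF that] peval_all_zero[OF q1z that] that r(1) by simp
  then have "{c \<in> carrier R. peval R q c = \<zero>} = carrier R" by blast
  then show ?case using infinite_roots_peval[OF Suc.prems(4)] infinite_carrier by metis
next
  case 0
  then have "q = []" by simp
  then show ?case by (metis empty_iff list.set(1))
qed

end

section \<open>Uniform quantifier elimination\<close>

text \<open>Predicates are compared only at such pairs: \<open>upred\<close> is closed under
  changing a predicate elsewhere, where the operations of the record \<open>F\<close> are
  unconstrained.\<close>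

definition valid :: "'c ring \<Rightarrow> ('v \<Rightarrow> 'c) \<Rightarrow> bool" where
  "valid F e \<longleftrightarrow> acf F \<and> range e \<subseteq> carrier F"

text \<open>Integer polynomials and quantifier-free formulas of the language of rings in variables of
  type \<open>'v\<close>, given by their values: the argument \<open>F\<close> ranges over all fields on subsets of
  \<open>'c\<close>, so that one such object has a meaning in all these fields at once.\<close>

inductive_set uterm :: "('c ring \<Rightarrow> ('v \<Rightarrow> 'c) \<Rightarrow> 'c) set" where
  var: "(\<lambda>F e. e v) \<in> uterm"
| zero: "(\<lambda>F e. \<zero>\<^bsub>F\<^esub>) \<in> uterm"
| one: "(\<lambda>F e. \<one>\<^bsub>F\<^esub>) \<in> uterm"
| add: "s \<in> uterm \<Longrightarrow> t \<in> uterm \<Longrightarrow> (\<lambda>F e. s F e \<oplus>\<^bsub>F\<^esub> t F e) \<in> uterm"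
| mult: "s \<in> uterm \<Longrightarrow> t \<in> uterm \<Longrightarrow> (\<lambda>F e. s F e \<otimes>\<^bsub>F\<^esub> t F e) \<in> uterm"
| uminus: "t \<in> uterm \<Longrightarrow> (\<lambda>F e. \<ominus>\<^bsub>F\<^esub> t F e) \<in> uterm"

inductive upred :: "('c ring \<Rightarrow> ('v \<Rightarrow> 'c) \<Rightarrow> bool) \<Rightarrow> bool" where
  eq_zero: "t \<in> uterm \<Longrightarrow> upred (\<lambda>F e. t F e = \<zero>\<^bsub>F\<^esub>)"
| neg: "upred P \<Longrightarrow> upred (\<lambda>F e. \<not> P F e)"
| conj: "upred P \<Longrightarrow> upred Q \<Longrightarrow> upred (\<lambda>F e. P F e \<and> Q F e)"
| cong: "upred P \<Longrightarrow> (\<And>F e. valid F e \<Longrightarrow> P F e = Q F e) \<Longrightarrow> upred Q"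

lemma validD:
  assumes "valid F e" shows "acf F" "cring F" "e v \<in> carrier F"
proof -
  interpret acf F using assms unfolding valid_def by blast
  show "acf F" "cring F" by unfold_locales
  show "e v \<in> carrier F" using assms unfolding valid_def by blast
qed

lemma valid_upd: "valid F e \<Longrightarrow> c \<in> carrier F \<Longrightarrow> valid F (e(v := c))"
  unfolding valid_def by auto

lemma uterm_closed:
  assumes "t \<in> uterm" "valid F e" shows "t F e \<in> carrier F"
proof -
  interpret cring F using assms(2) validD by blast
  show ?thesis using assms(1) by induction (auto simp: validD[OF assms(2)])
qed

lemma upred_disj: "upred P \<Longrightarrow> upred Q \<Longrightarrow> upred (\<lambda>F e. P F e \<or> Q F e)"
  using neg[OF conj[OF neg neg], of P Q] by simp

lemma upred_imp: "upred P \<Longrightarrow> upred Q \<Longrightarrow> upred (\<lambda>F e. P F e \<longrightarrow> Q F e)"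
  using neg[OF conj[OF _ neg], of P Q] by simp

lemma upred_const: "upred (\<lambda>F e. b)"
proof -
  have T: "upred (\<lambda>F e. True)"
    by (rule cong[OF eq_zero[OF zero]]) simp
  show ?thesis using T neg[OF T] by (cases b) auto
qed

lemma upred_Ball:
  assumes "finite S" "\<And>s. s \<in> S \<Longrightarrow> upred (P s)"
  shows "upred (\<lambda>F e. \<forall>s \<in> S. P s F e)"
  using assms by (induction S) (auto intro: upred_const conj)

lemma upred_Bex:
  assumes "finite S" "\<And>s. s \<in> S \<Longrightarrow> upred (P s)"
  shows "upred (\<lambda>F e. \<exists>s \<in> S. P s F e)"
  using assms by (induction S) (auto intro: upred_const upred_disj)

lemma uterm_minus: "s \<in> uterm \<Longrightarrow> t \<in> uterm \<Longrightarrow> (\<lambda>F e. s F e \<ominus>\<^bsub>F\<^esub> t F e) \<in> uterm"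
  unfolding a_minus_def by (intro add uminus)

lemma upred_eq:
  fixes s t :: "'c ring \<Rightarrow> ('v \<Rightarrow> 'c) \<Rightarrow> 'c"
  assumes "s \<in> uterm" "t \<in> uterm" shows "upred (\<lambda>F e. s F e = t F e)"
proof (rule cong[OF eq_zero[OF uterm_minus[OF assms]]])
  fix F :: "'c ring" and e :: "'v \<Rightarrow> 'c" assume v: "valid F e"
  then interpret cring F by (rule validD)
  show "(s F e \<ominus>\<^bsub>F\<^esub> t F e = \<zero>\<^bsub>F\<^esub>) = (s F e = t F e)"
    using uterm_closed[OF assms(1) v] uterm_closed[OF assms(2) v] by simp
qed

section \<open>Disjunctive normal forms\<close>

text \<open>One disjunct of a normal form: a finite set of equations and a single inequation. One is
  enough, because a product in a field is nonzero exactly if all factors are.\<close>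

definition holds ::
    "('c ring \<Rightarrow> ('v \<Rightarrow> 'c) \<Rightarrow> 'c) set \<times> ('c ring \<Rightarrow> ('v \<Rightarrow> 'c) \<Rightarrow> 'c) \<Rightarrow> 'c ring \<Rightarrow> ('v \<Rightarrow> 'c) \<Rightarrow> bool" where
  "holds d F e \<longleftrightarrow> (\<forall>t \<in> fst d. t F e = \<zero>\<^bsub>F\<^esub>) \<and> snd d F e \<noteq> \<zero>\<^bsub>F\<^esub>"

definition dnf_rep where
  "dnf_rep D P \<longleftrightarrow> finite D \<and> (\<forall>d \<in> D. finite (fst d) \<and> fst d \<subseteq> uterm \<and> snd d \<in> uterm) \<and>
     (\<forall>F e. valid F e \<longrightarrow> P F e = (\<exists>d \<in> D. holds d F e))"

lemma dnf_rep_cong: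
  "dnf_rep D P \<Longrightarrow> (\<And>F e. valid F e \<Longrightarrow> P F e = Q F e) \<Longrightarrow> dnf_rep D Q"
  unfolding dnf_rep_def by auto

lemma dnf_rep_disj:
  assumes "dnf_rep D P" "dnf_rep E Q" shows "dnf_rep (D \<union> E) (\<lambda>F e. P F e \<or> Q F e)"
  using assms unfolding dnf_rep_def by (simp add: bex_Un ball_Un)

lemma dnf_rep_conj:
  fixes P Q :: "'c ring \<Rightarrow> ('v \<Rightarrow> 'c) \<Rightarrow> bool"
  assumes D: "dnf_rep D P" and E: "dnf_rep E Q"
  shows "dnf_rep ((\<lambda>(d, d'). (fst d \<union> fst d', \<lambda>F e. snd d F e \<otimes>\<^bsub>F\<^esub> snd d' F e)) ` (D \<times> E))
    (\<lambda>F e. P F e \<and> Q F e)"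
proof -
  let ?f = "\<lambda>(d, d'). (fst d \<union> fst d', \<lambda>F e. snd d F e \<otimes>\<^bsub>F\<^esub> snd d' F e)"
  have *: "holds (?f (d, d')) F e \<longleftrightarrow> holds d F e \<and> holds d' F e"
    if "d \<in> D" "d' \<in> E" "valid F e" for d d' and F :: "'c ring" and e :: "'v \<Rightarrow> 'c"
  proof -
    interpret acf F using that(3) by (rule validD)
    have "snd d \<in> uterm" "snd d' \<in> uterm" using that assms unfolding dnf_rep_def by blast+
    then have "snd d F e \<otimes>\<^bsub>F\<^esub> snd d' F e \<noteq> \<zero>\<^bsub>F\<^esub> \<longleftrightarrow> snd d F e \<noteq> \<zero>\<^bsub>F\<^esub> \<and> snd d' F e \<noteq> \<zero>\<^bsub>F\<^esub>"
      using uterm_closed[OF _ that(3)] by (simp add: integral_iff)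
    then show ?thesis unfolding holds_def by auto
  qed
  show ?thesis unfolding dnf_rep_def
  proof (intro conjI allI impI)
    show "finite (?f ` (D \<times> E))" using assms unfolding dnf_rep_def by simp
    show "\<forall>d \<in> ?f ` (D \<times> E). finite (fst d) \<and> fst d \<subseteq> uterm \<and> snd d \<in> uterm"
      using assms unfolding dnf_rep_def by (auto intro!: mult)
    fix F :: "'c ring" and e :: "'v \<Rightarrow> 'c" assume v: "valid F e"
    have "(P F e \<and> Q F e) \<longleftrightarrow> (\<exists>d \<in> D. holds d F e) \<and> (\<exists>d' \<in> E. holds d' F e)"
      using assms v unfolding dnf_rep_def by simp
    also have "\<dots> \<longleftrightarrow> (\<exists>d \<in> D. \<exists>d' \<in> E. holds (?f (d, d')) F e)"
      using *[OF _ _ v] by blast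
    also have "\<dots> \<longleftrightarrow> (\<exists>p \<in> D \<times> E. holds (?f p) F e)" by blast
    also have "\<dots> \<longleftrightarrow> (\<exists>d \<in> ?f ` (D \<times> E). holds d F e)" by blast
    finally show "(P F e \<and> Q F e) = (\<exists>d \<in> ?f ` (D \<times> E). holds d F e)" .
  qed
qed

lemma dnf_rep_eq_zero:
  assumes "t \<in> uterm" shows "dnf_rep {({t}, \<lambda>F e. \<one>\<^bsub>F\<^esub>)} (\<lambda>F e. t F e = \<zero>\<^bsub>F\<^esub>)"
proof -
  have "\<one>\<^bsub>F\<^esub> \<noteq> \<zero>\<^bsub>F\<^esub>" if "valid F e" for F :: "'a ring" and e :: "'b \<Rightarrow> 'a"
  proof -
    interpret acf F using that by (rule validD)
    show ?thesis by simp
  qed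
  then show ?thesis using assms one unfolding dnf_rep_def holds_def by auto
qed

lemma dnf_rep_neq_zero:
  assumes "t \<in> uterm" shows "dnf_rep {({}, t)} (\<lambda>F e. t F e \<noteq> \<zero>\<^bsub>F\<^esub>)"
  using assms unfolding dnf_rep_def holds_def by auto

lemma dnf_rep_Bex:
  assumes "finite S" "\<And>s. s \<in> S \<Longrightarrow> \<exists>D. dnf_rep D (P s)"
  shows "\<exists>D. dnf_rep D (\<lambda>F e. \<exists>s \<in> S. P s F e)"
  using assms
proof (induction S)
  case empty
  show ?case by (rule exI[of _ "{}"]) (simp add: dnf_rep_def)
next
  case (insert s S)
  then obtain D E where "dnf_rep D (P s)" "dnf_rep E (\<lambda>F e. \<exists>s \<in> S. P s F e)" by blast
  from dnf_rep_disj[OF this] show ?case by (simp only: bex_simps) (rule exI)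
qed

lemma dnf_rep_Ball:
  assumes "finite S" "\<And>s. s \<in> S \<Longrightarrow> \<exists>D. dnf_rep D (P s)"
  shows "\<exists>D. dnf_rep D (\<lambda>F e. \<forall>s \<in> S. P s F e)"
  using assms
proof (induction S)
  case empty
  show ?case using dnf_rep_cong[OF dnf_rep_eq_zero[OF zero], of "\<lambda>F e. \<forall>s \<in> {}. P s F e"] by auto
next
  case (insert s S)
  then obtain D E where "dnf_rep D (P s)" "dnf_rep E (\<lambda>F e. \<forall>s \<in> S. P s F e)" by blast
  from dnf_rep_conj[OF this] show ?case by (simp only: ball_simps) (rule exI)
qed

lemma dnf_rep_neg:
  assumes D: "dnf_rep D P" shows "\<exists>D. dnf_rep D (\<lambda>F e. \<not> P F e)"
proof -
  have "\<exists>E. dnf_rep E (\<lambda>F e. \<forall>d \<in> D. (\<exists>t \<in> fst d. t F e \<noteq> \<zero>\<^bsub>F\<^esub>) \<or> snd d F e = \<zero>\<^bsub>F\<^esub>)"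
  proof (rule dnf_rep_Ball)
    fix d assume "d \<in> D"
    then have d: "finite (fst d)" "fst d \<subseteq> uterm" "snd d \<in> uterm"
      using D unfolding dnf_rep_def by blast+
    have "\<exists>E. dnf_rep E (\<lambda>F e. \<exists>t \<in> fst d. t F e \<noteq> \<zero>\<^bsub>F\<^esub>)"
      using d dnf_rep_neq_zero by (intro dnf_rep_Bex) blast+
    then show "\<exists>E. dnf_rep E (\<lambda>F e. (\<exists>t \<in> fst d. t F e \<noteq> \<zero>\<^bsub>F\<^esub>) \<or> snd d F e = \<zero>\<^bsub>F\<^esub>)"
      using dnf_rep_disj dnf_rep_eq_zero[OF d(3)] by blast
  qed (use D in \<open>simp add: dnf_rep_def\<close>)
  then obtain E where
    "dnf_rep E (\<lambda>F e. \<forall>d \<in> D. (\<exists>t \<in> fst d. t F e \<noteq> \<zero>\<^bsub>F\<^esub>) \<or> snd d F e = \<zero>\<^bsub>F\<^esub>)" by blast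
  then have "dnf_rep E (\<lambda>F e. \<not> P F e)"
    by (rule dnf_rep_cong) (use D in \<open>auto simp: dnf_rep_def holds_def\<close>)
  then show ?thesis by blast
qed

lemma upred_dnf: "upred P \<Longrightarrow> \<exists>D. dnf_rep D P"
proof (induction rule: upred.induct)
  case (eq_zero t)
  then show ?case using dnf_rep_eq_zero by blast
next
  case (neg P)
  then show ?case using dnf_rep_neg by blast
next
  case (conj P Q)
  then show ?case using dnf_rep_conj by blast
next
  case (cong P Q)
  then show ?case using dnf_rep_cong by metis
qed

section \<open>Polynomials in one variable with uniform coefficients\<close>

abbreviation (input) evl :: "'c ring \<Rightarrow> ('v \<Rightarrow> 'c) \<Rightarrow> ('c ring \<Rightarrow> ('v \<Rightarrow> 'c) \<Rightarrow> 'c) list \<Rightarrow> 'c \<Rightarrow> 'c" where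
  "evl F e p c \<equiv> peval F (map (\<lambda>a. a F e) p) c"

lemma map_uterm_closed:
  "set p \<subseteq> uterm \<Longrightarrow> valid F e \<Longrightarrow> set (map (\<lambda>a. a F e) p) \<subseteq> carrier F"
  using uterm_closed by auto

text \<open>The base points are triples of a field, an environment and a value of the distinguished
  variable. Coefficients depend on the first two alone, so arithmetic of coefficient lists is done
  for all fields simultaneously.\<close>

lemma univ_function_ring:
  "function_ring (fst :: 'c ring \<times> ('v \<Rightarrow> 'c) \<times> 'c \<Rightarrow> 'c ring) {(F, e, c). valid F e \<and> c \<in> carrier F}
     ((\<lambda>a p. a (fst p) (fst (snd p))) ` uterm) (\<lambda>p. snd (snd p))"
  (is "function_ring _ ?V ?A _")
proof (rule function_ring.intro)
  fix p :: "'c ring \<times> ('v \<Rightarrow> 'c) \<times> 'c" assume p: "p \<in> ?V"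
  then show "cring (fst p)" by (auto intro: validD(2))
next
  fix p :: "'c ring \<times> ('v \<Rightarrow> 'c) \<times> 'c" assume p: "p \<in> ?V"
  then show "snd (snd p) \<in> carrier (fst p)" by auto
next
  fix p :: "'c ring \<times> ('v \<Rightarrow> 'c) \<times> 'c" and a assume "a \<in> ?A" "p \<in> ?V"
  then show "a p \<in> carrier (fst p)" using uterm_closed by fastforce
next
  fix a b assume "a \<in> ?A" "b \<in> ?A"
  then obtain s t where st: "s \<in> uterm" "t \<in> uterm"
    and ab: "a = (\<lambda>p. s (fst p) (fst (snd p)))" "b = (\<lambda>p. t (fst p) (fst (snd p)))" by blast
  show "(\<lambda>p. a p \<oplus>\<^bsub>fst p\<^esub> b p) \<in> ?A"
    unfolding ab by (rule image_eqI[OF _ add[OF st]]) simp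
  show "(\<lambda>p. a p \<otimes>\<^bsub>fst p\<^esub> b p) \<in> ?A"
    unfolding ab by (rule image_eqI[OF _ mult[OF st]]) simp
next
  show "(\<lambda>p. \<zero>\<^bsub>fst p\<^esub>) \<in> ?A" by (rule image_eqI[OF _ zero]) simp
  show "(\<lambda>p. \<one>\<^bsub>fst p\<^esub>) \<in> ?A" by (rule image_eqI[OF _ one]) simp
qed

interpretation univ: function_ring fst "{(F, e, c). valid F e \<and> c \<in> carrier F}"
  "(\<lambda>a p. a (fst p) (fst (snd p))) ` uterm" "\<lambda>p. snd (snd p)"
  by (rule univ_function_ring)

abbreviation (input) urep :: "('c ring \<Rightarrow> ('v \<Rightarrow> 'c) \<Rightarrow> 'c \<Rightarrow> 'c) \<Rightarrow> bool" where
  "urep f \<equiv> poly_rep fst {(F, e, c). valid F e \<and> c \<in> carrier F}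
     ((\<lambda>a p. a (fst p) (fst (snd p))) ` uterm) (\<lambda>p. snd (snd p)) (\<lambda>(F, e, c). f F e c)"

lemma urep_iff:
  "urep f \<longleftrightarrow> (\<exists>as. set as \<subseteq> uterm \<and>
     (\<forall>F e c. valid F e \<longrightarrow> c \<in> carrier F \<longrightarrow> f F e c = evl F e as c))" (is "_ = ?rhs")
proof
  assume "urep f"
  then obtain as where as: "set as \<subseteq> (\<lambda>a p. a (fst p) (fst (snd p))) ` uterm"
    "\<And>F e c. valid F e \<Longrightarrow> c \<in> carrier F \<Longrightarrow> f F e c = peval F (map (\<lambda>a. a (F, e, c)) as) c"
    unfolding poly_rep_def by fastforce
  have "\<exists>bs. set bs \<subseteq> uterm \<and> as = map (\<lambda>a p. a (fst p) (fst (snd p))) bs"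
    using as(1) by (induction as) (simp, metis (no_types, lifting) image_iff insert_subset list.simps(15) list.simps(9))
  then obtain bs where bs: "set bs \<subseteq> uterm" "as = map (\<lambda>a p. a (fst p) (fst (snd p))) bs" by blast
  show ?rhs using as(2) bs(1) unfolding bs(2) by (intro exI[of _ bs]) (auto simp: comp_def)
next
  assume ?rhs
  then obtain as where "set as \<subseteq> uterm"
     "\<And>F e c. valid F e \<Longrightarrow> c \<in> carrier F \<Longrightarrow> f F e c = evl F e as c" by blast
  then show "urep f" unfolding poly_rep_def
    by (intro exI[of _ "map (\<lambda>a p. a (fst p) (fst (snd p))) as"]) (auto simp: comp_def)
qed

lemma uterm_univ:
  assumes "t \<in> uterm"
  shows "urep (\<lambda>F e c. t F (e(v := c)))"
  using assms
proof induction
  case (var w)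
  show ?case
  proof (cases "w = v")
    case True
    show ?thesis by (rule univ.poly_rep_cong[OF univ.poly_rep_point]) (use True in auto)
  next
    case False
    have "(\<lambda>p. fst (snd p) w) \<in> (\<lambda>a p. a (fst p) (fst (snd p))) ` uterm"
      by (rule image_eqI[OF _ uterm.var[of w]]) simp
    then have "urep (\<lambda>F e c. e w)"
      by (rule univ.poly_rep_cong[OF univ.poly_rep_const]) auto
    then show ?thesis using False by simp
  qed
next
  case zero
  show ?case by (rule univ.poly_rep_cong[OF univ.poly_rep_const[OF univ.A_zero]]) auto
next
  case one
  show ?case by (rule univ.poly_rep_cong[OF univ.poly_rep_const[OF univ.A_one]]) auto
next
  case (add s t)
  show ?case by (rule univ.poly_rep_cong[OF univ.poly_rep_add[OF add.IH]]) auto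
next
  case (mult s t)
  show ?case by (rule univ.poly_rep_cong[OF univ.poly_rep_mult[OF mult.IH]]) auto
next
  case (uminus t)
  \<comment> \<open>\<open>function_ring\<close> has no operation for negation, so it is expressed
    as multiplication by the coefficient -1.\<close>
  have "(\<lambda>p. (\<lambda>F e. \<ominus>\<^bsub>F\<^esub> \<one>\<^bsub>F\<^esub>) (fst p) (fst (snd p))) \<in> (\<lambda>a p. a (fst p) (fst (snd p))) ` uterm"
    by (rule image_eqI[OF _ uterm.uminus[OF uterm.one]]) simp
  note * = univ.poly_rep_smult[OF uminus.IH this]
  show ?case
  proof (rule univ.poly_rep_cong[OF *])
    fix p :: "'a ring \<times> ('b \<Rightarrow> 'a) \<times> 'a"
    assume "p \<in> {(F, e, c). valid F e \<and> c \<in> carrier F}"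
    then obtain F e c where p: "p = (F, e, c)" "valid F e" "c \<in> carrier F" by auto
    interpret cring F using p(2) by (rule validD)
    have "t F (e(v := c)) \<in> carrier F"
      using uterm_closed[OF uminus.hyps valid_upd[OF p(2,3)]] .
    then show "(\<ominus>\<^bsub>fst p\<^esub> \<one>\<^bsub>fst p\<^esub>) \<otimes>\<^bsub>fst p\<^esub> (case p of (F, e, c) \<Rightarrow> t F (e(v := c)))
        = (case p of (F, e, c) \<Rightarrow> \<ominus>\<^bsub>F\<^esub> t F (e(v := c)))"
      unfolding p(1) by (simp add: l_minus)
  qed
qed

lemma urep_evl: "set as \<subseteq> uterm \<Longrightarrow> urep (\<lambda>F e c. evl F e as c)"
  unfolding urep_iff by blast

lemma urep_pow:
  assumes "urep f" shows "urep (\<lambda>F e c. f F e c [^]\<^bsub>F\<^esub> (n::nat))"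
proof (induction n)
  case 0
  show ?case by (rule univ.poly_rep_cong[OF univ.poly_rep_const[OF univ.A_one]]) auto
next
  case (Suc n)
  show ?case by (rule univ.poly_rep_cong[OF univ.poly_rep_mult[OF Suc assms]]) auto
qed

section \<open>Pseudo-division\<close>

text \<open>One step of pseudo-division, a Q - b X^k P, where P = \<open>p @ [a]\<close>, Q =
  \<open>q @ [b]\<close> and k is the difference of the lengths. The lists \<open>p\<close> and
  \<open>q\<close> come without the leading coefficients, because the leading terms cancel. No
  division occurs, so the result is again a list of terms.\<close>

definition ured where
  "ured a p b q = map2 (\<lambda>x y F e. a F e \<otimes>\<^bsub>F\<^esub> x F e \<ominus>\<^bsub>F\<^esub> b F e \<otimes>\<^bsub>F\<^esub> y F e) q
     (replicate (length q - length p) (\<lambda>F e. \<zero>\<^bsub>F\<^esub>) @ p)"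

lemma length_ured: "length p \<le> length q \<Longrightarrow> length (ured a p b q) = length q"
  by (simp add: ured_def)

lemma ured_uterm:
  assumes "set p \<subseteq> uterm" "set q \<subseteq> uterm" "a \<in> uterm" "b \<in> uterm"
  shows "set (ured a p b q) \<subseteq> uterm"
proof
  let ?z = "replicate (length q - length p) (\<lambda>F e. \<zero>\<^bsub>F\<^esub>) @ p"
  fix t assume "t \<in> set (ured a p b q)"
  then obtain x y where xy: "(x, y) \<in> set (zip q ?z)"
    and t: "t = (\<lambda>F e. a F e \<otimes>\<^bsub>F\<^esub> x F e \<ominus>\<^bsub>F\<^esub> b F e \<otimes>\<^bsub>F\<^esub> y F e)"
    unfolding ured_def by auto
  have "x \<in> uterm" using set_zip_leftD[OF xy] assms(2) by blast
  moreover have "y \<in> uterm" using set_zip_rightD[OF xy] assms(1) uterm.zero by auto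
  ultimately show "t \<in> uterm" unfolding t using assms(3,4)
    by (intro uterm_minus uterm.mult)
qed

lemma evl_ured:
  assumes "set p \<subseteq> uterm" "set q \<subseteq> uterm" "a \<in> uterm" "b \<in> uterm" "length p \<le> length q"
    and v: "valid F e" and c: "c \<in> carrier F"
  shows "evl F e (ured a p b q) c = a F e \<otimes>\<^bsub>F\<^esub> evl F e (q @ [b]) c \<ominus>\<^bsub>F\<^esub>
     b F e \<otimes>\<^bsub>F\<^esub> (c [^]\<^bsub>F\<^esub> (length q - length p) \<otimes>\<^bsub>F\<^esub> evl F e (p @ [a]) c)"
proof -
  interpret acf F using v by (rule validD)
  define P Q k where "P = map (\<lambda>t. t F e) p" and "Q = map (\<lambda>t. t F e) q"
    and "k = length q - length p"
  have PQ: "set P \<subseteq> carrier F" "set Q \<subseteq> carrier F" "length Q = k + length P"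
    using map_uterm_closed[OF assms(1) v] map_uterm_closed[OF assms(2) v] assms(5)
    unfolding P_def Q_def k_def by auto
  have ab: "a F e \<in> carrier F" "b F e \<in> carrier F" using assms(3,4) uterm_closed v by blast+
  have cl: "peval F P c \<in> carrier F" "peval F Q c \<in> carrier F" using PQ c by auto
  have "map (\<lambda>t. t F e) (ured a p b q) = map2 (\<lambda>x y. a F e \<otimes>\<^bsub>F\<^esub> x \<ominus>\<^bsub>F\<^esub> b F e \<otimes>\<^bsub>F\<^esub> y) Q
      (map (\<lambda>t. t F e) (replicate k (\<lambda>F e. \<zero>\<^bsub>F\<^esub>) @ p))"
    unfolding ured_def Q_def k_def by (simp only: zip_map_map) (simp add: case_prod_unfold)
  also have "map (\<lambda>t. t F e) (replicate k (\<lambda>F e. \<zero>\<^bsub>F\<^esub>) @ p) = replicate k \<zero>\<^bsub>F\<^esub> @ P"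
    unfolding P_def by simp
  finally have "evl F e (ured a p b q) c
      = a F e \<otimes>\<^bsub>F\<^esub> peval F Q c \<ominus>\<^bsub>F\<^esub> b F e \<otimes>\<^bsub>F\<^esub> peval F (replicate k \<zero>\<^bsub>F\<^esub> @ P) c"
    using PQ ab c by (simp only:) (intro peval_lincomb; auto)
  also have "peval F (replicate k \<zero>\<^bsub>F\<^esub> @ P) c = c [^]\<^bsub>F\<^esub> k \<otimes>\<^bsub>F\<^esub> peval F P c"
    using PQ c cl by (subst peval_append) (auto simp: peval_replicate_zero)
  finally have 1: "evl F e (ured a p b q) c
      = a F e \<otimes>\<^bsub>F\<^esub> peval F Q c \<ominus>\<^bsub>F\<^esub> b F e \<otimes>\<^bsub>F\<^esub> (c [^]\<^bsub>F\<^esub> k \<otimes>\<^bsub>F\<^esub> peval F P c)" .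
  have 2: "evl F e (q @ [b]) c = peval F Q c \<oplus>\<^bsub>F\<^esub> (c [^]\<^bsub>F\<^esub> k \<otimes>\<^bsub>F\<^esub> c [^]\<^bsub>F\<^esub> length P) \<otimes>\<^bsub>F\<^esub> b F e"
    using PQ ab c unfolding Q_def[symmetric] map_append
    by (subst peval_append) (auto simp: nat_pow_mult)
  have 3: "evl F e (p @ [a]) c = peval F P c \<oplus>\<^bsub>F\<^esub> c [^]\<^bsub>F\<^esub> length P \<otimes>\<^bsub>F\<^esub> a F e"
    using PQ ab c unfolding P_def[symmetric] map_append by (subst peval_append) auto
  show ?thesis unfolding 1 2 3 k_def[symmetric] using cl ab c by (simp add: cring_norm r_neg)
qed

text \<open>The quotient is any polynomial function over the particular field \<open>F\<close>; it
  may depend on \<open>F\<close> and \<open>e\<close> in a way that is not uniform. Only the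
  remainder has to be uniform.\<close>

definition udivides where
  "udivides F e p q \<longleftrightarrow> (\<exists>s. poly_rep (\<lambda>_. F) (carrier F) ((\<lambda>a _. a) ` carrier F) (\<lambda>c. c) s \<and>
     (\<forall>c \<in> carrier F. evl F e q c = s c \<otimes>\<^bsub>F\<^esub> evl F e p c))"

text \<open>The value of \<open>a\<close> is invertible, and \<open>ured\<close> differs from
  \<open>a\<close> times the dividend by a multiple of the divisor.\<close>

lemma udivides_ured:
  assumes "set p \<subseteq> uterm" "set q \<subseteq> uterm" "a \<in> uterm" "b \<in> uterm" "length p \<le> length q"
    and v: "valid F e" and nz: "a F e \<noteq> \<zero>\<^bsub>F\<^esub>"
  shows "udivides F e (p @ [a]) (q @ [b]) \<longleftrightarrow> udivides F e (p @ [a]) (ured a p b q)"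
proof -
  interpret acf F using v by (rule validD)
  let ?k = "length q - length p"
  have ab: "a F e \<in> carrier F" "b F e \<in> carrier F" using assms(3,4) uterm_closed v by blast+
  have cl: "evl F e (p @ [a]) c \<in> carrier F" "evl F e (q @ [b]) c \<in> carrier F" if "c \<in> carrier F" for c
    using that map_uterm_closed[of "p @ [a]", OF _ v] map_uterm_closed[of "q @ [b]", OF _ v] assms
    by auto
  note E = evl_ured[OF assms(1-5) v]
  show ?thesis
  proof
    assume "udivides F e (p @ [a]) (q @ [b])"
    then obtain s where s: "pfun s"
      "\<And>c. c \<in> carrier F \<Longrightarrow> evl F e (q @ [b]) c = s c \<otimes>\<^bsub>F\<^esub> evl F e (p @ [a]) c"
      unfolding udivides_def by blast
    let ?s = "\<lambda>c. a F e \<otimes>\<^bsub>F\<^esub> s c \<oplus>\<^bsub>F\<^esub> \<ominus>\<^bsub>F\<^esub> b F e \<otimes>\<^bsub>F\<^esub> c [^]\<^bsub>F\<^esub> ?k"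
    have "pfun ?s"
      using ab s(1) by (intro pf.poly_rep_add pf.poly_rep_mult pfun_const pfun_pow pf.poly_rep_point) auto
    moreover have "evl F e (ured a p b q) c = ?s c \<otimes>\<^bsub>F\<^esub> evl F e (p @ [a]) c" if c: "c \<in> carrier F" for c
      unfolding E[OF c] s(2)[OF c] using ab c cl(1)[OF c] pfun_closed[OF s(1) c] by (simp add: cring_norm)
    ultimately show "udivides F e (p @ [a]) (ured a p b q)" unfolding udivides_def by blast
  next
    assume "udivides F e (p @ [a]) (ured a p b q)"
    then obtain s where s: "pfun s"
      "\<And>c. c \<in> carrier F \<Longrightarrow> evl F e (ured a p b q) c = s c \<otimes>\<^bsub>F\<^esub> evl F e (p @ [a]) c"
      unfolding udivides_def by blast
    let ?i = "inv\<^bsub>F\<^esub> (a F e)"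
    have i: "?i \<in> carrier F" "?i \<otimes>\<^bsub>F\<^esub> a F e = \<one>\<^bsub>F\<^esub>" using ab nz by (auto simp: field_Units)
    let ?s = "\<lambda>c. ?i \<otimes>\<^bsub>F\<^esub> (s c \<oplus>\<^bsub>F\<^esub> b F e \<otimes>\<^bsub>F\<^esub> c [^]\<^bsub>F\<^esub> ?k)"
    have "pfun ?s"
      using ab i s(1) by (intro pf.poly_rep_add pf.poly_rep_mult pfun_const pfun_pow pf.poly_rep_point) auto
    moreover have "evl F e (q @ [b]) c = ?s c \<otimes>\<^bsub>F\<^esub> evl F e (p @ [a]) c" if c: "c \<in> carrier F" for c
    proof -
      define U W S where "U = evl F e (q @ [b]) c" and "W = evl F e (p @ [a]) c" and "S = s c"
      have u: "U \<in> carrier F" "W \<in> carrier F" "S \<in> carrier F" "c [^]\<^bsub>F\<^esub> ?k \<in> carrier F"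
        using cl[OF c] pfun_closed[OF s(1) c] c unfolding U_def W_def S_def by auto
      have "a F e \<otimes>\<^bsub>F\<^esub> U \<ominus>\<^bsub>F\<^esub> b F e \<otimes>\<^bsub>F\<^esub> (c [^]\<^bsub>F\<^esub> ?k \<otimes>\<^bsub>F\<^esub> W) = S \<otimes>\<^bsub>F\<^esub> W"
        using E[OF c] s(2)[OF c] unfolding U_def W_def S_def by simp
      moreover have "x = (x \<ominus>\<^bsub>F\<^esub> y) \<oplus>\<^bsub>F\<^esub> y" if "x \<in> carrier F" "y \<in> carrier F" for x y
        using that by (simp add: a_minus_def a_assoc l_neg)
      ultimately have "a F e \<otimes>\<^bsub>F\<^esub> U = S \<otimes>\<^bsub>F\<^esub> W \<oplus>\<^bsub>F\<^esub> b F e \<otimes>\<^bsub>F\<^esub> (c [^]\<^bsub>F\<^esub> ?k \<otimes>\<^bsub>F\<^esub> W)"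
        using u ab by (metis m_closed)
      then have "?i \<otimes>\<^bsub>F\<^esub> (a F e \<otimes>\<^bsub>F\<^esub> U) = ?s c \<otimes>\<^bsub>F\<^esub> W"
        using u ab i by (simp add: l_distr m_assoc S_def[symmetric])
      then show ?thesis using i ab u unfolding U_def[symmetric] W_def[symmetric]
        by (metis l_one m_assoc)
    qed
    ultimately show "udivides F e (p @ [a]) (q @ [b])" unfolding udivides_def by blast
  qed
qed

text \<open>Each step shortens the dividend by one and is correct whether or not the leading
  coefficient of the dividend vanishes. Only \<open>a\<close> must be nonzero, so one remainder
  \<open>r\<close> serves all these fields and environments without case distinctions.\<close>

lemma pseudo_remainder:
  fixes p q :: "('c ring \<Rightarrow> ('v \<Rightarrow> 'c) \<Rightarrow> 'c) list"
  assumes "set p \<subseteq> uterm" "a \<in> uterm" "set q \<subseteq> uterm"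
  shows "\<exists>r. set r \<subseteq> uterm \<and> length r \<le> length p \<and>
    (\<forall>F e. valid F e \<longrightarrow> a F e \<noteq> \<zero>\<^bsub>F\<^esub> \<longrightarrow> udivides F e (p @ [a]) q = udivides F e (p @ [a]) r)"
  using assms(3)
proof (induction "length q" arbitrary: q rule: less_induct)
  case less
  show ?case
  proof (cases "length q \<le> length p")
    case True
    then show ?thesis using less.prems by (intro exI[of _ q]) simp
  next
    case False
    then obtain q' b where q: "q = q' @ [b]" by (cases q rule: rev_cases) auto
    have l: "length p \<le> length q'" and u: "set q' \<subseteq> uterm" "b \<in> uterm"
      using False less.prems q by auto
    have "\<exists>r. set r \<subseteq> uterm \<and> length r \<le> length p \<and> (\<forall>F e. valid F e \<longrightarrow> a F e \<noteq> \<zero>\<^bsub>F\<^esub> \<longrightarrow>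
        udivides F e (p @ [a]) (ured a p b q') = udivides F e (p @ [a]) r)"
      using l u assms(1,2) q by (intro less.hyps ured_uterm) (auto simp: length_ured)
    then show ?thesis using udivides_ured[OF assms(1) u(1) assms(2) u(2) l] unfolding q by simp
  qed
qed

section \<open>Elimination of one existential quantifier\<close>

text \<open>There is no such c exactly if all roots of \<open>p @ [a]\<close> are roots of
  \<open>q\<close>, that is, if \<open>p @ [a]\<close> divides the power of \<open>q\<close> with
  exponent \<open>length p\<close>, that is, if the pseudo-remainder of this power has only zero
  coefficients. The last condition is a formula.\<close>

lemma upred_one_equation:
  fixes p q :: "('c ring \<Rightarrow> ('v \<Rightarrow> 'c) \<Rightarrow> 'c) list"
  assumes "set p \<subseteq> uterm" "a \<in> uterm" "set q \<subseteq> uterm"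
  shows "\<exists>P. upred P \<and> (\<forall>F e. valid F e \<longrightarrow> a F e \<noteq> \<zero>\<^bsub>F\<^esub> \<longrightarrow>
    P F e = (\<exists>c \<in> carrier F. evl F e (p @ [a]) c = \<zero>\<^bsub>F\<^esub> \<and> evl F e q c \<noteq> \<zero>\<^bsub>F\<^esub>))"
proof -
  obtain qd where qd: "set qd \<subseteq> uterm" "\<And>F e c. valid F e \<Longrightarrow> c \<in> carrier F \<Longrightarrow>
      evl F e q c [^]\<^bsub>F\<^esub> length p = evl F e qd c"
    using urep_pow[OF urep_evl[OF assms(3)], of "length p"] unfolding urep_iff by auto
  obtain r where r: "set r \<subseteq> uterm" "length r \<le> length p"
    "\<And>F e. valid F e \<Longrightarrow> a F e \<noteq> \<zero>\<^bsub>F\<^esub> \<Longrightarrow> udivides F e (p @ [a]) qd = udivides F e (p @ [a]) r"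
    using pseudo_remainder[OF assms(1,2) qd(1)] by blast
  have up: "upred (\<lambda>F e. \<not> (\<forall>t \<in> set r. t F e = \<zero>\<^bsub>F\<^esub>))"
    using r(1) by (intro upred.neg upred_Ball upred.eq_zero) auto
  moreover have "(\<not> (\<forall>t \<in> set r. t F e = \<zero>\<^bsub>F\<^esub>)) \<longleftrightarrow>
      (\<exists>c \<in> carrier F. evl F e (p @ [a]) c = \<zero>\<^bsub>F\<^esub> \<and> evl F e q c \<noteq> \<zero>\<^bsub>F\<^esub>)"
    if v: "valid F e" and nz: "a F e \<noteq> \<zero>\<^bsub>F\<^esub>" for F :: "'c ring" and e :: "'v \<Rightarrow> 'c"
  proof -
    interpret acf F using v by (rule validD)
    let ?p = "map (\<lambda>t. t F e) p" and ?q = "map (\<lambda>t. t F e) q" and ?r = "map (\<lambda>t. t F e) r"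
    have cl: "set ?p \<subseteq> carrier F" "set ?q \<subseteq> carrier F" "set ?r \<subseteq> carrier F" "a F e \<in> carrier F"
      using map_uterm_closed[OF _ v] assms r(1) uterm_closed[OF _ v] by blast+
    have "(\<forall>t \<in> set r. t F e = \<zero>\<^bsub>F\<^esub>) \<longleftrightarrow> udivides F e (p @ [a]) r"
    proof
      assume "\<forall>t \<in> set r. t F e = \<zero>\<^bsub>F\<^esub>"
      then have "\<forall>c \<in> carrier F. evl F e r c = \<zero>\<^bsub>F\<^esub> \<otimes>\<^bsub>F\<^esub> evl F e (p @ [a]) c"
        using cl by (auto intro!: peval_all_zero)
      then show "udivides F e (p @ [a]) r" unfolding udivides_def using pfun_const[OF zero_closed] by blast
    next
      assume "udivides F e (p @ [a]) r"
      then obtain s where "pfun s"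
        "\<And>c. c \<in> carrier F \<Longrightarrow> peval F ?r c = s c \<otimes>\<^bsub>F\<^esub> peval F (?p @ [a F e]) c"
        unfolding udivides_def by auto
      then have "\<forall>b \<in> set ?r. b = \<zero>\<^bsub>F\<^esub>"
        by (intro divides_smaller_degree_imp_zero[OF cl(1,4) nz cl(3)]) (use r(2) in auto)
      then show "\<forall>t \<in> set r. t F e = \<zero>\<^bsub>F\<^esub>" by auto
    qed
    also have "\<dots> \<longleftrightarrow> udivides F e (p @ [a]) qd" using r(3)[OF v nz] by simp
    also have "\<dots> \<longleftrightarrow> (\<forall>c \<in> carrier F. evl F e (p @ [a]) c = \<zero>\<^bsub>F\<^esub> \<longrightarrow> evl F e q c = \<zero>\<^bsub>F\<^esub>)"
    proof
      assume "udivides F e (p @ [a]) qd"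
      then obtain s where s: "pfun s"
        "\<And>c. c \<in> carrier F \<Longrightarrow> evl F e qd c = s c \<otimes>\<^bsub>F\<^esub> evl F e (p @ [a]) c"
        unfolding udivides_def by auto
      show "\<forall>c \<in> carrier F. evl F e (p @ [a]) c = \<zero>\<^bsub>F\<^esub> \<longrightarrow> evl F e q c = \<zero>\<^bsub>F\<^esub>"
      proof (intro ballI impI)
        fix c assume c: "c \<in> carrier F" and z: "evl F e (p @ [a]) c = \<zero>\<^bsub>F\<^esub>"
        have "evl F e q c [^]\<^bsub>F\<^esub> length p = \<zero>\<^bsub>F\<^esub>"
          unfolding qd(2)[OF v c] s(2)[OF c] z using pfun_closed[OF s(1) c] by simp
        moreover have "x = \<zero>\<^bsub>F\<^esub>" if "x \<in> carrier F" "x [^]\<^bsub>F\<^esub> (n::nat) = \<zero>\<^bsub>F\<^esub>" for x n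
          using that by (induction n) (auto simp: integral_iff)
        ultimately show "evl F e q c = \<zero>\<^bsub>F\<^esub>" using peval_closed[OF cl(2) c] by blast
      qed
    next
      assume "\<forall>c \<in> carrier F. evl F e (p @ [a]) c = \<zero>\<^bsub>F\<^esub> \<longrightarrow> evl F e q c = \<zero>\<^bsub>F\<^esub>"
      then have "\<exists>s. pfun s \<and> (\<forall>c \<in> carrier F.
          peval F ?q c [^]\<^bsub>F\<^esub> length ?p = s c \<otimes>\<^bsub>F\<^esub> peval F (?p @ [a F e]) c)"
        by (intro roots_subset_imp_divides_power[OF cl(1,4) nz cl(2)]) simp
      then show "udivides F e (p @ [a]) qd" unfolding udivides_def using qd(2)[OF v] by simp
    qed
    finally show ?thesis by blast
  qed
  ultimately show ?thesis by blast
qed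

lemma upred_case:
  assumes "a \<in> uterm" "upred P" "upred Q"
    and "\<And>F e. valid F e \<Longrightarrow> a F e = \<zero>\<^bsub>F\<^esub> \<Longrightarrow> P F e = R F e"
    and "\<And>F e. valid F e \<Longrightarrow> a F e \<noteq> \<zero>\<^bsub>F\<^esub> \<Longrightarrow> Q F e = R F e"
  shows "upred R"
  by (rule upred.cong[of "\<lambda>F e. a F e = \<zero>\<^bsub>F\<^esub> \<and> P F e \<or> a F e \<noteq> \<zero>\<^bsub>F\<^esub> \<and> Q F e"])
    (use assms in \<open>auto intro!: upred_disj upred.intros(1-3)\<close>)

lemma evl_snoc_zero:
  assumes "set p \<subseteq> uterm" "valid F e" "a F e = \<zero>\<^bsub>F\<^esub>" "c \<in> carrier F"
  shows "evl F e (p @ [a]) c = evl F e p c"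
proof -
  interpret acf F using assms(2) by (rule validD)
  show ?thesis using map_uterm_closed[OF assms(1,2)] assms(3,4) by (simp add: peval_append)
qed

text \<open>Euclid's algorithm with case distinctions: if the shorter of two equations has leading
  coefficient zero, drop that coefficient, and otherwise reduce the longer equation by it. This ends
  with at most one equation.\<close>

lemma upred_system:
  fixes q :: "('c ring \<Rightarrow> ('v \<Rightarrow> 'c) \<Rightarrow> 'c) list"
  assumes "\<forall>p \<in> set ps. set p \<subseteq> uterm" "set q \<subseteq> uterm"
  shows "upred (\<lambda>F e. \<exists>c \<in> carrier F. (\<forall>p \<in> set ps. evl F e p c = \<zero>\<^bsub>F\<^esub>) \<and> evl F e q c \<noteq> \<zero>\<^bsub>F\<^esub>)"
    (is "upred (?S ps)")
  using assms(1)
\<comment> \<open>The summand 1 makes an empty list count, so that discarding a trivial equation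
  also lowers the measure.\<close>
proof (induction "sum_list (map (\<lambda>p. length p + 1) ps)" arbitrary: ps rule: less_induct)
  case less
  have pair: "upred (?S ps)"
    if ps: "set ps = insert (p @ [a]) (insert (p' @ [b]) (set rest))"
      and len: "length p \<le> length p'"
      and size: "sum_list (map (\<lambda>p. length p + 1) ps) =
        length p + length p' + 4 + sum_list (map (\<lambda>p. length p + 1) rest)" for p a p' b rest
  proof -
    have u: "set p \<subseteq> uterm" "a \<in> uterm" "set p' \<subseteq> uterm" "b \<in> uterm" "\<forall>p \<in> set rest. set p \<subseteq> uterm"
      using less.prems unfolding ps by auto
    have sz: "sum_list (map (\<lambda>p. length p + 1) (p # (p' @ [b]) # rest)) < sum_list (map (\<lambda>p. length p + 1) ps)"
      "sum_list (map (\<lambda>p. length p + 1) ((p @ [a]) # ured a p b p' # rest)) < sum_list (map (\<lambda>p. length p + 1) ps)"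
      unfolding size using len by (simp_all add: length_ured)
    show ?thesis
    proof (rule upred_case[OF u(2), of "?S (p # (p' @ [b]) # rest)" "?S ((p @ [a]) # ured a p b p' # rest)"])
      show "upred (?S (p # (p' @ [b]) # rest))"
        using u by (intro less.hyps[OF sz(1)]) simp
      show "upred (?S ((p @ [a]) # ured a p b p' # rest))"
        using u ured_uterm[OF u(1,3,2,4)] by (intro less.hyps[OF sz(2)]) simp
    next
      fix F :: "'c ring" and e :: "'v \<Rightarrow> 'c" assume v: "valid F e" and "a F e = \<zero>\<^bsub>F\<^esub>"
      then show "?S (p # (p' @ [b]) # rest) F e = ?S ps F e"
        unfolding ps using evl_snoc_zero[OF u(1) v] by (intro bex_cong) auto
    next
      fix F :: "'c ring" and e :: "'v \<Rightarrow> 'c" assume v: "valid F e" and nz: "a F e \<noteq> \<zero>\<^bsub>F\<^esub>"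
      interpret acf F using v by (rule validD)
      have ab: "a F e \<in> carrier F" "b F e \<in> carrier F" using u uterm_closed v by blast+
      \<comment> \<open>Where the first equation holds, the reduced polynomial is \<open>a\<close>
        times the second one, and \<open>a\<close> is nonzero.\<close>
      have "(evl F e (p @ [a]) c = \<zero>\<^bsub>F\<^esub> \<and> evl F e (ured a p b p') c = \<zero>\<^bsub>F\<^esub>) \<longleftrightarrow>
          (evl F e (p @ [a]) c = \<zero>\<^bsub>F\<^esub> \<and> evl F e (p' @ [b]) c = \<zero>\<^bsub>F\<^esub>)" if c: "c \<in> carrier F" for c
      proof -
        have "evl F e (p' @ [b]) c \<in> carrier F"
          using c map_uterm_closed[of "p' @ [b]", OF _ v] u by auto
        then show ?thesis
          unfolding evl_ured[OF u(1,3,2,4) len v c] using ab nz c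
          by (auto simp: integral_iff a_minus_def)
      qed
      then show "?S ((p @ [a]) # ured a p b p' # rest) F e = ?S ps F e"
        unfolding ps by (intro bex_cong) (auto simp del: map_append)
    qed
  qed
  consider "ps = []" | "[] \<in> set ps" | p a where "ps = [p @ [a]]"
    | p a p' b rest where "ps = (p @ [a]) # (p' @ [b]) # rest"
    by (cases ps; cases "tl ps"; cases "hd ps" rule: rev_cases; cases "hd (tl ps)" rule: rev_cases) auto
  then show ?case
  proof cases
    case 1
    have "upred (\<lambda>F e. \<not> (\<forall>t \<in> set q. t F e = \<zero>\<^bsub>F\<^esub>))"
      using assms(2) by (intro upred.neg upred_Ball upred.eq_zero) auto
    then show ?thesis
    proof (rule upred.cong)
      fix F :: "'c ring" and e :: "'v \<Rightarrow> 'c" assume v: "valid F e"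
      interpret acf F using v by (rule validD)
      let ?q = "map (\<lambda>t. t F e) q"
      \<comment> \<open>Without equations the question is whether \<open>q\<close> is the zero
        polynomial; over an infinite field the coefficients decide this.\<close>
      have "(\<forall>b \<in> set ?q. b = \<zero>\<^bsub>F\<^esub>) \<longleftrightarrow> (\<forall>c \<in> carrier F. peval F ?q c = \<zero>\<^bsub>F\<^esub>)"
      proof
        assume "\<forall>b \<in> set ?q. b = \<zero>\<^bsub>F\<^esub>"
        from peval_all_zero[OF this] show "\<forall>c \<in> carrier F. peval F ?q c = \<zero>\<^bsub>F\<^esub>" by blast
      next
        assume "\<forall>c \<in> carrier F. peval F ?q c = \<zero>\<^bsub>F\<^esub>"
        then have eq: "{c \<in> carrier F. peval F ?q c = \<zero>\<^bsub>F\<^esub>} = carrier F" by blast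
        have "infinite {c \<in> carrier F. peval F ?q c = \<zero>\<^bsub>F\<^esub>}"
          unfolding eq by (rule infinite_carrier)
        then show "\<forall>b \<in> set ?q. b = \<zero>\<^bsub>F\<^esub>"
          by (rule infinite_roots_peval[OF map_uterm_closed[OF assms(2) v]])
      qed
      then show "(\<not> (\<forall>t \<in> set q. t F e = \<zero>\<^bsub>F\<^esub>)) = ?S ps F e" unfolding 1 by simp
    qed
  next
    case 2
    have sm: "sum_list (map (\<lambda>p. length p + 1) (removeAll [] ps)) < sum_list (map (\<lambda>p. length p + 1) ps)"
      if "[] \<in> set ps" for ps :: "'x list list"
      using that
    proof (induction ps)
      case (Cons p ps)
      have "sum_list (map (\<lambda>p. length p + 1) (removeAll [] ps)) \<le> sum_list (map (\<lambda>p. length p + 1) ps)"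
        by (induction ps) auto
      then show ?case using Cons by auto
    qed simp
    have *: "upred (?S (removeAll [] ps))"
      using less.prems sm[OF 2] by (intro less.hyps) auto
    have eq: "(\<forall>p \<in> set (removeAll [] ps). f p = z) \<longleftrightarrow> (\<forall>p \<in> set ps. f p = z)"
      if "f [] = z" for f and z :: 'c using that by auto
    show ?thesis by (rule upred.cong[OF *]) (simp only: eq peval.simps list.map)
  next
    case 3
    have u: "set p \<subseteq> uterm" "a \<in> uterm" using less.prems unfolding 3 by simp_all
    obtain P where P: "upred P" "\<And>F e. valid F e \<Longrightarrow> a F e \<noteq> \<zero>\<^bsub>F\<^esub> \<Longrightarrow>
      P F e = (\<exists>c \<in> carrier F. evl F e (p @ [a]) c = \<zero>\<^bsub>F\<^esub> \<and> evl F e q c \<noteq> \<zero>\<^bsub>F\<^esub>)"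
      using upred_one_equation[OF u assms(2)] by blast
    show ?thesis
    proof (rule upred_case[OF u(2) _ P(1)])
      show "upred (?S [p])" using u 3 by (intro less.hyps) auto
    next
      fix F :: "'c ring" and e :: "'v \<Rightarrow> 'c" assume v: "valid F e" and "a F e = \<zero>\<^bsub>F\<^esub>"
      then show "?S [p] F e = ?S ps F e"
        unfolding 3 using evl_snoc_zero[OF u(1) v] by (intro bex_cong) auto
    next
      fix F :: "'c ring" and e :: "'v \<Rightarrow> 'c" assume v: "valid F e" and "a F e \<noteq> \<zero>\<^bsub>F\<^esub>"
      then show "P F e = ?S ps F e" using P(2) unfolding 3 by simp
    qed
  next
    case 4
    show ?thesis
    proof (cases "length p \<le> length p'")
      case True
      then show ?thesis using 4 by (intro pair[of p a p' b rest]) auto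
    next
      case False
      then show ?thesis using 4 by (intro pair[of p' b p a rest]) auto
    qed
  qed
qed

text \<open>The quantifier distributes over the disjuncts of a normal form. In each disjunct the
  terms are rewritten as polynomials in the bound variable, which leaves a system of equations and
  one inequation.\<close>

theorem upred_ex:
  assumes "upred P"
  shows "upred (\<lambda>F e. \<exists>c \<in> carrier F. P F (e(v := c)))"
proof -
  obtain D where D: "dnf_rep D P" using upred_dnf[OF assms] by blast
  have rep: "\<exists>as. set as \<subseteq> uterm \<and> (\<forall>F e c. valid F e \<longrightarrow> c \<in> carrier F \<longrightarrow> t F (e(v := c)) = evl F e as c)"
    if "t \<in> uterm" for t :: "'a ring \<Rightarrow> ('b \<Rightarrow> 'a) \<Rightarrow> 'a"
    using uterm_univ[OF that, of v] unfolding urep_iff by blast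
  define \<rho> where "\<rho> t = (SOME as. set as \<subseteq> uterm \<and>
     (\<forall>F e c. valid F e \<longrightarrow> c \<in> carrier F \<longrightarrow> t F (e(v := c)) = evl F e as c))"
    for t :: "'a ring \<Rightarrow> ('b \<Rightarrow> 'a) \<Rightarrow> 'a"
  have \<rho>: "set (\<rho> t) \<subseteq> uterm"
    "\<And>F e c. valid F e \<Longrightarrow> c \<in> carrier F \<Longrightarrow> t F (e(v := c)) = evl F e (\<rho> t) c"
    if "t \<in> uterm" for t using someI_ex[OF rep[OF that]] unfolding \<rho>_def by blast+
  have "upred (\<lambda>F e. \<exists>d \<in> D. \<exists>c \<in> carrier F. holds d F (e(v := c)))"
  proof (rule upred_Bex)
    show "finite D" using D unfolding dnf_rep_def by blast
    fix d assume "d \<in> D"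
    then have d: "finite (fst d)" "fst d \<subseteq> uterm" "snd d \<in> uterm"
      using D unfolding dnf_rep_def by blast+
    then obtain ts where ts: "set ts = fst d" using finite_list by blast
    have "upred (\<lambda>F e. \<exists>c \<in> carrier F. (\<forall>p \<in> set (map \<rho> ts). evl F e p c = \<zero>\<^bsub>F\<^esub>) \<and>
        evl F e (\<rho> (snd d)) c \<noteq> \<zero>\<^bsub>F\<^esub>)"
      using \<rho>(1) d ts by (intro upred_system) auto
    then show "upred (\<lambda>F e. \<exists>c \<in> carrier F. holds d F (e(v := c)))"
    proof (rule upred.cong)
      fix F :: "'a ring" and e :: "'b \<Rightarrow> 'a" assume v: "valid F e"
      have "evl F e (\<rho> t) c = t F (e(v := c))" if "t \<in> insert (snd d) (fst d)" "c \<in> carrier F" for t c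
        using \<rho>(2)[OF _ v that(2)] that(1) d by auto
      then show "(\<exists>c \<in> carrier F. (\<forall>p \<in> set (map \<rho> ts). evl F e p c = \<zero>\<^bsub>F\<^esub>) \<and>
          evl F e (\<rho> (snd d)) c \<noteq> \<zero>\<^bsub>F\<^esub>) = (\<exists>c \<in> carrier F. holds d F (e(v := c)))"
        unfolding holds_def set_map ts by (intro bex_cong refl) simp
    qed
  qed
  then show ?thesis
  proof (rule upred.cong)
    fix F :: "'a ring" and e :: "'b \<Rightarrow> 'a" assume v: "valid F e"
    have "\<forall>F e. valid F e \<longrightarrow> P F e = (\<exists>d \<in> D. holds d F e)"
      using D unfolding dnf_rep_def by (elim conjE)
    then have "P F (e(v := c)) = (\<exists>d \<in> D. holds d F (e(v := c)))" if "c \<in> carrier F" for c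
      using valid_upd[OF v that] by (elim allE impE)
    then show "(\<exists>d \<in> D. \<exists>c \<in> carrier F. holds d F (e(v := c))) = (\<exists>c \<in> carrier F. P F (e(v := c)))"
      by blast
  qed
qed

section \<open>Transfer between fields\<close>

lemma field_hom_eq_zero:
  assumes "\<sigma> \<in> ring_hom R S" "field R" "field S" "x \<in> carrier R"
  shows "\<sigma> x = \<zero>\<^bsub>S\<^esub> \<longleftrightarrow> x = \<zero>\<^bsub>R\<^esub>"
proof -
  interpret R: field R by fact
  interpret S: field S by fact
  interpret ring_hom_ring R S \<sigma> using assms(1) R.ring_axioms S.ring_axioms by (intro ring_hom_ringI2)
  show ?thesis
  proof
    assume z: "\<sigma> x = \<zero>\<^bsub>S\<^esub>"
    show "x = \<zero>\<^bsub>R\<^esub>"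
    proof (rule ccontr)
      assume "x \<noteq> \<zero>\<^bsub>R\<^esub>"
      then have i: "inv\<^bsub>R\<^esub> x \<in> carrier R" "x \<otimes>\<^bsub>R\<^esub> inv\<^bsub>R\<^esub> x = \<one>\<^bsub>R\<^esub>"
        using assms(4) by (auto simp: R.field_Units)
      have "\<sigma> (x \<otimes>\<^bsub>R\<^esub> inv\<^bsub>R\<^esub> x) = \<zero>\<^bsub>S\<^esub>" using z i(1) assms(4) by simp
      then show False using i(2) by simp
    qed
  qed simp
qed

lemma field_hom_inj:
  assumes "\<sigma> \<in> ring_hom R S" "field R" "field S" "x \<in> carrier R" "y \<in> carrier R" "\<sigma> x = \<sigma> y"
  shows "x = y"
proof -
  interpret R: field R by fact
  interpret S: field S by fact
  interpret ring_hom_ring R S \<sigma> using assms(1) R.ring_axioms S.ring_axioms by (intro ring_hom_ringI2)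
  have "\<sigma> (x \<ominus>\<^bsub>R\<^esub> y) = \<zero>\<^bsub>S\<^esub>" using assms(4-6) by (simp add: R.minus_eq S.r_neg)
  then show ?thesis using field_hom_eq_zero[OF assms(1-3)] assms(4,5) by simp
qed

lemma peval_hom:
  assumes "\<sigma> \<in> ring_hom R S" "ring R" "ring S" "set as \<subseteq> carrier R" "c \<in> carrier R"
  shows "peval S (map \<sigma> as) (\<sigma> c) = \<sigma> (peval R as c)"
proof -
  interpret ring_hom_ring R S \<sigma> using assms by (intro ring_hom_ringI2)
  have cl: "peval R as c \<in> carrier R" if "set as \<subseteq> carrier R" for as
    using that assms(5) by (induction as) auto
  show ?thesis using assms(4,5) by (induction as) (auto simp: cl)
qed

lemma valid_comp:
  "valid F e \<Longrightarrow> acf F' \<Longrightarrow> \<sigma> \<in> ring_hom F F' \<Longrightarrow> valid F' (\<sigma> \<circ> e)"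
  unfolding valid_def ring_hom_def by auto

lemma uterm_hom:
  assumes "t \<in> uterm" "valid F e" "acf F'" "\<sigma> \<in> ring_hom F F'"
  shows "t F' (\<sigma> \<circ> e) = \<sigma> (t F e)"
proof -
  interpret F: acf F using assms(2) by (rule validD)
  interpret F': acf F' by fact
  interpret ring_hom_ring F F' \<sigma> using assms(4) F.ring_axioms F'.ring_axioms by (intro ring_hom_ringI2)
  show ?thesis using assms(1)
    by induction (use uterm_closed[OF _ assms(2)] in auto)
qed

text \<open>Homomorphisms of fields are injective, so equations and inequations are both preserved.
  Since \<open>upred\<close> is closed under quantifiers, this reaches all first-order conditions;
  it is applied to an endomorphism of one field, which therefore preserves sets definable over fixed
  parameters.\<close>

lemma upred_hom:
  assumes "upred P" "valid F e" "acf F'" "\<sigma> \<in> ring_hom F F'"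
  shows "P F' (\<sigma> \<circ> e) = P F e"
  using assms(1)
proof induction
  case (eq_zero t)
  show ?case unfolding uterm_hom[OF eq_zero assms(2-4)]
    using assms uterm_closed[OF eq_zero assms(2)] validD(1)[OF assms(2)]
    by (intro field_hom_eq_zero) (auto simp: acf_def)
next
  case (cong P Q)
  then show ?case using assms(2) valid_comp[OF assms(2-4)] by metis
qed auto

section \<open>Finite support and closing of formulas\<close>

lemma uterm_finite_support:
  assumes "t \<in> uterm"
  shows "\<exists>V. finite V \<and> (\<forall>F e e'. (\<forall>v \<in> V. e v = e' v) \<longrightarrow> t F e = t F e')"
  using assms
proof induction
  case (var v)
  show ?case by (rule exI[of _ "{v}"]) simp
next
  case (add s t)
  then obtain V W where "finite V" "\<forall>F e e'. (\<forall>v \<in> V. e v = e' v) \<longrightarrow> s F e = s F e'"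
    "finite W" "\<forall>F e e'. (\<forall>v \<in> W. e v = e' v) \<longrightarrow> t F e = t F e'" by blast
  then show ?case by (intro exI[of _ "V \<union> W"]) (simp add: ball_Un, metis)
next
  case (mult s t)
  then obtain V W where "finite V" "\<forall>F e e'. (\<forall>v \<in> V. e v = e' v) \<longrightarrow> s F e = s F e'"
    "finite W" "\<forall>F e e'. (\<forall>v \<in> W. e v = e' v) \<longrightarrow> t F e = t F e'" by blast
  then show ?case by (intro exI[of _ "V \<union> W"]) (simp add: ball_Un, metis)
next
  case (uminus t)
  then obtain V where "finite V" "\<forall>F e e'. (\<forall>v \<in> V. e v = e' v) \<longrightarrow> t F e = t F e'" by blast
  then show ?case by (intro exI[of _ V]) (simp, metis)
qed auto

definition depends_on :: "'v set \<Rightarrow> ('c ring \<Rightarrow> ('v \<Rightarrow> 'c) \<Rightarrow> bool) \<Rightarrow> bool" where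
  "depends_on V P \<longleftrightarrow> (\<forall>F e e'. valid F e \<and> valid F e' \<and> (\<forall>v \<in> V. e v = e' v) \<longrightarrow> P F e = P F e')"

text \<open>There may be infinitely many variables, one for each element of k, but only finitely
  many quantifiers can be eliminated; the support is the finite set to quantify over.\<close>

lemma upred_finite_support:
  fixes P :: "'c ring \<Rightarrow> ('v \<Rightarrow> 'c) \<Rightarrow> bool"
  assumes "upred P" shows "\<exists>V. finite V \<and> depends_on V P"
  using assms
proof (induction rule: upred.induct)
  case (eq_zero t)
  then obtain V where V: "finite V" "\<forall>F e e'. (\<forall>v \<in> V. e v = e' v) \<longrightarrow> t F e = t F e'"
    using uterm_finite_support by blast
  have "depends_on V (\<lambda>F e. t F e = \<zero>\<^bsub>F\<^esub>)"
    unfolding depends_on_def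
  proof (intro allI impI, elim conjE)
    fix F :: "'c ring" and e e' :: "'v \<Rightarrow> 'c" assume "\<forall>v \<in> V. e v = e' v"
    then have "t F e = t F e'" using V(2) by blast
    then show "(t F e = \<zero>\<^bsub>F\<^esub>) = (t F e' = \<zero>\<^bsub>F\<^esub>)" by simp
  qed
  then show ?case using V(1) by blast
next
  case (neg P)
  then show ?case unfolding depends_on_def by simp
next
  case (conj P Q)
  then obtain V W where V: "finite V" "depends_on V P" and W: "finite W" "depends_on W Q" by blast
  have "depends_on (V \<union> W) (\<lambda>F e. P F e \<and> Q F e)"
    unfolding depends_on_def
  proof (intro allI impI, elim conjE)
    fix F :: "'c ring" and e e' :: "'v \<Rightarrow> 'c" assume *: "valid F e" "valid F e'" "\<forall>v \<in> V \<union> W. e v = e' v"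
    have "P F e = P F e'" "Q F e = Q F e'" using * V(2) W(2) unfolding depends_on_def by simp_all
    then show "(P F e \<and> Q F e) = (P F e' \<and> Q F e')" by simp
  qed
  then show ?case using V(1) W(1) by blast
next
  case (cong P Q)
  then obtain V where V: "finite V" "depends_on V P" by blast
  have "depends_on V Q"
    unfolding depends_on_def
  proof (intro allI impI, elim conjE)
    fix F :: "'c ring" and e e' :: "'v \<Rightarrow> 'c" assume *: "valid F e" "valid F e'" "\<forall>v \<in> V. e v = e' v"
    have "P F e = P F e'" using * V(2) unfolding depends_on_def by simp
    then show "Q F e = Q F e'" using cong.hyps(2)[OF *(1)] cong.hyps(2)[OF *(2)] by simp
  qed
  then show ?case using V(1) by blast
qed

lemma upred_exs:
  assumes "finite V" "upred P"
  shows "upred (\<lambda>F e. \<exists>e'. range e' \<subseteq> carrier F \<and> (\<forall>v. v \<notin> V \<longrightarrow> e' v = e v) \<and> P F e')"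
  using assms
proof (induction V arbitrary: P)
  case empty
  show ?case
  proof (rule upred.cong[OF empty])
    fix F :: "'b ring" and e :: "'a \<Rightarrow> 'b" assume "valid F e"
    then have "range e \<subseteq> carrier F" by (simp add: valid_def)
    moreover have "e' = e" if "\<forall>v. e' v = e v" for e' using that by blast
    ultimately show "P F e = (\<exists>e'. range e' \<subseteq> carrier F \<and> (\<forall>v. v \<notin> {} \<longrightarrow> e' v = e v) \<and> P F e')"
      by auto
  qed
next
  case (insert w V)
  from upred_ex[OF insert.prems, of w]
  have "upred (\<lambda>F e. \<exists>e'. range e' \<subseteq> carrier F \<and> (\<forall>v. v \<notin> V \<longrightarrow> e' v = e v) \<and>
     (\<exists>c \<in> carrier F. P F (e'(w := c))))" by (rule insert.IH)
  then show ?case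
  proof (rule upred.cong)
    fix F :: "'b ring" and e :: "'a \<Rightarrow> 'b" assume v: "valid F e"
    show "(\<exists>e'. range e' \<subseteq> carrier F \<and> (\<forall>v. v \<notin> V \<longrightarrow> e' v = e v) \<and> (\<exists>c \<in> carrier F. P F (e'(w := c))))
      = (\<exists>e'. range e' \<subseteq> carrier F \<and> (\<forall>v. v \<notin> insert w V \<longrightarrow> e' v = e v) \<and> P F e')" (is "?l = ?r")
    proof
      assume ?l
      then obtain e' c where *: "range e' \<subseteq> carrier F" "\<forall>v. v \<notin> V \<longrightarrow> e' v = e v" "c \<in> carrier F" "P F (e'(w := c))"
        by blast
      show ?r by (rule exI[of _ "e'(w := c)"]) (use * in auto)
    next
      assume ?r
      then obtain e' where *: "range e' \<subseteq> carrier F" "\<forall>v. v \<notin> insert w V \<longrightarrow> e' v = e v" "P F e'" by blast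
      have ew: "e w \<in> carrier F" using v by (rule validD)
      have "P F ((e'(w := e w))(w := e' w))" using *(3) by simp
      moreover have "e' w \<in> carrier F" using *(1) by blast
      ultimately have "\<exists>c \<in> carrier F. P F ((e'(w := e w))(w := c))" by blast
      then show ?l using * ew insert.hyps(2)
        by (intro exI[of _ "e'(w := e w)"] conjI) auto
    qed
  qed
qed

subsection \<open>Closed formulas and the characteristic\<close>

lemma (in ring) int_mult_one:
  "[(m * n :: int)] \<cdot> \<one> = [m] \<cdot> \<one> \<otimes> [n] \<cdot> \<one>"
proof -
  have "[m] \<cdot> \<one> \<otimes> [n] \<cdot> \<one> = [m] \<cdot> (\<one> \<otimes> [n] \<cdot> \<one>)" by (rule add_pow_ldistr_int) auto
  also have "\<dots> = [m] \<cdot> ([n] \<cdot> \<one>)" by simp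
  also have "\<dots> = [(n * m)] \<cdot> \<one>" by (rule add.int_pow_pow) simp
  finally show ?thesis by (simp add: mult.commute)
qed

text \<open>The zero environment stands for the absence of free variables. A term is there its
  constant coefficient, which is one integer read in each field.\<close>

lemma uterm_closed_value:
  assumes "t \<in> uterm"
  shows "\<exists>m::int. \<forall>F. acf F \<longrightarrow> t F (\<lambda>_. \<zero>\<^bsub>F\<^esub>) = [m] \<cdot>\<^bsub>F\<^esub> \<one>\<^bsub>F\<^esub>"
  using assms
proof induction
  case (var v)
  have "[(0::int)] \<cdot>\<^bsub>F\<^esub> \<one>\<^bsub>F\<^esub> = \<zero>\<^bsub>F\<^esub>" for F :: "'a ring" by (simp add: add_pow_def)
  then show ?case by metis
next
  case zero
  have "[(0::int)] \<cdot>\<^bsub>F\<^esub> \<one>\<^bsub>F\<^esub> = \<zero>\<^bsub>F\<^esub>" for F :: "'a ring" by (simp add: add_pow_def)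
  then show ?case by metis
next
  case one
  have "[(1::int)] \<cdot>\<^bsub>F\<^esub> \<one>\<^bsub>F\<^esub> = \<one>\<^bsub>F\<^esub>" if "acf F" for F :: "'a ring"
  proof -
    interpret acf F by fact
    show ?thesis by simp
  qed
  then show ?case by metis
next
  case (add s t)
  then obtain m n where mn: "\<And>F. acf F \<Longrightarrow> s F (\<lambda>_. \<zero>\<^bsub>F\<^esub>) = [(m::int)] \<cdot>\<^bsub>F\<^esub> \<one>\<^bsub>F\<^esub>"
    "\<And>F. acf F \<Longrightarrow> t F (\<lambda>_. \<zero>\<^bsub>F\<^esub>) = [(n::int)] \<cdot>\<^bsub>F\<^esub> \<one>\<^bsub>F\<^esub>" by blast
  have "[(m + n)] \<cdot>\<^bsub>F\<^esub> \<one>\<^bsub>F\<^esub> = [m] \<cdot>\<^bsub>F\<^esub> \<one>\<^bsub>F\<^esub> \<oplus>\<^bsub>F\<^esub> [n] \<cdot>\<^bsub>F\<^esub> \<one>\<^bsub>F\<^esub>" if "acf F" for F :: "'a ring"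
  proof -
    interpret acf F by fact
    show ?thesis by (simp add: add.int_pow_mult)
  qed
  then show ?case using mn by (intro exI[of _ "m + n"]) simp
next
  case (mult s t)
  then obtain m n where mn: "\<And>F. acf F \<Longrightarrow> s F (\<lambda>_. \<zero>\<^bsub>F\<^esub>) = [(m::int)] \<cdot>\<^bsub>F\<^esub> \<one>\<^bsub>F\<^esub>"
    "\<And>F. acf F \<Longrightarrow> t F (\<lambda>_. \<zero>\<^bsub>F\<^esub>) = [(n::int)] \<cdot>\<^bsub>F\<^esub> \<one>\<^bsub>F\<^esub>" by blast
  have "[(m * n)] \<cdot>\<^bsub>F\<^esub> \<one>\<^bsub>F\<^esub> = [m] \<cdot>\<^bsub>F\<^esub> \<one>\<^bsub>F\<^esub> \<otimes>\<^bsub>F\<^esub> [n] \<cdot>\<^bsub>F\<^esub> \<one>\<^bsub>F\<^esub>" if "acf F" for F :: "'a ring"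
  proof -
    interpret acf F by fact
    show ?thesis by (rule int_mult_one)
  qed
  then show ?case using mn by (intro exI[of _ "m * n"]) simp
next
  case (uminus t)
  then obtain m where m: "\<And>F. acf F \<Longrightarrow> t F (\<lambda>_. \<zero>\<^bsub>F\<^esub>) = [(m::int)] \<cdot>\<^bsub>F\<^esub> \<one>\<^bsub>F\<^esub>" by blast
  have "[(- m)] \<cdot>\<^bsub>F\<^esub> \<one>\<^bsub>F\<^esub> = \<ominus>\<^bsub>F\<^esub> ([m] \<cdot>\<^bsub>F\<^esub> \<one>\<^bsub>F\<^esub>)" if "acf F" for F :: "'a ring"
  proof -
    interpret acf F by fact
    show ?thesis by (simp add: add.int_pow_neg)
  qed
  then show ?case using m by (intro exI[of _ "- m"]) simp
qed

definition agree_on :: "int set \<Rightarrow> 'c ring \<Rightarrow> 'c ring \<Rightarrow> bool" where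
  "agree_on B F F' \<longleftrightarrow> acf F \<and> acf F' \<and>
     (\<forall>m \<in> B. ([m] \<cdot>\<^bsub>F\<^esub> \<one>\<^bsub>F\<^esub> = \<zero>\<^bsub>F\<^esub>) = ([m] \<cdot>\<^bsub>F'\<^esub> \<one>\<^bsub>F'\<^esub> = \<zero>\<^bsub>F'\<^esub>))"

lemma valid_zero: "acf F \<Longrightarrow> valid F (\<lambda>_. \<zero>\<^bsub>F\<^esub>)"
proof -
  assume "acf F"
  then interpret acf F .
  show ?thesis by (auto simp: valid_def acf_axioms)
qed

text \<open>\<open>B\<close> collects the constant coefficients of the atoms of the formula; truth
  depends only on which of them vanish in the field.\<close>

lemma upred_closed_value:
  assumes "upred P"
  shows "\<exists>B. finite B \<and> (\<forall>F F'. agree_on B F F' \<longrightarrow> P F (\<lambda>_. \<zero>\<^bsub>F\<^esub>) = P F' (\<lambda>_. \<zero>\<^bsub>F'\<^esub>))"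
  using assms
proof induction
  case (eq_zero t)
  then obtain m :: int where "\<forall>F. acf F \<longrightarrow> t F (\<lambda>_. \<zero>\<^bsub>F\<^esub>) = [m] \<cdot>\<^bsub>F\<^esub> \<one>\<^bsub>F\<^esub>"
    using uterm_closed_value by blast
  then show ?case unfolding agree_on_def by (intro exI[of _ "{m}"]) simp
next
  case (neg P)
  then show ?case by simp
next
  case (conj P Q)
  then obtain B C where B: "finite B" "\<forall>F F'. agree_on B F F' \<longrightarrow> P F (\<lambda>_. \<zero>\<^bsub>F\<^esub>) = P F' (\<lambda>_. \<zero>\<^bsub>F'\<^esub>)"
    and C: "finite C" "\<forall>F F'. agree_on C F F' \<longrightarrow> Q F (\<lambda>_. \<zero>\<^bsub>F\<^esub>) = Q F' (\<lambda>_. \<zero>\<^bsub>F'\<^esub>)"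
    by (elim exE conjE)
  have "agree_on (B \<union> C) F F' \<Longrightarrow> agree_on B F F' \<and> agree_on C F F'" for F F' :: "'a ring"
    unfolding agree_on_def by simp
  then have "(P F (\<lambda>_. \<zero>\<^bsub>F\<^esub>) \<and> Q F (\<lambda>_. \<zero>\<^bsub>F\<^esub>)) = (P F' (\<lambda>_. \<zero>\<^bsub>F'\<^esub>) \<and> Q F' (\<lambda>_. \<zero>\<^bsub>F'\<^esub>))"
    if "agree_on (B \<union> C) F F'" for F F' using that B(2) C(2) by metis
  then show ?case using B(1) C(1) by (intro exI[of _ "B \<union> C"]) blast
next
  case (cong P Q)
  then obtain B where B: "finite B" "\<forall>F F'. agree_on B F F' \<longrightarrow> P F (\<lambda>_. \<zero>\<^bsub>F\<^esub>) = P F' (\<lambda>_. \<zero>\<^bsub>F'\<^esub>)"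
    by (elim exE conjE)
  have "P F (\<lambda>_. \<zero>\<^bsub>F\<^esub>) = Q F (\<lambda>_. \<zero>\<^bsub>F\<^esub>)" if "acf F" for F
    using cong.hyps(2) valid_zero[OF that] .
  then show ?case using B by (intro exI[of _ B]) (simp add: agree_on_def)
qed

lemma (in domain) prime_multiples_zero:
  assumes "prime p" "[int p] \<cdot> \<one> = \<zero>"
  shows "[(m::int)] \<cdot> \<one> = \<zero> \<longleftrightarrow> int p dvd m"
proof
  assume "int p dvd m"
  then show "[m] \<cdot> \<one> = \<zero>" using assms(2) by (auto simp: int_mult_one)
next
  assume m: "[m] \<cdot> \<one> = \<zero>"
  show "int p dvd m"
  proof (rule ccontr)
    assume "\<not> int p dvd m"
    then have "coprime (int p) m" using assms(1) by (simp add: prime_imp_coprime)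
    then obtain u v where "u * int p + v * m = 1" by (metis bezout_int coprime_imp_gcd_eq_1)
    then have "\<one> = [(u * int p + v * m)] \<cdot> \<one>" by simp
    also have "\<dots> = [(u * int p)] \<cdot> \<one> \<oplus> [(v * m)] \<cdot> \<one>" by (rule add.int_pow_mult) simp
    also have "\<dots> = \<zero>" using m assms(2) by (simp add: int_mult_one)
    finally show False by simp
  qed
qed

text \<open>If some nonzero multiple of one in \<open>B\<close> vanishes, a prime factor of it
  already vanishes, because a domain has no zero divisors, and this prime generates all vanishing
  multiples. Otherwise a prime that divides no nonzero member of \<open>B\<close> will do.\<close>

lemma (in domain) exists_prime_same_multiples:
  assumes "finite B"
  shows "\<exists>p. prime p \<and> (\<forall>m \<in> B. ([(m::int)] \<cdot> \<one> = \<zero>) = (int p dvd m))"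
proof (cases "\<exists>m \<in> B. m \<noteq> 0 \<and> [m] \<cdot> \<one> = \<zero>")
  case True
  then obtain m :: int where m: "m \<noteq> 0" "[m] \<cdot> \<one> = \<zero>" by blast
  have "\<exists>p. prime p \<and> [int p] \<cdot> \<one> = \<zero>" if "n \<noteq> 0" "[int n] \<cdot> \<one> = \<zero>" for n
    using that
  proof (induction n rule: less_induct)
    case (less n)
    have "n \<noteq> 1" using less.prems(2) by (intro notI) simp
    then obtain p where p: "prime p" "p dvd n" using prime_factor_nat by blast
    then obtain k where k: "n = p * k" by blast
    then have "[int p] \<cdot> \<one> \<otimes> [int k] \<cdot> \<one> = \<zero>" using less.prems(2) by (simp add: int_mult_one)
    then consider "[int p] \<cdot> \<one> = \<zero>" | "[int k] \<cdot> \<one> = \<zero>"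
      using integral_iff[of "[int p] \<cdot> \<one>" "[int k] \<cdot> \<one>"] by auto
    then show ?case
    proof cases
      case 2
      have "k < n" "k \<noteq> 0" using k less.prems(1) prime_gt_1_nat[OF p(1)] by auto
      then show ?thesis using less.IH 2 by blast
    qed (use p in blast)
  qed
  moreover have "[int (nat \<bar>m\<bar>)] \<cdot> \<one> = \<zero>"
    using m by (cases "m \<ge> 0") (simp_all add: add.int_pow_neg)
  ultimately obtain p where "prime p" "[int p] \<cdot> \<one> = \<zero>" using m(1) by (metis abs_eq_0 nat_0_iff abs_ge_zero int_nat_eq of_nat_0)
  then show ?thesis using prime_multiples_zero[of p] by (intro exI[of _ p]) simp
next
  case False
  \<comment> \<open>A prime larger than all absolute values divides only the member 0. Inserting 0
    keeps the maximum defined when \<open>B\<close> is empty.\<close>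
  obtain p where p: "prime p" "p > Max ((\<lambda>m. nat \<bar>m\<bar>) ` insert 0 B)" using bigger_prime by blast
  have "([m] \<cdot> \<one> = \<zero>) = (int p dvd m)" if "m \<in> B" for m :: int
  proof (cases "m = 0")
    case False
    have "nat \<bar>m\<bar> < p" using p(2) that assms by (simp add: Max_gr_iff)
    then have "\<not> int p dvd m" using False zdvd_not_zless[of "\<bar>m\<bar>" "int p"] by simp
    then show ?thesis using \<open>\<not> (\<exists>m \<in> B. m \<noteq> 0 \<and> [m] \<cdot> \<one> = \<zero>)\<close> False that by blast
  qed (simp add: add_pow_def)
  then show ?thesis using p(1) by (intro exI[of _ p]) simp
qed

subsection \<open>Algebraic closures of prime fields\<close>

text \<open>\<open>eval\<close> reads lists with the leading coefficient first, \<open>peval\<close>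
  with the constant coefficient first.\<close>

lemma (in cring) eval_eq_peval:
  "set p \<subseteq> carrier R \<Longrightarrow> x \<in> carrier R \<Longrightarrow> eval p x = peval R (rev p) x"
proof (induction p)
  case (Cons a p)
  have "peval R (rev p) x \<in> carrier R" using Cons.prems by auto
  then show ?case using Cons by (simp add: peval_append a_comm m_comm)
qed simp

lemma algebraically_closed_imp_acf:
  assumes "algebraically_closed L" shows "acf (L :: 'a ring)"
proof -
  interpret algebraically_closed L by fact
  show ?thesis
  proof
    fix as a assume as: "set as \<subseteq> carrier L" "as \<noteq> []" "a \<in> carrier L" "a \<noteq> \<zero>\<^bsub>L\<^esub>"
    let ?p = "rev (as @ [a])"
    have p: "?p \<in> carrier (poly_ring L)" "set ?p \<subseteq> carrier L"
      using as by (auto simp: univ_poly_carrier[symmetric] polynomial_def)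
    have "size (roots ?p) = length as" using roots_over_carrier[OF p(1)] by (simp add: splitted_def)
    then have "roots ?p \<noteq> {#}" using as(2) by auto
    then obtain x where "x \<in># roots ?p" by blast
    then have "x \<in> carrier L" "eval ?p x = \<zero>\<^bsub>L\<^esub>"
      using roots_mem_iff_is_root[OF p(1)] by (auto simp: is_root_def)
    then show "\<exists>c \<in> carrier L. peval L (as @ [a]) c = \<zero>\<^bsub>L\<^esub>"
      using eval_eq_peval[OF p(2)] by (intro bexI[of _ x]) simp_all
  qed
qed

section \<open>The Frobenius endomorphism\<close>

context cring
begin

lemma nat_pow_add_binomial:
  assumes x: "x \<in> carrier R" and y: "y \<in> carrier R"
  shows "(x \<oplus> y) [^] (n::nat) = (\<Oplus>i \<in> {..n}. [(n choose i)] \<cdot> (x [^] i \<otimes> y [^] (n - i)))"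
proof (induction n)
  case 0
  show ?case using x y by simp
next
  case (Suc n)
  let ?f = "\<lambda>i. [(n choose i)] \<cdot> (x [^] i \<otimes> y [^] (n - i))"
  \<comment> \<open>The two halves of Pascal's rule, indexed by the exponent of x: multiplication by
    x gives \<open>?A\<close> with index shifted by one, so it gets a zero at index 0, and
    multiplication by y gives \<open>?B\<close>, whose term at n + 1 vanishes with the binomial
    coefficient.\<close>
  let ?A = "\<lambda>i. if i = 0 then \<zero> else [(n choose (i - 1))] \<cdot> (x [^] i \<otimes> y [^] (Suc n - i))"
  let ?B = "\<lambda>i. [(n choose i)] \<cdot> (x [^] i \<otimes> y [^] (Suc n - i))"
  have [simp]: "x \<in> carrier R" "y \<in> carrier R" by fact+
  have fx: "x \<otimes> ?f i = ?A (Suc i)" for i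
    by (simp add: add_pow_rdistr m_assoc[symmetric] nat_pow_Suc2[symmetric] del: nat_pow_Suc)
  have fy: "y \<otimes> ?f i = ?B i" if "i \<le> n" for i
    using that by (simp add: add_pow_rdistr m_ac Suc_diff_le)
  have AB: "?A i \<oplus> ?B i = [(Suc n choose i)] \<cdot> (x [^] i \<otimes> y [^] (Suc n - i))" for i
  proof (cases i)
    case (Suc j)
    let ?u = "x [^] i \<otimes> y [^] (Suc n - i)"
    have "[(n choose j)] \<cdot> ?u \<oplus> [(n choose Suc j)] \<cdot> ?u = [((n choose j) + (n choose Suc j))] \<cdot> ?u"
      by (rule add.nat_pow_mult) simp
    then show ?thesis using Suc by simp
  qed simp
  have "(x \<oplus> y) [^] Suc n = (x \<oplus> y) \<otimes> (\<Oplus>i \<in> {..n}. ?f i)"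
    by (simp add: Suc[symmetric] m_comm)
  also have "\<dots> = x \<otimes> (\<Oplus>i \<in> {..n}. ?f i) \<oplus> y \<otimes> (\<Oplus>i \<in> {..n}. ?f i)"
    by (intro l_distr finsum_closed) auto
  also have "x \<otimes> (\<Oplus>i \<in> {..n}. ?f i) = (\<Oplus>i \<in> {..n}. x \<otimes> ?f i)"
    by (intro finsum_rdistr) auto
  also have "\<dots> = (\<Oplus>i \<in> {..n}. ?A (Suc i))" by (simp only: fx)
  also have "\<dots> = (\<Oplus>i \<in> {..n}. ?A (Suc i)) \<oplus> ?A 0"
    by (simp add: finsum_closed Pi_def)
  also have "\<dots> = (\<Oplus>i \<in> {..Suc n}. ?A i)"
    by (rule finsum_Suc2[symmetric]) auto
  also have "y \<otimes> (\<Oplus>i \<in> {..n}. ?f i) = (\<Oplus>i \<in> {..n}. y \<otimes> ?f i)"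
    by (intro finsum_rdistr) auto
  also have "\<dots> = (\<Oplus>i \<in> {..n}. ?B i)" by (intro finsum_cong') (auto simp: fy)
  also have "\<dots> = ?B (Suc n) \<oplus> (\<Oplus>i \<in> {..n}. ?B i)"
    by (simp add: finsum_closed Pi_def binomial_eq_0)
  also have "\<dots> = (\<Oplus>i \<in> {..Suc n}. ?B i)"
    by (rule finsum_Suc[symmetric]) auto
  also have "(\<Oplus>i \<in> {..Suc n}. ?A i) \<oplus> (\<Oplus>i \<in> {..Suc n}. ?B i) = (\<Oplus>i \<in> {..Suc n}. ?A i \<oplus> ?B i)"
    by (rule finsum_addf[symmetric]) auto
  finally show ?case by (simp only: AB)
qed

text \<open>All binomial coefficients except the two outer ones are divisible by p.\<close>

lemma prime_char_pow_add:
  assumes p: "prime p" and char: "[p] \<cdot> \<one> = \<zero>" and x: "x \<in> carrier R" and y: "y \<in> carrier R"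
  shows "(x \<oplus> y) [^] p = x [^] p \<oplus> y [^] (p::nat)"
proof -
  \<comment> \<open>This form of p lets the first and the last summand be split off
    separately.\<close>
  obtain q where q: "p = Suc (Suc q)" using prime_ge_2_nat[OF p] by (metis add_2_eq_Suc le_Suc_ex)
  let ?f = "\<lambda>i. [(p choose i)] \<cdot> (x [^] i \<otimes> y [^] (p - i))"
  have cl: "?f i \<in> carrier R" for i using x y by simp
  have z: "?f i = \<zero>" if i: "0 < i" "i < p" for i
  proof -
    have "p dvd (p choose i)" using p i by (intro dvd_choose_prime) auto
    then obtain m where m: "p choose i = p * m" by blast
    have "[(p * m)] \<cdot> \<one> = [m] \<cdot> ([p] \<cdot> \<one>)" by (rule add.nat_pow_pow[symmetric]) simp
    then have "[(p * m)] \<cdot> \<one> = \<zero>" using char by simp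
    moreover have "[(p * m)] \<cdot> (\<one> \<otimes> u) = [(p * m)] \<cdot> \<one> \<otimes> u" if "u \<in> carrier R" for u
      using that by (intro add_pow_ldistr[symmetric]) auto
    ultimately show ?thesis using x y unfolding m by simp
  qed
  have "(x \<oplus> y) [^] p = (\<Oplus>i \<in> {..Suc (Suc q)}. ?f i)"
    using nat_pow_add_binomial[OF x y, of p] unfolding q .
  also have "\<dots> = ?f (Suc (Suc q)) \<oplus> (\<Oplus>i \<in> {..Suc q}. ?f i)"
    by (rule finsum_Suc) (use cl in auto)
  also have "(\<Oplus>i \<in> {..Suc q}. ?f i) = (\<Oplus>i \<in> {..q}. ?f (Suc i)) \<oplus> ?f 0"
    by (rule finsum_Suc2) (use cl in auto)
  also have "(\<Oplus>i \<in> {..q}. ?f (Suc i)) = (\<Oplus>i \<in> {..q}. \<zero>)"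
    by (intro finsum_cong' z) (use q in auto)
  finally show ?thesis using x y unfolding q by simp
qed

end

text \<open>Every finite set lies in the finite fixed set of one endomorphism. This is all that is
  used of the closure of a finite field; as it does not mention powers, it is easily carried over to
  an isomorphic copy.\<close>

definition locally_fixed :: "'c ring \<Rightarrow> bool" where
  "locally_fixed L \<longleftrightarrow> (\<forall>Z. finite Z \<and> Z \<subseteq> carrier L \<longrightarrow>
     (\<exists>\<sigma> \<in> ring_hom L L. (\<forall>x \<in> Z. \<sigma> x = x) \<and> finite {x \<in> carrier L. \<sigma> x = x}))"

lemma (in domain) finite_pow_fixed:
  assumes "n \<ge> 2" shows "finite {x \<in> carrier R. x [^] (n::nat) = x}"
proof -
  obtain m where n: "n = Suc (Suc m)" using assms by (metis add_2_eq_Suc le_Suc_ex)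
  \<comment> \<open>The coefficients of X^n - X. For n at least 2 the two terms occupy different
    places, so the leading coefficient is 1.\<close>
  let ?l = "([\<zero>, \<ominus> \<one>] @ replicate m \<zero>) @ [\<one>]"
  have "peval R ?l x = \<zero>" if x: "x \<in> carrier R" "x [^] n = x" for x
  proof -
    have "peval R ?l x = peval R ([\<zero>, \<ominus> \<one>] @ replicate m \<zero>) x \<oplus> x [^] n \<otimes> \<one>"
      using x(1) n by (subst peval_append) auto
    also have "peval R ([\<zero>, \<ominus> \<one>] @ replicate m \<zero>) x = \<ominus> x"
      using x(1) by (simp add: peval_replicate_zero r_minus)
    finally show ?thesis using x by (simp add: l_neg)
  qed
  then have "{x \<in> carrier R. x [^] n = x} \<subseteq> {x \<in> carrier R. peval R ?l x = \<zero>}" by blast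
  moreover have "finite {x \<in> carrier R. peval R ?l x = \<zero>}"
    by (rule finite_roots_peval) auto
  ultimately show ?thesis by (rule finite_subset)
qed

text \<open>An element x is a root of a nonzero polynomial over the prime field. Frobenius fixes its
  coefficients and hence maps roots to roots, so the orbit of x is finite; by injectivity x itself
  recurs. A common multiple of the periods gives one iterate that fixes finitely many
  elements.\<close>

lemma algebraic_closure_locally_fixed:
  assumes p: "prime p" and L: "algebraic_closure L K" and char: "[(p::nat)] \<cdot>\<^bsub>L\<^esub> \<one>\<^bsub>L\<^esub> = \<zero>\<^bsub>L\<^esub>"
    and K: "\<And>x. x \<in> K \<Longrightarrow> \<exists>n::nat. x = [n] \<cdot>\<^bsub>L\<^esub> \<one>\<^bsub>L\<^esub>"
  shows "locally_fixed (L :: 'a ring)"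
proof -
  interpret algebraic_closure L K by fact
  define \<phi> where "\<phi> x = x [^]\<^bsub>L\<^esub> p" for x
  have p2: "p \<ge> 2" using p by (rule prime_ge_2_nat)
  have hom: "\<phi> \<in> ring_hom L L"
    unfolding \<phi>_def using prime_char_pow_add[OF p char]
    by (intro ring_hom_memI) (auto simp: nat_pow_distrib)
  have ring: "ring L" by (rule ring_axioms)
  have fld: "field L" by (rule field_axioms)
  have \<phi>K: "\<phi> x = x" if x: "x \<in> K" for x
  proof -
    have "\<phi> ([n] \<cdot>\<^bsub>L\<^esub> \<one>\<^bsub>L\<^esub>) = [n] \<cdot>\<^bsub>L\<^esub> \<one>\<^bsub>L\<^esub>" for n :: nat
    proof (induction n)
      case 0
      show ?case using ring_hom_zero[OF hom ring ring] by simp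
    next
      case (Suc n)
      then show ?case using ring_hom_add[OF hom, of "[n] \<cdot>\<^bsub>L\<^esub> \<one>\<^bsub>L\<^esub>" "\<one>\<^bsub>L\<^esub>"] ring_hom_one[OF hom] by simp
    qed
    then show ?thesis using K[OF x] by blast
  qed
  have iter_hom: "\<phi> ^^ n \<in> ring_hom L L" for n
  proof (induction n)
    case 0
    show ?case by (simp add: ring_hom_def)
  next
    case (Suc n)
    show ?case using ring_hom_trans[OF Suc hom] by (simp add: comp_def)
  qed
  have iter_closed: "(\<phi> ^^ n) x \<in> carrier L" if "x \<in> carrier L" for x n
    using ring_hom_closed[OF iter_hom that] .
  have iter_pow: "(\<phi> ^^ n) x = x [^]\<^bsub>L\<^esub> (p ^ n)" if "x \<in> carrier L" for x n
    using that by (induction n) (auto simp: \<phi>_def nat_pow_pow mult.commute)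
  have periodic: "\<exists>d>0. (\<phi> ^^ d) x = x" if x: "x \<in> carrier L" for x
  proof -
    obtain f where f: "f \<in> carrier (K[X]\<^bsub>L\<^esub>)" "f \<noteq> []" "eval f x = \<zero>\<^bsub>L\<^esub>"
      using algebraicE[OF subfieldE(1)[OF subfield_axioms] x algebraic_extension[OF x]] by blast
    have fK: "set f \<subseteq> K" "hd f \<noteq> \<zero>\<^bsub>L\<^esub>"
      using f(1,2) unfolding univ_poly_carrier[symmetric] polynomial_def by auto
    have fL: "set f \<subseteq> carrier L" using fK(1) subfieldE(3)[OF subfield_axioms] by blast
    let ?l = "rev f"
    have l: "set ?l \<subseteq> carrier L" "?l \<noteq> []" "last ?l \<noteq> \<zero>\<^bsub>L\<^esub>" "map \<phi> ?l = ?l"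
      using fL f(2) fK \<phi>K by (auto simp: last_rev intro!: map_idI)
    have root: "peval L ?l ((\<phi> ^^ n) x) = \<zero>\<^bsub>L\<^esub>" for n
    proof (induction n)
      case 0
      show ?case using f(3) eval_eq_peval[OF fL x] by simp
    next
      case (Suc n)
      have "peval L (map \<phi> ?l) (\<phi> ((\<phi> ^^ n) x)) = \<phi> (peval L ?l ((\<phi> ^^ n) x))"
        by (rule peval_hom[OF hom ring ring l(1) iter_closed[OF x]])
      then show ?case unfolding l(4) Suc using ring_hom_zero[OF hom ring ring] by simp
    qed
    have "finite (range (\<lambda>n. (\<phi> ^^ n) x))"
      by (rule finite_subset[OF _ finite_roots_peval[OF l(1-3)]]) (use root iter_closed[OF x] in auto)
    then have "\<not> inj (\<lambda>n. (\<phi> ^^ n) x)" using finite_imageD infinite_UNIV_nat by blast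
    then obtain i j where ij: "i < j" "(\<phi> ^^ i) x = (\<phi> ^^ j) x"
      unfolding inj_def by (metis nat_neq_iff)
    have "(\<phi> ^^ i) x = (\<phi> ^^ i) ((\<phi> ^^ (j - i)) x)"
      using ij by (metis add_diff_inverse_nat comp_apply funpow_add less_imp_not_less)
    then have "x = (\<phi> ^^ (j - i)) x"
      by (rule field_hom_inj[OF iter_hom fld fld x iter_closed[OF x]])
    then show ?thesis using ij(1) by (intro exI[of _ "j - i"]) simp
  qed
  have mult_fixed: "(\<phi> ^^ (d * m)) x = x" if "(\<phi> ^^ d) x = x" for d m x
    using that by (induction m) (auto simp: funpow_add)
  have common: "\<exists>d>0. \<forall>x \<in> Z. (\<phi> ^^ d) x = x" if "finite Z" "Z \<subseteq> carrier L" for Z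
    using that
  proof (induction Z)
    case (insert x Z)
    then obtain d where d: "d > 0" "\<forall>x \<in> Z. (\<phi> ^^ d) x = x" by blast
    obtain e where e: "e > 0" "(\<phi> ^^ e) x = x" using periodic insert.prems by blast
    show ?case
      \<comment> \<open>The product of two periods is a common period.\<close>
      using d e mult_fixed[of d _ e] mult_fixed[of e x d]
      by (intro exI[of _ "d * e"]) (auto simp: mult.commute)
  qed (intro exI[of _ 1], simp)
  show ?thesis
    unfolding locally_fixed_def
  proof (intro allI impI, elim conjE)
    fix Z assume "finite Z" "Z \<subseteq> carrier L"
    then obtain d where d: "d > 0" "\<forall>x \<in> Z. (\<phi> ^^ d) x = x" using common by blast
    \<comment> \<open>The iterate is the power map with exponent p^d, and d > 0 excludes the
      identity, which would fix everything.\<close>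
    have "p ^ d \<ge> 2" using p2 d(1) by (metis self_le_power order_trans one_le_numeral)
    then have "finite {x \<in> carrier L. (\<phi> ^^ d) x = x}"
      using finite_pow_fixed iter_pow by (simp cong: conj_cong)
    then show "\<exists>\<sigma> \<in> ring_hom L L. (\<forall>x \<in> Z. \<sigma> x = x) \<and> finite {x \<in> carrier L. \<sigma> x = x}"
      using d(2) iter_hom by blast
  qed
qed

text \<open>The type of \<open>L\<close> is dictated by the construction of the algebraic closure of
  a field of integers modulo p: functions from multisets of indexed variables to coefficients. It is
  the same type for all p.\<close>

lemma exists_locally_fixed_acf:
  assumes p: "prime p"
  shows "\<exists>L :: ((int list \<times> nat) multiset \<Rightarrow> int) ring.
    acf L \<and> [int p] \<cdot>\<^bsub>L\<^esub> \<one>\<^bsub>L\<^esub> = \<zero>\<^bsub>L\<^esub> \<and> locally_fixed L"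
proof -
  let ?R = "residue_ring (int p)"
  interpret R: residues_prime p ?R using p by unfold_locales simp_all
  obtain L :: "((int list \<times> nat) multiset \<Rightarrow> int) ring" where
    L: "algebraic_closure L (R.indexed_const ` carrier ?R)" and h: "R.indexed_const \<in> ring_hom ?R L"
    using R.exists_closure by blast
  interpret L: algebraic_closure L "R.indexed_const ` carrier ?R" by fact
  have val: "[n] \<cdot>\<^bsub>?R\<^esub> \<one>\<^bsub>?R\<^esub> = int n mod int p" for n :: nat
  proof (induction n)
    case 0
    show ?case by (simp add: R.res_zero_eq)
  next
    case (Suc n)
    then show ?case by (simp add: R.res_add_eq R.res_one_eq mod_simps add.commute)
  qed
  have hval: "R.indexed_const ([n] \<cdot>\<^bsub>?R\<^esub> \<one>\<^bsub>?R\<^esub>) = [n] \<cdot>\<^bsub>L\<^esub> \<one>\<^bsub>L\<^esub>" for n :: nat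
  proof (induction n)
    case 0
    show ?case using ring_hom_zero[OF h R.ring_axioms L.ring_axioms] by simp
  next
    case (Suc n)
    then show ?case
      using ring_hom_add[OF h, of "[n] \<cdot>\<^bsub>?R\<^esub> \<one>\<^bsub>?R\<^esub>" "\<one>\<^bsub>?R\<^esub>"] ring_hom_one[OF h] by simp
  qed
  have char: "[p] \<cdot>\<^bsub>L\<^esub> \<one>\<^bsub>L\<^esub> = \<zero>\<^bsub>L\<^esub>"
    using hval[of p] val[of p] ring_hom_zero[OF h R.ring_axioms L.ring_axioms] by (simp add: R.res_zero_eq)
  have "\<exists>n::nat. x = [n] \<cdot>\<^bsub>L\<^esub> \<one>\<^bsub>L\<^esub>" if x: "x \<in> R.indexed_const ` carrier ?R" for x
  proof -
    obtain a where a: "a \<in> carrier ?R" "x = R.indexed_const a" using x by blast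
    then have "a = int (nat a) mod int p" by (simp add: R.res_carrier_eq)
    then have "x = [nat a] \<cdot>\<^bsub>L\<^esub> \<one>\<^bsub>L\<^esub>" using hval[of "nat a"] val[of "nat a"] a(2) by simp
    then show ?thesis by blast
  qed
  then have "locally_fixed L" by (rule algebraic_closure_locally_fixed[OF p L char])
  moreover have "acf L" by (rule algebraically_closed_imp_acf) unfold_locales
  moreover have "[int p] \<cdot>\<^bsub>L\<^esub> \<one>\<^bsub>L\<^esub> = \<zero>\<^bsub>L\<^esub>" using char by (simp add: add_pow_int_ge)
  ultimately show ?thesis by blast
qed

section \<open>Moving a field along an injection\<close>

lemma acf_image_ring:
  assumes "acf (F :: 'a ring)" "inj_on h (carrier F)"
  shows "acf (image_ring h F)" "h \<in> ring_hom F (image_ring h F)" "carrier (image_ring h F) = h ` carrier F"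
proof -
  interpret acf F by fact
  interpret I: field "image_ring h F" using assms(2) by (rule inj_imp_image_ring_is_field)
  show hom: "h \<in> ring_hom F (image_ring h F)"
    using inj_imp_image_ring_iso[OF assms(2)] by (simp add: ring_iso_def)
  show car: "carrier (image_ring h F) = h ` carrier F" by (rule image_ring_carrier)
  show "acf (image_ring h F)"
  proof
    fix as a assume as: "set as \<subseteq> carrier (image_ring h F)" "as \<noteq> []" "a \<in> carrier (image_ring h F)"
      "a \<noteq> \<zero>\<^bsub>image_ring h F\<^esub>"
    obtain b where b: "b \<in> carrier F" "a = h b" using as(3) car by blast
    define bs where "bs = map (inv_into (carrier F) h) as"
    have bs: "set bs \<subseteq> carrier F" "map h bs = as"
      using as(1) unfolding bs_def car
      by (auto simp: inv_into_into f_inv_into_f subset_iff intro!: map_idI)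
    have "b \<noteq> \<zero>\<^bsub>F\<^esub>" using as(4) b ring_hom_zero[OF hom ring_axioms I.ring_axioms] by auto
    then obtain c where c: "c \<in> carrier F" "peval F (bs @ [b]) c = \<zero>\<^bsub>F\<^esub>"
      using exists_root[OF bs(1) _ b(1)] bs(2) as(2) by auto
    have "peval (image_ring h F) (map h (bs @ [b])) (h c) = h (peval F (bs @ [b]) c)"
      using bs(1) b(1) c(1) by (intro peval_hom[OF hom ring_axioms I.ring_axioms]) auto
    then show "\<exists>c \<in> carrier (image_ring h F). peval (image_ring h F) (as @ [a]) c = \<zero>\<^bsub>image_ring h F\<^esub>"
      using c bs(2) b(2) ring_hom_zero[OF hom ring_axioms I.ring_axioms] car by (intro bexI[of _ "h c"]) auto
  qed
qed

text \<open>The endomorphism is conjugated by the bijection \<open>h\<close>.\<close>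

lemma locally_fixed_image_ring:
  assumes "locally_fixed F" "acf F" "inj_on h (carrier F)"
  shows "locally_fixed (image_ring h F)"
  unfolding locally_fixed_def
proof (intro allI impI, elim conjE)
  note I = acf_image_ring[OF assms(2,3)]
  let ?i = "inv_into (carrier F) h"
  fix Z assume Z: "finite Z" "Z \<subseteq> carrier (image_ring h F)"
  then have "finite (?i ` Z)" "?i ` Z \<subseteq> carrier F" unfolding I(3) by (auto intro: inv_into_into)
  then obtain \<sigma> where \<sigma>: "\<sigma> \<in> ring_hom F F" "\<forall>x \<in> ?i ` Z. \<sigma> x = x" "finite {x \<in> carrier F. \<sigma> x = x}"
    using assms(1) unfolding locally_fixed_def by meson
  have ih: "?i (h x) = x" if "x \<in> carrier F" for x using that assms(3) by simp
  have \<sigma>c: "\<sigma> x \<in> carrier F" if "x \<in> carrier F" for x using \<sigma>(1) that by (rule ring_hom_closed)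
  have "(\<lambda>x. h (\<sigma> (?i x))) \<in> ring_hom (image_ring h F) (image_ring h F)"
  proof -
    interpret acf F by fact
    interpret J: acf "image_ring h F" by (rule I(1))
    show ?thesis
    proof (rule ring_hom_memI)
      fix x y assume "x \<in> carrier (image_ring h F)" "y \<in> carrier (image_ring h F)"
      then obtain a b where ab: "a \<in> carrier F" "b \<in> carrier F" "x = h a" "y = h b" unfolding I(3) by blast
      show "h (\<sigma> (?i x)) \<in> carrier (image_ring h F)" using ab \<sigma>c I(3) ih by simp
      show "h (\<sigma> (?i (x \<otimes>\<^bsub>image_ring h F\<^esub> y))) = h (\<sigma> (?i x)) \<otimes>\<^bsub>image_ring h F\<^esub> h (\<sigma> (?i y))"
        using ab \<sigma>c ih by (simp add: ring_hom_mult[OF I(2), symmetric] ring_hom_mult[OF \<sigma>(1)])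
      show "h (\<sigma> (?i (x \<oplus>\<^bsub>image_ring h F\<^esub> y))) = h (\<sigma> (?i x)) \<oplus>\<^bsub>image_ring h F\<^esub> h (\<sigma> (?i y))"
        using ab \<sigma>c ih by (simp add: ring_hom_add[OF I(2), symmetric] ring_hom_add[OF \<sigma>(1)])
    next
      show "h (\<sigma> (?i \<one>\<^bsub>image_ring h F\<^esub>)) = \<one>\<^bsub>image_ring h F\<^esub>"
        using ih ring_hom_one[OF I(2)] ring_hom_one[OF \<sigma>(1)] by (metis one_closed)
    qed
  qed
  moreover have "\<forall>x \<in> Z. h (\<sigma> (?i x)) = x"
    using \<sigma>(2) Z(2) I(3) by (auto simp: f_inv_into_f)
  moreover have "{x \<in> carrier (image_ring h F). h (\<sigma> (?i x)) = x} \<subseteq> h ` {x \<in> carrier F. \<sigma> x = x}"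
    using ih \<sigma>c assms(3) unfolding I(3) by (auto simp: inj_on_eq_iff[OF assms(3)])
  then have "finite {x \<in> carrier (image_ring h F). h (\<sigma> (?i x)) = x}"
    using \<sigma>(3) finite_subset by blast
  ultimately show "\<exists>\<sigma> \<in> ring_hom (image_ring h F) (image_ring h F).
      (\<forall>x \<in> Z. \<sigma> x = x) \<and> finite {x \<in> carrier (image_ring h F). \<sigma> x = x}"
    by (intro bexI[of _ "\<lambda>x. h (\<sigma> (?i x))"] conjI)
qed

text \<open>The type \<open>'c\<close> has to contain copies of the closures of all prime fields.\<close>

theorem transfer_to_locally_finite:
  fixes P :: "'c ring \<Rightarrow> ('v \<Rightarrow> 'c) \<Rightarrow> bool"
  assumes P: "upred P" "valid F e" "P F e"
    and h: "inj (h :: ((int list \<times> nat) multiset \<Rightarrow> int) \<Rightarrow> 'c)"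
  obtains L e' \<sigma> where "valid L e'" "P L e'" "\<sigma> \<in> ring_hom L L" "\<sigma> \<circ> e' = e'"
    "finite {x \<in> carrier L. \<sigma> x = x}"
proof -
  obtain V where V: "finite V" "depends_on V P" using upred_finite_support[OF P(1)] by blast
  \<comment> \<open>All parameters in the support become existentially quantified, so the truth of
    \<open>Q\<close> at the zero environment depends only on the field.\<close>
  define Q where "Q = (\<lambda>F e. \<exists>e'. range e' \<subseteq> carrier F \<and> (\<forall>v. v \<notin> V \<longrightarrow> e' v = e v) \<and> P F e')"
  have "upred Q" unfolding Q_def by (rule upred_exs[OF V(1) P(1)])
  then obtain B where B: "finite B" "\<forall>F F'. agree_on B F F' \<longrightarrow> Q F (\<lambda>_. \<zero>\<^bsub>F\<^esub>) = Q F' (\<lambda>_. \<zero>\<^bsub>F'\<^esub>)"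
    using upred_closed_value by blast
  interpret F: acf F using P(2) by (rule validD)
  obtain p where p: "prime p" "\<forall>m \<in> B. ([(m::int)] \<cdot>\<^bsub>F\<^esub> \<one>\<^bsub>F\<^esub> = \<zero>\<^bsub>F\<^esub>) = (int p dvd m)"
    using F.exists_prime_same_multiples[OF B(1)] by blast
  obtain L0 :: "((int list \<times> nat) multiset \<Rightarrow> int) ring" where
    L0: "acf L0" "[int p] \<cdot>\<^bsub>L0\<^esub> \<one>\<^bsub>L0\<^esub> = \<zero>\<^bsub>L0\<^esub>" "locally_fixed L0"
    using exists_locally_fixed_acf[OF p(1)] by blast
  define L where "L = image_ring h L0"
  have hi: "inj_on h (carrier L0)" using h by (rule inj_on_subset) simp
  note I = acf_image_ring[OF L0(1) hi, folded L_def]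
  interpret L0: acf L0 by fact
  interpret L: acf L by (rule I(1))
  interpret H: ring_hom_ring L0 L h using I(2) L0.ring_axioms L.ring_axioms by (intro ring_hom_ringI2)
  have "h ([n] \<cdot>\<^bsub>L0\<^esub> \<one>\<^bsub>L0\<^esub>) = [n] \<cdot>\<^bsub>L\<^esub> \<one>\<^bsub>L\<^esub>" for n :: nat
    by (induction n) simp_all
  then have "[int p] \<cdot>\<^bsub>L\<^esub> \<one>\<^bsub>L\<^esub> = \<zero>\<^bsub>L\<^esub>"
    using L0(2) by (metis H.hom_zero add_pow_int_ge nat_int of_nat_0_le_iff)
  then have "\<forall>m \<in> B. ([(m::int)] \<cdot>\<^bsub>L\<^esub> \<one>\<^bsub>L\<^esub> = \<zero>\<^bsub>L\<^esub>) = (int p dvd m)"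
    using L.prime_multiples_zero[OF p(1)] by simp
  then have "agree_on B F L" using p(2) F.acf_axioms L.acf_axioms unfolding agree_on_def by simp
  then have QL: "Q F (\<lambda>_. \<zero>\<^bsub>F\<^esub>) = Q L (\<lambda>_. \<zero>\<^bsub>L\<^esub>)" using B(2) by blast
  \<comment> \<open>Variables outside the support are set to zero without affecting
    \<open>P\<close>; this makes the given environment a witness for \<open>Q\<close> at the zero
    environment.\<close>
  let ?e = "\<lambda>v. if v \<in> V then e v else \<zero>\<^bsub>F\<^esub>"
  have "valid F ?e" using P(2) by (auto simp: valid_def)
  moreover have "P F ?e = P F e"
    using V(2) \<open>valid F ?e\<close> P(2) unfolding depends_on_def by simp
  ultimately have "Q F (\<lambda>_. \<zero>\<^bsub>F\<^esub>)" unfolding Q_def using P(3)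
    by (intro exI[of _ ?e]) (auto simp: valid_def)
  then obtain e' where e': "range e' \<subseteq> carrier L" "\<forall>v. v \<notin> V \<longrightarrow> e' v = \<zero>\<^bsub>L\<^esub>" "P L e'"
    using QL unfolding Q_def by auto
  have "locally_fixed L" unfolding L_def by (rule locally_fixed_image_ring[OF L0(3,1) hi])
  moreover have "finite (e' ` V)" "e' ` V \<subseteq> carrier L" using V(1) e'(1) by auto
  ultimately obtain \<sigma> where \<sigma>: "\<sigma> \<in> ring_hom L L" "\<forall>x \<in> e' ` V. \<sigma> x = x" "finite {x \<in> carrier L. \<sigma> x = x}"
    unfolding locally_fixed_def by meson
  \<comment> \<open>The finitely many values on \<open>V\<close> are fixed by choice, and all other
    values are zero, which every ring homomorphism fixes.\<close>
  have "\<sigma> (e' v) = e' v" for v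
    using \<sigma>(2) e'(2) ring_hom_zero[OF \<sigma>(1) L.ring_axioms L.ring_axioms] by (cases "v \<in> V") auto
  then have "\<sigma> \<circ> e' = e'" by auto
  moreover have "valid L e'" using e'(1) L.acf_axioms by (simp add: valid_def)
  ultimately show ?thesis using that e'(3) \<sigma>(1,3) by blast
qed

section \<open>Noetherian rings of functions\<close>

text \<open>Algebraic sets are given by polynomial functions, so the Noetherian property is proved
  for rings of functions on a set \<open>E\<close>, without formal polynomials.\<close>

locale fun_ring = cring K for K (structure) +
  fixes E :: "'p set" and A :: "('p \<Rightarrow> 'a) set"
  assumes A_closed: "a \<in> A \<Longrightarrow> x \<in> E \<Longrightarrow> a x \<in> carrier K"
    and A_const: "c \<in> carrier K \<Longrightarrow> (\<lambda>_. c) \<in> A"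
    and A_add: "a \<in> A \<Longrightarrow> b \<in> A \<Longrightarrow> (\<lambda>x. a x \<oplus> b x) \<in> A"
    and A_mult: "a \<in> A \<Longrightarrow> b \<in> A \<Longrightarrow> (\<lambda>x. a x \<otimes> b x) \<in> A"
begin

text \<open>The ideal generated by \<open>B\<close>, up to values outside \<open>E\<close>. Its
  members need not lie in \<open>A\<close>, but agree on \<open>E\<close> with members of
  \<open>A\<close>.\<close>

inductive_set idl :: "('p \<Rightarrow> 'a) set \<Rightarrow> ('p \<Rightarrow> 'a) set" for B where
  idl_zero: "(\<lambda>x. \<zero>) \<in> idl B"
| idl_step: "b \<in> B \<Longrightarrow> a \<in> A \<Longrightarrow> f \<in> idl B \<Longrightarrow> (\<lambda>x. a x \<otimes> b x \<oplus> f x) \<in> idl B"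
| idl_cong: "f \<in> idl B \<Longrightarrow> (\<And>x. x \<in> E \<Longrightarrow> f x = g x) \<Longrightarrow> g \<in> idl B"

lemma idl_closed: "f \<in> idl B \<Longrightarrow> B \<subseteq> A \<Longrightarrow> x \<in> E \<Longrightarrow> f x \<in> carrier K"
proof (induction rule: idl.induct)
  case (idl_step b a f)
  then show ?case using A_closed[of a x] A_closed[of b x] by auto
qed auto

lemma idl_mono: "f \<in> idl B \<Longrightarrow> B \<subseteq> C \<Longrightarrow> f \<in> idl C"
  by (induction rule: idl.induct) (auto intro: idl.intros)

lemma idl_base: "b \<in> B \<Longrightarrow> B \<subseteq> A \<Longrightarrow> b \<in> idl B"
  using A_closed by (intro idl_cong[OF idl_step[OF _ A_const[of \<one>] idl_zero]]) auto

lemma idl_add: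
  assumes "f \<in> idl B" "g \<in> idl B" "B \<subseteq> A" shows "(\<lambda>x. f x \<oplus> g x) \<in> idl B"
  using assms(1)
proof induction
  case idl_zero
  show ?case using idl_closed[OF assms(2,3)] by (intro idl_cong[OF assms(2)]) auto
next
  case (idl_step b a f)
  have "b \<in> A" using idl_step.hyps assms(3) by blast
  then show ?case
    using idl_closed[OF assms(2,3)] idl_closed[OF idl_step.hyps(3) assms(3)]
      A_closed[of a] A_closed[of b] idl_step.hyps
    by (intro idl_cong[OF idl.idl_step[OF idl_step.hyps(1,2) idl_step.IH]]) (simp add: a_assoc)
next
  case (idl_cong f h)
  then show ?case by (intro idl.idl_cong[OF idl_cong.IH]) auto
qed

lemma idl_smult:
  assumes "f \<in> idl B" "c \<in> A" "B \<subseteq> A" shows "(\<lambda>x. c x \<otimes> f x) \<in> idl B"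
  using assms(1)
proof induction
  case idl_zero
  show ?case using A_closed[OF assms(2)] by (intro idl_cong[OF idl.idl_zero]) auto
next
  case (idl_step b a f)
  have "b \<in> A" using idl_step.hyps assms(3) by blast
  then show ?case
    using A_closed[OF assms(2)] idl_closed[OF idl_step.hyps(3) assms(3)]
      A_closed[of a] A_closed[of b] idl_step.hyps
    by (intro idl_cong[OF idl.idl_step[OF idl_step.hyps(1) A_mult[OF assms(2) idl_step.hyps(2)] idl_step.IH]])
      (simp add: r_distr m_assoc)
next
  case (idl_cong f h)
  then show ?case by (intro idl.idl_cong[OF idl_cong.IH]) auto
qed

lemma idl_trans:
  assumes "f \<in> idl B" "B \<subseteq> idl C" "C \<subseteq> A" shows "f \<in> idl C"
  using assms(1)
proof induction
  case idl_zero
  show ?case by (rule idl.idl_zero)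
next
  case (idl_step b a f)
  then show ?case using assms by (intro idl_add idl_smult) auto
next
  case (idl_cong f h)
  then show ?case by (intro idl.idl_cong[OF idl_cong.IH]) auto
qed

lemma idl_vanish: "f \<in> idl B \<Longrightarrow> x \<in> E \<Longrightarrow> \<forall>b \<in> B. b x = \<zero> \<Longrightarrow> f x = \<zero>"
  by (induction rule: idl.induct) (auto simp: A_closed)

lemma idl_range_finite:
  assumes "f \<in> idl (range g)" shows "\<exists>m::nat. f \<in> idl (g ` {..<m})"
  using assms
proof induction
  case (idl_step b a f)
  then obtain i m where i: "b = g i" and m: "f \<in> idl (g ` {..<m})" by blast
  have "(\<lambda>x. a x \<otimes> b x \<oplus> f x) \<in> idl (g ` {..<max m (Suc i)})"
    using idl_step.hyps i by (intro idl.idl_step idl_mono[OF m]) auto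
  then show ?case by blast
next
  case (idl_cong f h)
  then show ?case using idl.idl_cong by blast
qed (auto intro: idl.idl_zero)

lemma A_closed_idl: "f \<in> idl B \<Longrightarrow> B \<subseteq> A \<Longrightarrow> \<exists>f' \<in> A. \<forall>x \<in> E. f x = f' x"
proof (induction rule: idl.induct)
  case idl_zero
  show ?case using A_const[of \<zero>] by (intro bexI[of _ "\<lambda>_. \<zero>"]) auto
next
  case (idl_step b a f)
  then obtain f' where "f' \<in> A" "\<forall>x \<in> E. f x = f' x" by blast
  then show ?case using idl_step A_add[OF A_mult] by (intro bexI[of _ "\<lambda>x. a x \<otimes> b x \<oplus> f' x"]) auto
next
  case (idl_cong f h)
  then show ?case by (metis (no_types, lifting))
qed

text \<open>The ascending chain condition, stated for the ideals generated by initial segments of a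
  sequence; this form suits proofs that build a counterexample step by step.\<close>

definition noetherian :: bool where
  "noetherian \<longleftrightarrow> (\<forall>f::nat \<Rightarrow> 'p \<Rightarrow> 'a. range f \<subseteq> A \<longrightarrow> (\<exists>m. f m \<in> idl (f ` {..<m})))"

text \<open>Otherwise one could keep choosing functions in \<open>S\<close> that do not vanish on
  the common zeros of the earlier choices. Such a function is never in the ideal of the earlier
  ones, because members of that ideal vanish there.\<close>

lemma noetherian_finite_zero_set:
  assumes noetherian "S \<subseteq> A"
  shows "\<exists>T. finite T \<and> T \<subseteq> S \<and> (\<forall>x \<in> E. (\<forall>p \<in> T. p x = \<zero>) \<longrightarrow> (\<forall>p \<in> S. p x = \<zero>))"
proof (rule ccontr)
  assume neg: "\<not> ?thesis"
  have ex: "\<exists>p \<in> S. \<exists>x \<in> E. (\<forall>q \<in> T. q x = \<zero>) \<and> p x \<noteq> \<zero>" if "finite T" "T \<subseteq> S" for T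
    using neg that by blast
  define pick where "pick T = (SOME p. p \<in> S \<and> (\<exists>x \<in> E. (\<forall>q \<in> T. q x = \<zero>) \<and> p x \<noteq> \<zero>))" for T
  have pick: "pick T \<in> S" "\<exists>x \<in> E. (\<forall>q \<in> T. q x = \<zero>) \<and> pick T x \<noteq> \<zero>" if "finite T" "T \<subseteq> S" for T
  proof -
    have "\<exists>p. p \<in> S \<and> (\<exists>x \<in> E. (\<forall>q \<in> T. q x = \<zero>) \<and> p x \<noteq> \<zero>)" using ex[OF that] by blast
    from someI_ex[OF this] show "pick T \<in> S" "\<exists>x \<in> E. (\<forall>q \<in> T. q x = \<zero>) \<and> pick T x \<noteq> \<zero>"
      unfolding pick_def by blast+
  qed
  define Q where "Q = rec_nat {} (\<lambda>_ T. insert (pick T) T)"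
  have Q: "Q 0 = {}" "Q (Suc m) = insert (pick (Q m)) (Q m)" for m unfolding Q_def by simp_all
  have fin: "finite (Q m) \<and> Q m \<subseteq> S" for m
    by (induction m) (use Q pick in auto)
  have Qim: "Q m = (\<lambda>i. pick (Q i)) ` {..<m}" for m
    by (induction m) (auto simp: Q lessThan_Suc)
  have "range (\<lambda>i. pick (Q i)) \<subseteq> A" using pick(1) fin assms(2) by blast
  then obtain m where "pick (Q m) \<in> idl ((\<lambda>i. pick (Q i)) ` {..<m})"
    using assms(1) unfolding noetherian_def by blast
  then have "pick (Q m) \<in> idl (Q m)" unfolding Qim[of m, symmetric] .
  moreover obtain x where "x \<in> E" "\<forall>q \<in> Q m. q x = \<zero>" "pick (Q m) x \<noteq> \<zero>"
    using pick(2)[of "Q m"] fin[of m] by blast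
  ultimately show False using idl_vanish[of "pick (Q m)" "Q m" x] by blast
qed

end

text \<open>Hilbert's basis theorem, by leading coefficients of elements of minimal degree.\<close>

locale fun_ring_extension = fun_ring K E A + ext: fun_ring K E A'
  for K (structure) and E :: "'p set" and A A' :: "('p \<Rightarrow> 'a) set" +
  fixes y :: "'p \<Rightarrow> 'a"
  assumes A_sub: "A \<subseteq> A'" and y_mem: "y \<in> A'"
begin

text \<open>Degree less than \<open>d\<close>; the last coefficient may be zero. A function can have
  several representations, so a degree is available only as the least possible
  \<open>d\<close>.\<close>

definition rep :: "nat \<Rightarrow> ('p \<Rightarrow> 'a) \<Rightarrow> bool" where
  "rep d f \<longleftrightarrow> (\<exists>as. set as \<subseteq> A \<and> length as = d \<and>
     (\<forall>x \<in> E. f x = peval K (map (\<lambda>a. a x) as) (y x)))"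

lemma y_closed: "x \<in> E \<Longrightarrow> y x \<in> carrier K"
  using ext.A_closed y_mem by blast

lemma peval_map_closed:
  "set as \<subseteq> A \<Longrightarrow> x \<in> E \<Longrightarrow> peval K (map (\<lambda>a. a x) as) (y x) \<in> carrier K"
  using A_closed y_closed by (intro peval_closed) auto

lemma rep_closed: "rep d f \<Longrightarrow> x \<in> E \<Longrightarrow> f x \<in> carrier K"
  unfolding rep_def using peval_map_closed by auto

lemma rep_cong: "rep d f \<Longrightarrow> (\<And>x. x \<in> E \<Longrightarrow> f x = g x) \<Longrightarrow> rep d g"
  unfolding rep_def by auto

lemma rep_zero: "rep d (\<lambda>_. \<zero>)"
  unfolding rep_def using A_const[of \<zero>]
  by (intro exI[of _ "replicate d (\<lambda>_. \<zero>)"]) (auto simp: peval_replicate_zero y_closed)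

lemma rep_Suc_Cons:
  "rep (Suc d) f \<longleftrightarrow> (\<exists>a g. a \<in> A \<and> rep d g \<and> (\<forall>x \<in> E. f x = a x \<oplus> y x \<otimes> g x))"
proof
  assume "rep (Suc d) f"
  then obtain as where as: "set as \<subseteq> A" "length as = Suc d"
    "\<forall>x \<in> E. f x = peval K (map (\<lambda>a. a x) as) (y x)" unfolding rep_def by blast
  then obtain a bs where "as = a # bs" by (cases as) auto
  then show "\<exists>a g. a \<in> A \<and> rep d g \<and> (\<forall>x \<in> E. f x = a x \<oplus> y x \<otimes> g x)"
    using as unfolding rep_def
    by (intro exI[of _ a] exI[of _ "\<lambda>x. peval K (map (\<lambda>a. a x) bs) (y x)"]) auto
next
  assume "\<exists>a g. a \<in> A \<and> rep d g \<and> (\<forall>x \<in> E. f x = a x \<oplus> y x \<otimes> g x)"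
  then obtain a g as where "a \<in> A" "\<forall>x \<in> E. f x = a x \<oplus> y x \<otimes> g x"
    "set as \<subseteq> A" "length as = d" "\<forall>x \<in> E. g x = peval K (map (\<lambda>a. a x) as) (y x)"
    unfolding rep_def by blast
  then show "rep (Suc d) f" unfolding rep_def by (intro exI[of _ "a # as"]) auto
qed

lemma rep_add: "rep d f \<Longrightarrow> rep d g \<Longrightarrow> rep d (\<lambda>x. f x \<oplus> g x)"
proof (induction d arbitrary: f g)
  case 0
  then show ?case by (auto simp: rep_def)
next
  case (Suc d)
  from Suc.prems[unfolded rep_Suc_Cons] obtain a f' b g' where
    *: "a \<in> A" "rep d f'" "\<forall>x \<in> E. f x = a x \<oplus> y x \<otimes> f' x"
       "b \<in> A" "rep d g'" "\<forall>x \<in> E. g x = b x \<oplus> y x \<otimes> g' x" by blast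
  have "f x \<oplus> g x = (a x \<oplus> b x) \<oplus> y x \<otimes> (f' x \<oplus> g' x)" if "x \<in> E" for x
    using * that A_closed[OF *(1) that] A_closed[OF *(4) that] rep_closed[OF *(2) that]
      rep_closed[OF *(5) that] y_closed[OF that]
    by (simp add: cring_norm)
  then show ?case unfolding rep_Suc_Cons
    using A_add[OF *(1,4)] Suc.IH[OF *(2,5)]
    by (intro exI[of _ "\<lambda>x. a x \<oplus> b x"] exI[of _ "\<lambda>x. f' x \<oplus> g' x"]) auto
qed

lemma rep_smult: "rep d f \<Longrightarrow> c \<in> A \<Longrightarrow> rep d (\<lambda>x. c x \<otimes> f x)"
proof (induction d arbitrary: f)
  case 0
  then show ?case using A_closed by (auto simp: rep_def)
next
  case (Suc d)
  from Suc.prems(1)[unfolded rep_Suc_Cons] obtain a f' where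
    *: "a \<in> A" "rep d f'" "\<forall>x \<in> E. f x = a x \<oplus> y x \<otimes> f' x" by blast
  have "c x \<otimes> f x = c x \<otimes> a x \<oplus> y x \<otimes> (c x \<otimes> f' x)" if "x \<in> E" for x
    using * that A_closed[OF *(1) that] A_closed[OF Suc.prems(2) that] rep_closed[OF *(2) that]
      y_closed[OF that]
    by (simp add: cring_norm)
  then show ?case unfolding rep_Suc_Cons
    using A_mult[OF Suc.prems(2) *(1)] Suc.IH[OF *(2) Suc.prems(2)]
    by (intro exI[of _ "\<lambda>x. c x \<otimes> a x"] exI[of _ "\<lambda>x. c x \<otimes> f' x"]) auto
qed

lemma rep_shift: "rep d f \<Longrightarrow> rep (d + n) (\<lambda>x. y x [^] n \<otimes> f x)"
proof (induction n)
  case 0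
  then show ?case using rep_closed[OF 0] by (auto intro!: rep_cong[OF 0])
next
  case (Suc n)
  have "y x [^] Suc n \<otimes> f x = \<zero> \<oplus> y x \<otimes> (y x [^] n \<otimes> f x)" if "x \<in> E" for x
    using rep_closed[OF Suc.prems that] y_closed[OF that] by (simp add: m_ac)
  then show ?case unfolding add_Suc_right rep_Suc_Cons using Suc A_const[of \<zero>]
    by (intro exI[of _ "\<lambda>_. \<zero>"] exI[of _ "\<lambda>x. y x [^] n \<otimes> f x"]) auto
qed

lemma rep_Suc_snoc:
  assumes "rep (Suc d) f"
  shows "\<exists>a g. a \<in> A \<and> rep d g \<and> (\<forall>x \<in> E. f x = g x \<oplus> y x [^] d \<otimes> a x)"
proof -
  obtain as where as: "set as \<subseteq> A" "length as = Suc d"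
    "\<forall>x \<in> E. f x = peval K (map (\<lambda>a. a x) as) (y x)" using assms unfolding rep_def by blast
  then obtain bs a where ab: "as = bs @ [a]" by (cases as rule: rev_cases) auto
  have "f x = peval K (map (\<lambda>a. a x) bs) (y x) \<oplus> y x [^] d \<otimes> a x" if "x \<in> E" for x
  proof -
    have "set (map (\<lambda>a. a x) bs) \<subseteq> carrier K" "a x \<in> carrier K"
      using as(1) ab A_closed that by auto
    then show ?thesis using as(2,3) ab that y_closed by (simp add: peval_append)
  qed
  then show ?thesis using as(1,2) ab unfolding rep_def
    by (intro exI[of _ a] exI[of _ "\<lambda>x. peval K (map (\<lambda>a. a x) bs) (y x)"]) auto
qed

lemma pow_y_mem: "(\<lambda>x. y x [^] (n::nat)) \<in> A'"
  by (induction n) (auto intro: ext.A_const ext.A_mult y_mem)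

lemma hilbert_basis:
  assumes noetherian and reps: "\<And>f. f \<in> A' \<Longrightarrow> \<exists>d. rep d f"
  shows ext.noetherian
proof (rule ccontr)
  assume "\<not> ext.noetherian"
  then obtain g :: "nat \<Rightarrow> 'p \<Rightarrow> 'a" where g: "range g \<subseteq> A'" "\<And>m. g m \<notin> ext.idl (g ` {..<m})"
    unfolding ext.noetherian_def by blast
  let ?J = "{f \<in> A'. f \<in> ext.idl (range g)}"
  \<comment> \<open>A finite part of the ideal generated by the sequence is generated by an initial
    segment, which does not reach the next member of the sequence.\<close>
  have ex: "\<exists>f. f \<in> ?J \<and> f \<notin> ext.idl B" if B: "finite B" "B \<subseteq> ?J" for B
  proof -
    have "\<exists>m. B \<subseteq> ext.idl (g ` {..<m})" using B
    proof (induction B)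
      case (insert b B)
      then obtain m m' where "B \<subseteq> ext.idl (g ` {..<m})" "b \<in> ext.idl (g ` {..<m'})"
        using ext.idl_range_finite by blast
      then have "insert b B \<subseteq> ext.idl (g ` {..<max m m'})"
        using ext.idl_mono[of _ "g ` {..<m}" "g ` {..<max m m'}"]
          ext.idl_mono[of _ "g ` {..<m'}" "g ` {..<max m m'}"] by (auto simp: image_mono)
      then show ?case by blast
    qed simp
    then obtain m where m: "B \<subseteq> ext.idl (g ` {..<m})" by blast
    have "g m \<notin> ext.idl B"
      using ext.idl_trans[OF _ m] g by blast
    moreover have "g m \<in> ?J" using g(1) ext.idl_base[of "g m" "range g"] by blast
    ultimately show ?thesis by blast
  qed
  \<comment> \<open>One more than the least degree in which the function can be written; a function
    that vanishes on \<open>E\<close> has length 0.\<close>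
  define len where "len f = (LEAST d. rep d f)" for f
  have len: "rep (len f) f" if "f \<in> A'" for f
    unfolding len_def using reps[OF that] by (rule LeastI_ex)
  have len_le: "len f \<le> d" if "rep d f" for f d
    unfolding len_def using that by (rule Least_le)
  define pick where "pick B = (ARG_MIN len f. f \<in> ?J \<and> f \<notin> ext.idl B)" for B
  have pick: "pick B \<in> ?J" "pick B \<notin> ext.idl B"
    "\<And>f. f \<in> ?J \<Longrightarrow> f \<notin> ext.idl B \<Longrightarrow> len (pick B) \<le> len f" if B: "finite B" "B \<subseteq> ?J" for B
  proof -
    obtain f0 where f0: "f0 \<in> ?J \<and> f0 \<notin> ext.idl B" using ex[OF B] by blast
    show "pick B \<in> ?J" "pick B \<notin> ext.idl B"
      using arg_min_natI[of "\<lambda>f. f \<in> ?J \<and> f \<notin> ext.idl B", OF f0, of len] unfolding pick_def by blast+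
    fix f assume "f \<in> ?J" "f \<notin> ext.idl B"
    then show "len (pick B) \<le> len f"
      using arg_min_nat_le[of "\<lambda>f. f \<in> ?J \<and> f \<notin> ext.idl B" f len] unfolding pick_def by blast
  qed
  define Q where "Q = rec_nat {} (\<lambda>_ T. insert (pick T) T)"
  have Q: "Q 0 = {}" "Q (Suc m) = insert (pick (Q m)) (Q m)" for m unfolding Q_def by simp_all
  have fin: "finite (Q m)" "Q m \<subseteq> ?J" for m
    by (induction m) (use Q pick(1) in auto)
  define f where "f m = pick (Q m)" for m
  have Qim: "Q m = f ` {..<m}" for m
    by (induction m) (auto simp: Q f_def lessThan_Suc)
  have fJ: "f m \<in> A'" "f m \<in> ext.idl (range g)" "f m \<notin> ext.idl (Q m)" for m
    unfolding f_def using pick(1,2)[OF fin] by blast+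
  \<comment> \<open>Each choice is of minimal length outside a growing ideal. The lengths therefore
    do not decrease, which makes the exponents d m - d i below legitimate.\<close>
  have mono: "len (f i) \<le> len (f m)" if "i \<le> m" for i m
  proof -
    have "Q i \<subseteq> Q m" unfolding Qim using that by (intro image_mono) auto
    then have "f m \<notin> ext.idl (Q i)" using fJ(3) ext.idl_mono by blast
    then show ?thesis using pick(3)[OF fin, of "f m" i] fJ unfolding f_def by blast
  qed
  have "len (f m) \<noteq> 0" for m
  proof
    assume "len (f m) = 0"
    then have "\<forall>x \<in> E. f m x = \<zero>" using len[OF fJ(1)[of m]] by (auto simp: rep_def)
    then have "f m \<in> ext.idl (Q m)" by (intro ext.idl_cong[OF ext.idl_zero]) simp
    then show False using fJ(3) by blast
  qed
  then have "\<exists>d. len (f m) = Suc d" for m using not0_implies_Suc by blast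
  then obtain d where d: "\<And>m. len (f m) = Suc (d m)" by metis
  have "\<exists>a r. a \<in> A \<and> rep (d m) r \<and> (\<forall>x \<in> E. f m x = r x \<oplus> y x [^] d m \<otimes> a x)" for m
    using rep_Suc_snoc len[OF fJ(1)[of m]] d by simp
  then obtain a r where ar: "\<And>m. a m \<in> A" "\<And>m. rep (d m) (r m)"
    "\<And>m x. x \<in> E \<Longrightarrow> f m x = r m x \<oplus> y x [^] d m \<otimes> a m x" by metis
  obtain m where m: "a m \<in> idl (a ` {..<m})"
    using assms(1) ar(1) unfolding noetherian_def by blast
  have Qm: "f ` {..<m} \<subseteq> A'" using fJ(1) by blast
  have aA: "a ` {..<m} \<subseteq> A" using ar(1) by blast
  \<comment> \<open>A relation between leading coefficients is lifted to the functions: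
    multiplication by a power of y brings each f i to degree d m, and the combination has leading
    coefficient b there.\<close>
  have "\<exists>h s. h \<in> ext.idl (f ` {..<m}) \<and> rep (d m) s \<and> (\<forall>x \<in> E. h x = s x \<oplus> y x [^] d m \<otimes> b x)"
    if "b \<in> idl (a ` {..<m})" for b
    using that
  proof induction
    case idl_zero
    show ?case using rep_zero y_closed
      by (intro exI[of _ "\<lambda>_. \<zero>"] conjI ext.idl_zero) auto
  next
    case (idl_step b' c b)
    then obtain h s where hs: "h \<in> ext.idl (f ` {..<m})" "rep (d m) s"
      "\<And>x. x \<in> E \<Longrightarrow> h x = s x \<oplus> y x [^] d m \<otimes> b x" by blast
    obtain i where i: "i < m" "b' = a i" using idl_step.hyps(1) by blast
    have di: "d i \<le> d m" using mono[of i m] i(1) d by simp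
    let ?n = "d m - d i"
    let ?c = "\<lambda>x. c x \<otimes> y x [^] ?n"
    let ?h = "\<lambda>x. ?c x \<otimes> f i x \<oplus> h x" and ?s = "\<lambda>x. c x \<otimes> (y x [^] ?n \<otimes> r i x) \<oplus> s x"
    have "?h \<in> ext.idl (f ` {..<m})"
      using idl_step.hyps(2) A_sub i(1) hs(1) by (intro ext.idl_step ext.A_mult pow_y_mem) auto
    moreover have "rep (d m) ?s"
      using rep_add[OF rep_smult[OF rep_shift[OF ar(2)[of i], of ?n] idl_step.hyps(2)], of s] di hs(2) by simp
    moreover have "?h x = ?s x \<oplus> y x [^] d m \<otimes> (c x \<otimes> b' x \<oplus> b x)" if x: "x \<in> E" for x
    proof -
      note [simp] = A_closed[OF idl_step.hyps(2) x] y_closed[OF x] A_closed[OF ar(1) x]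
        rep_closed[OF ar(2) x] idl_closed[OF idl_step.hyps(3) aA x] rep_closed[OF hs(2) x]
      have "y x [^] d m = y x [^] ?n \<otimes> y x [^] d i" using di by (simp add: nat_pow_mult)
      then show ?thesis unfolding ar(3)[OF x] hs(3)[OF x] i(2) by (simp add: cring_norm)
    qed
    ultimately show ?case by blast
  next
    case (idl_cong b b')
    then show ?case by metis
  qed
  then obtain h s where hs: "h \<in> ext.idl (f ` {..<m})" "rep (d m) s"
    "\<And>x. x \<in> E \<Longrightarrow> h x = s x \<oplus> y x [^] d m \<otimes> a m x" using m by blast
  \<comment> \<open>Minimality was imposed on members of \<open>A'\<close>, so h is replaced by such
    a member that agrees with it on \<open>E\<close>.\<close>
  obtain h' where h': "h' \<in> A'" "\<And>x. x \<in> E \<Longrightarrow> h x = h' x"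
    using ext.A_closed_idl[OF hs(1) Qm] by blast
  have h'i: "h' \<in> ext.idl (f ` {..<m})" using ext.idl_cong[OF hs(1) h'(2)] by blast
  \<comment> \<open>The terms of degree d m cancel, so u is shorter than f m. As h' lies in the
    ideal of the earlier choices and f m does not, u does not either, against minimality.\<close>
  define u where "u = (\<lambda>x. f m x \<oplus> \<ominus> \<one> \<otimes> h' x)"
  have "u \<in> A'" unfolding u_def using fJ(1) h'(1) ext.A_const by (intro ext.A_add ext.A_mult) auto
  have hJ: "h' \<in> ext.idl (range g)"
    using ext.idl_trans[OF h'i _ g(1)] fJ(2) by blast
  have "u \<in> ext.idl (range g)"
    unfolding u_def using ext.A_const[of "\<ominus> \<one>"] g(1)
    by (intro ext.idl_add ext.idl_smult fJ(2) hJ) auto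
  moreover have "u \<notin> ext.idl (Q m)"
  proof
    assume "u \<in> ext.idl (Q m)"
    then have "(\<lambda>x. u x \<oplus> h' x) \<in> ext.idl (Q m)" using h'i Qm unfolding Qim by (intro ext.idl_add)
    then have "f m \<in> ext.idl (Q m)"
    proof (rule ext.idl_cong)
      fix x assume x: "x \<in> E"
      show "u x \<oplus> h' x = f m x" unfolding u_def
        using ext.A_closed[OF fJ(1) x] ext.A_closed[OF h'(1) x] by (simp add: l_minus a_assoc l_neg)
    qed
    then show False using fJ(3) by blast
  qed
  ultimately have "len (f m) \<le> len u" using pick(3)[OF fin, of u m] \<open>u \<in> A'\<close> unfolding f_def by blast
  moreover have "rep (d m) u"
  proof (rule rep_cong)
    show "rep (d m) (\<lambda>x. r m x \<oplus> \<ominus> \<one> \<otimes> s x)"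
      using ar(2) hs(2) A_const[of "\<ominus> \<one>"] by (intro rep_add rep_smult[where c = "\<lambda>_. \<ominus> \<one>"]) auto
    fix x assume x: "x \<in> E"
    have "r m x \<in> carrier K" "s x \<in> carrier K" "y x [^] d m \<otimes> a m x \<in> carrier K"
      using rep_closed[OF ar(2) x] rep_closed[OF hs(2) x] y_closed[OF x] A_closed[OF ar(1) x] by auto
    then show "r m x \<oplus> \<ominus> \<one> \<otimes> s x = u x"
      unfolding u_def h'(2)[OF x, symmetric] hs(3)[OF x] ar(3)[OF x] by (simp add: cring_norm r_neg)
  qed
  then have "len u \<le> d m" by (rule len_le)
  ultimately show False using d by simp
qed

end

section \<open>Polynomial functions on affine space\<close>

lemma poly_funs_closed:
  assumes "cring k" "p \<in> poly_funs k n" "x \<in> affine_space k m" "n \<le> m"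
  shows "p x \<in> carrier k"
proof -
  interpret cring k by fact
  show ?thesis using assms(2)
  proof induction
    case (poly_var i)
    then have "x ! i \<in> set x" using assms(3,4) by (simp add: affine_space_def)
    then show ?case using assms(3) by (auto simp: affine_space_def)
  qed auto
qed

lemma fun_ring_poly_funs:
  assumes "cring k" "n \<le> m" shows "fun_ring k (affine_space k m) (poly_funs k n)"
proof -
  interpret cring k by fact
  show ?thesis
    by unfold_locales (auto intro: poly_funs_closed[OF assms(1) _ _ assms(2)] poly_funs.intros)
qed

lemma poly_funs_mono: "p \<in> poly_funs k n \<Longrightarrow> n \<le> m \<Longrightarrow> p \<in> poly_funs k m"
  by (induction rule: poly_funs.induct) (auto intro: poly_funs.intros)

text \<open>Induction on the number n of variables that may occur, while the domain stays affine
  m-space, so that consecutive rings consist of functions on the same set. The new variable is the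
  coordinate with index n.\<close>

lemma noetherian_poly_funs:
  fixes k :: "'f ring"
  assumes "field k" "n \<le> m"
  shows "fun_ring.noetherian k (affine_space k m) (poly_funs k n)"
  using assms(2)
proof (induction n)
  case 0
  interpret field k by fact
  interpret fun_ring k "affine_space k m" "poly_funs k 0" by (rule fun_ring_poly_funs[OF is_cring]) simp
  have const: "\<exists>c \<in> carrier k. p = (\<lambda>x. c)" if "p \<in> poly_funs k 0" for p
    using that by induction auto
  show ?case unfolding noetherian_def
  proof (intro allI impI)
    fix f :: "nat \<Rightarrow> 'f list \<Rightarrow> 'f" assume f: "range f \<subseteq> poly_funs k 0"
    \<comment> \<open>Without variables there are only constants, and two members of the sequence
      decide: either the first is zero and lies in the zero ideal, or it is a unit and generates the
      second.\<close>
    obtain c d where cd: "c \<in> carrier k" "f 0 = (\<lambda>x. c)" "d \<in> carrier k" "f 1 = (\<lambda>x. d)"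
      using const f by (metis rangeI subset_iff)
    show "\<exists>m. f m \<in> idl (f ` {..<m})"
    proof (cases "c = \<zero>\<^bsub>k\<^esub>")
      case True
      then have "f 0 \<in> idl (f ` {..<0})" using idl_zero cd(2) by simp
      then show ?thesis by blast
    next
      case False
      have "(\<lambda>x. (\<lambda>_. d \<otimes>\<^bsub>k\<^esub> inv\<^bsub>k\<^esub> c) x \<otimes>\<^bsub>k\<^esub> f 0 x \<oplus>\<^bsub>k\<^esub> \<zero>\<^bsub>k\<^esub>) \<in> idl (f ` {..<1})"
        using cd False by (intro idl_step idl_zero A_const) (auto simp: field_Units)
      then have "f 1 \<in> idl (f ` {..<1})"
        by (rule idl_cong) (use cd False in \<open>simp add: field_Units m_assoc\<close>)
      then show ?thesis by blast
    qed
  qed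
next
  case (Suc n)
  interpret field k by fact
  interpret fun_ring_extension k "affine_space k m" "poly_funs k n" "poly_funs k (Suc n)" "\<lambda>x. x ! n"
  proof (rule fun_ring_extension.intro)
    show "fun_ring k (affine_space k m) (poly_funs k n)" "fun_ring k (affine_space k m) (poly_funs k (Suc n))"
      using Suc.prems by (auto intro: fun_ring_poly_funs[OF is_cring])
    show "fun_ring_extension_axioms (poly_funs k n) (poly_funs k (Suc n)) (\<lambda>x. x ! n)"
      by unfold_locales (auto intro: poly_funs_mono poly_var)
  qed
  interpret F: function_ring "\<lambda>_. k" "affine_space k m" "poly_funs k n" "\<lambda>x. x ! n"
    by (rule function_ring.intro) (auto intro: is_cring A_closed y_closed A_const A_add A_mult)
  have "poly_rep (\<lambda>_. k) (affine_space k m) (poly_funs k n) (\<lambda>x. x ! n) f" if "f \<in> poly_funs k (Suc n)" for f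
    using that
  proof induction
    case (poly_const c)
    then show ?case by (intro F.poly_rep_const poly_funs.poly_const)
  next
    case (poly_var i)
    then show ?case
    proof (cases "i = n")
      case False
      then show ?thesis using poly_var by (intro F.poly_rep_const poly_funs.poly_var) simp
    qed (simp add: F.poly_rep_point)
  next
    case (poly_add p q)
    show ?case by (rule F.poly_rep_add[OF poly_add.IH])
  next
    case (poly_mult p q)
    show ?case by (rule F.poly_rep_mult[OF poly_mult.IH])
  qed
  then have "\<exists>d. rep d f" if "f \<in> poly_funs k (Suc n)" for f
    using that unfolding poly_rep_def rep_def by blast
  then show ?case using Suc by (intro hilbert_basis) auto
qed

theorem finite_zero_set:
  fixes k :: "'f ring"
  assumes "field k" "S \<subseteq> poly_funs k n"
  obtains T where "finite T" "T \<subseteq> S"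
    "\<And>x. x \<in> affine_space k n \<Longrightarrow> (\<forall>p \<in> T. p x = \<zero>\<^bsub>k\<^esub>) = (\<forall>p \<in> S. p x = \<zero>\<^bsub>k\<^esub>)"
proof -
  interpret field k by fact
  interpret fun_ring k "affine_space k n" "poly_funs k n" by (rule fun_ring_poly_funs[OF is_cring]) simp
  show ?thesis
    using noetherian_finite_zero_set[OF noetherian_poly_funs[OF assms(1) order_refl] assms(2)] that
    by (metis subset_iff)
qed

section \<open>Definability of algebraic groups\<close>

lemma uterm_subst:
  assumes "t \<in> uterm" "\<And>v. s v \<in> uterm" shows "(\<lambda>F e. t F (\<lambda>v. s v F e)) \<in> uterm"
  using assms(1) by induction (auto intro: uterm.intros assms(2))

lemma upred_subst:
  fixes P :: "'c ring \<Rightarrow> ('v \<Rightarrow> 'c) \<Rightarrow> bool" and s :: "'v \<Rightarrow> 'c ring \<Rightarrow> ('w \<Rightarrow> 'c) \<Rightarrow> 'c"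
  assumes "upred P" "\<And>v. s v \<in> uterm" shows "upred (\<lambda>F e. P F (\<lambda>v. s v F e))"
  using assms(1)
proof induction
  case (eq_zero t)
  show ?case by (rule upred.eq_zero[OF uterm_subst[OF eq_zero assms(2)]])
next
  case (cong P Q)
  show ?case
  proof (rule upred.cong[OF cong.IH])
    fix F :: "'c ring" and e :: "'w \<Rightarrow> 'c" assume v: "valid F e"
    have "valid F (\<lambda>v. s v F e)"
      using uterm_closed[OF assms(2) v] validD(1)[OF v] unfolding valid_def by blast
    then show "P F (\<lambda>v. s v F e) = Q F (\<lambda>v. s v F e)" by (rule cong.hyps(2))
  qed
qed (intro upred.neg upred.conj; assumption)+

text \<open>Parameters from \<open>k\<close> are variables of their own: the variable \<open>Inl c\<close> stands for
  \<open>c\<close>, and \<open>Inr (j, i)\<close> for the coordinate \<open>i\<close> of the \<open>j\<close>-th tuple.\<close>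

locale coded_field = acf k for k :: "'f ring" (structure) +
  fixes h :: "'f \<Rightarrow> 'c"
  assumes inj_h: "inj_on h (carrier k)"
begin

definition k' :: "'c ring" where "k' = image_ring h k"

text \<open>Variables exist for all elements of the type; those outside the field receive the value
  of zero, so that the environment is valid.\<close>

definition base_par :: "'f \<Rightarrow> 'c" where
  "base_par c = h (if c \<in> carrier k then c else \<zero>)"

definition kenv :: "(nat \<Rightarrow> 'i \<Rightarrow> 'f) \<Rightarrow> 'f + nat \<times> 'i \<Rightarrow> 'c" where
  "kenv w = case_sum base_par (\<lambda>(j, i). h (w j i))"

definition ok :: "(nat \<Rightarrow> 'i \<Rightarrow> 'f) \<Rightarrow> bool" where
  "ok w \<longleftrightarrow> (\<forall>j i. w j i \<in> carrier k)"

definition kterm :: "((nat \<Rightarrow> 'i \<Rightarrow> 'f) \<Rightarrow> 'f) \<Rightarrow> bool" where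
  "kterm t \<longleftrightarrow> (\<exists>u \<in> uterm. \<forall>w. ok w \<longrightarrow> t w \<in> carrier k \<and> u k' (kenv w) = h (t w))"

text \<open>Definability over k with parameters. The defining formula is evaluated in the copy
  \<open>k'\<close>, whose type also accommodates the fields to which the formula will be
  transferred.\<close>

definition kdef :: "((nat \<Rightarrow> 'i \<Rightarrow> 'f) \<Rightarrow> bool) \<Rightarrow> bool" where
  "kdef P \<longleftrightarrow> (\<exists>R. upred R \<and> (\<forall>w. ok w \<longrightarrow> R k' (kenv w) = P w))"

lemmas k'_facts = acf_image_ring[OF acf_axioms inj_h, folded k'_def]

lemma h_zero: "h \<zero> = \<zero>\<^bsub>k'\<^esub>" "h \<one> = \<one>\<^bsub>k'\<^esub>"
  by (simp_all add: k'_def image_ring_zero image_ring_one)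

lemma valid_kenv: "ok w \<Longrightarrow> valid k' (kenv w)"
  unfolding valid_def kenv_def ok_def base_par_def
  using k'_facts(1,3) by (auto split: sum.splits)

lemma kterm_closed: "kterm t \<Longrightarrow> ok w \<Longrightarrow> t w \<in> carrier k"
  unfolding kterm_def by blast

lemma kterm_const: "c \<in> carrier k \<Longrightarrow> kterm (\<lambda>w. c)"
  unfolding kterm_def
  by (intro bexI[OF _ uterm.var[of "Inl c"]]) (auto simp: kenv_def base_par_def)

lemma kterm_coord: "kterm (\<lambda>w. w j i)"
  unfolding kterm_def
  by (intro bexI[OF _ uterm.var[of "Inr (j, i)"]]) (auto simp: kenv_def ok_def)

lemma kterm_add:
  assumes "kterm s" "kterm t" shows "kterm (\<lambda>w. s w \<oplus> t w)"
proof -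
  obtain u where u: "u \<in> uterm" "\<And>w. ok w \<Longrightarrow> s w \<in> carrier k \<and> u k' (kenv w) = h (s w)"
    using assms(1) unfolding kterm_def by blast
  obtain v where v: "v \<in> uterm" "\<And>w. ok w \<Longrightarrow> t w \<in> carrier k \<and> v k' (kenv w) = h (t w)"
    using assms(2) unfolding kterm_def by blast
  show ?thesis unfolding kterm_def
    using u(2) v(2) ring_hom_add[OF k'_facts(2)]
    by (intro bexI[OF _ uterm.add[OF u(1) v(1)]]) simp
qed

lemma kterm_mult:
  assumes "kterm s" "kterm t" shows "kterm (\<lambda>w. s w \<otimes> t w)"
proof -
  obtain u where u: "u \<in> uterm" "\<And>w. ok w \<Longrightarrow> s w \<in> carrier k \<and> u k' (kenv w) = h (s w)"
    using assms(1) unfolding kterm_def by blast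
  obtain v where v: "v \<in> uterm" "\<And>w. ok w \<Longrightarrow> t w \<in> carrier k \<and> v k' (kenv w) = h (t w)"
    using assms(2) unfolding kterm_def by blast
  show ?thesis unfolding kterm_def
    using u(2) v(2) ring_hom_mult[OF k'_facts(2)]
    by (intro bexI[OF _ uterm.mult[OF u(1) v(1)]]) simp
qed

lemma kdef_eq:
  assumes "kterm s" "kterm t" shows "kdef (\<lambda>w. s w = t w)"
proof -
  obtain u where u: "u \<in> uterm" "\<And>w. ok w \<Longrightarrow> s w \<in> carrier k \<and> u k' (kenv w) = h (s w)"
    using assms(1) unfolding kterm_def by blast
  obtain v where v: "v \<in> uterm" "\<And>w. ok w \<Longrightarrow> t w \<in> carrier k \<and> v k' (kenv w) = h (t w)"
    using assms(2) unfolding kterm_def by blast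
  show ?thesis unfolding kdef_def
    using u v inj_on_eq_iff[OF inj_h] by (intro exI[of _ "\<lambda>F e. u F e = v F e"]) (simp add: upred_eq)
qed

lemma kdef_neg:
  assumes "kdef P" shows "kdef (\<lambda>w. \<not> P w)"
proof -
  obtain R where "upred R" "\<forall>w. ok w \<longrightarrow> R k' (kenv w) = P w" using assms unfolding kdef_def by blast
  then show ?thesis unfolding kdef_def by (intro exI[of _ "\<lambda>F e. \<not> R F e"]) (simp add: upred.neg)
qed

lemma kdef_conj:
  assumes "kdef P" "kdef Q" shows "kdef (\<lambda>w. P w \<and> Q w)"
proof -
  obtain R S where "upred R" "\<forall>w. ok w \<longrightarrow> R k' (kenv w) = P w"
    "upred S" "\<forall>w. ok w \<longrightarrow> S k' (kenv w) = Q w" using assms unfolding kdef_def by blast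
  then show ?thesis unfolding kdef_def by (intro exI[of _ "\<lambda>F e. R F e \<and> S F e"]) (simp add: upred.conj)
qed

lemma kdef_disj: "kdef P \<Longrightarrow> kdef Q \<Longrightarrow> kdef (\<lambda>w. P w \<or> Q w)"
  using kdef_neg[OF kdef_conj[OF kdef_neg kdef_neg], of P Q] by simp

lemma kdef_const: "kdef (\<lambda>w. b)"
  unfolding kdef_def using upred_const[of b] by (intro exI conjI) auto

lemma kdef_Ball:
  assumes "finite S" "\<And>s. s \<in> S \<Longrightarrow> kdef (P s)"
  shows "kdef (\<lambda>w. \<forall>s \<in> S. P s w)"
  using assms by (induction S) (auto intro: kdef_const kdef_conj)

lemma kdef_Bex:
  assumes "finite S" "\<And>s. s \<in> S \<Longrightarrow> kdef (P s)"
  shows "kdef (\<lambda>w. \<exists>s \<in> S. P s w)"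
  using assms by (induction S) (auto intro: kdef_const kdef_disj)

lemma kdef_cong: "kdef P \<Longrightarrow> (\<And>w. ok w \<Longrightarrow> P w = Q w) \<Longrightarrow> kdef Q"
  unfolding kdef_def by auto

lemma kdef_all_less: "(\<And>l. l < (n::nat) \<Longrightarrow> kdef (P l)) \<Longrightarrow> kdef (\<lambda>w. \<forall>l<n. P l w)"
  using kdef_Ball[of "{..<n}" P] by (simp only: Ball_def lessThan_iff finite_lessThan)

abbreviation (input) val :: "((nat \<Rightarrow> 'i \<Rightarrow> 'f) \<Rightarrow> 'f) list \<Rightarrow> (nat \<Rightarrow> 'i \<Rightarrow> 'f) \<Rightarrow> 'f list" where
  "val vs w \<equiv> map (\<lambda>t. t w) vs"

lemma val_affine:
  "\<forall>t \<in> set vs. kterm t \<Longrightarrow> ok w \<Longrightarrow> length vs = n \<Longrightarrow> val vs w \<in> affine_space k n"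
  unfolding affine_space_def using kterm_closed by auto

lemma kterm_poly:
  assumes "p \<in> poly_funs k n" "\<forall>t \<in> set vs. kterm t" "length vs = n"
  shows "kterm (\<lambda>w. p (val vs w))"
  using assms(1)
proof induction
  case (poly_var i)
  then have "kterm (vs ! i)" using assms(2,3) by simp
  then show ?case using poly_var assms(3) by simp
qed (auto intro: kterm_const kterm_add kterm_mult)

section \<open>Definability of algebraic sets and regular functions\<close>

lemma kdef_algebraic:
  assumes "algebraic_set k n Z" "\<forall>t \<in> set vs. kterm t" "length vs = n"
  shows "kdef (\<lambda>w. val vs w \<in> Z)"
proof -
  obtain S where S: "S \<subseteq> poly_funs k n" "Z = {x \<in> affine_space k n. \<forall>p \<in> S. p x = \<zero>}"
    using assms(1) unfolding algebraic_set_def by blast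
  obtain T where T: "finite T" "T \<subseteq> S"
    "\<And>x. x \<in> affine_space k n \<Longrightarrow> (\<forall>p \<in> T. p x = \<zero>) = (\<forall>p \<in> S. p x = \<zero>)"
    using finite_zero_set[OF field_axioms S(1)] by blast
  have "kdef (\<lambda>w. \<forall>p \<in> T. p (val vs w) = \<zero>)"
    using S(1) T(2) assms(2,3) by (intro kdef_Ball[OF T(1)] kdef_eq kterm_poly kterm_const) auto
  then show ?thesis
    by (rule kdef_cong) (use S(2) T(3) val_affine[OF assms(2) _ assms(3)] in simp)
qed

lemma kdef_open_in:
  assumes "zariski_open_in k n Z W" "kdef (\<lambda>w. val vs w \<in> Z)" "\<forall>t \<in> set vs. kterm t" "length vs = n"
  shows "kdef (\<lambda>w. val vs w \<in> W)"
proof -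
  obtain T where T: "zariski_open k n T" "W = Z \<inter> T"
    using assms(1) unfolding zariski_open_in_def by blast
  have "kdef (\<lambda>w. val vs w \<in> affine_space k n - T)"
    using T(1) assms(3,4) unfolding zariski_open_def by (intro kdef_algebraic) auto
  then have "kdef (\<lambda>w. val vs w \<in> Z \<and> \<not> val vs w \<in> affine_space k n - T)"
    using assms(2) by (intro kdef_conj kdef_neg)
  then show ?thesis
    by (rule kdef_cong) (use T(2) val_affine[OF assms(3) _ assms(4)] in auto)
qed

text \<open>Consider all g such that f is a single quotient where g does not vanish. They have no
  common zero on \<open>W\<close>, and a finite subset with the same common zeros therefore has none
  on \<open>W\<close> either.\<close>

lemma regular_fun_finite_cover:
  assumes "regular_fun k n W f" "W \<subseteq> affine_space k n"
  obtains Q where "finite Q" "\<And>g p q. (g, p, q) \<in> Q \<Longrightarrow> g \<in> poly_funs k n \<and> p \<in> poly_funs k n \<and> q \<in> poly_funs k n"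
    "\<And>x. x \<in> W \<Longrightarrow> \<exists>(g, p, q) \<in> Q. g x \<noteq> \<zero>"
    "\<And>x g p q. x \<in> W \<Longrightarrow> (g, p, q) \<in> Q \<Longrightarrow> g x \<noteq> \<zero> \<Longrightarrow> q x \<noteq> \<zero> \<and> f x = p x \<otimes> inv q x"
proof -
  define good where "good = (\<lambda>(g, p, q). g \<in> poly_funs k n \<and> p \<in> poly_funs k n \<and> q \<in> poly_funs k n \<and>
    (\<forall>x \<in> W. g x \<noteq> \<zero> \<longrightarrow> q x \<noteq> \<zero> \<and> f x = p x \<otimes> inv q x))"
  define G where "G = {g. \<exists>p q. good (g, p, q)}"
  have cover: "\<exists>g \<in> G. g x \<noteq> \<zero>" if x: "x \<in> W" for x
  proof -
    obtain T p q where T: "zariski_open k n T" "x \<in> T" and pq: "p \<in> poly_funs k n" "q \<in> poly_funs k n"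
      "\<forall>y \<in> W \<inter> T. q y \<noteq> \<zero> \<and> f y = p y \<otimes> inv q y"
      using assms(1) x unfolding regular_fun_def by blast
    obtain S where S: "S \<subseteq> poly_funs k n" "affine_space k n - T = {x \<in> affine_space k n. \<forall>p \<in> S. p x = \<zero>}"
      using T(1) unfolding zariski_open_def algebraic_set_def by blast
    have "x \<in> affine_space k n" using x assms(2) by blast
    then obtain g where g: "g \<in> S" "g x \<noteq> \<zero>" using S(2) T(2) by blast
    \<comment> \<open>The neighbourhood is shrunk to the set where g, one of the equations of its
      complement, does not vanish.\<close>
    have "y \<in> T" if "y \<in> W" "g y \<noteq> \<zero>" for y
    proof (rule ccontr)
      assume "y \<notin> T"
      then have "y \<in> {x \<in> affine_space k n. \<forall>p \<in> S. p x = \<zero>}"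
        using that(1) assms(2) S(2) by blast
      then show False using g(1) that(2) by blast
    qed
    then have "good (g, p, q)" unfolding good_def using g(1) S(1) pq by auto
    then show ?thesis unfolding G_def using g(2) by blast
  qed
  have "G \<subseteq> poly_funs k n" unfolding G_def good_def by auto
  then obtain T where T: "finite T" "T \<subseteq> G"
    "\<And>x. x \<in> affine_space k n \<Longrightarrow> (\<forall>p \<in> T. p x = \<zero>) = (\<forall>p \<in> G. p x = \<zero>)"
    by (rule finite_zero_set[OF field_axioms]) (rule that; assumption)
  have "\<forall>g \<in> T. \<exists>pq. good (g, pq)" using T(2) unfolding G_def by auto
  then obtain s where s: "\<And>g. g \<in> T \<Longrightarrow> good (g, s g)" by metis
  show ?thesis
  proof (rule that[of "(\<lambda>g. (g, s g)) ` T"])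
    show "finite ((\<lambda>g. (g, s g)) ` T)" using T(1) by simp
  next
    fix g p q assume "(g, p, q) \<in> (\<lambda>g. (g, s g)) ` T"
    then have "good (g, p, q)" using s by auto
    then show "g \<in> poly_funs k n \<and> p \<in> poly_funs k n \<and> q \<in> poly_funs k n"
      unfolding good_def by simp
  next
    fix x assume x: "x \<in> W"
    then have "x \<in> affine_space k n" using assms(2) by blast
    then obtain g where "g \<in> T" "g x \<noteq> \<zero>" using T(3) cover[OF x] by blast
    then have "(g, s g) \<in> (\<lambda>g. (g, s g)) ` T" "g x \<noteq> \<zero>" by blast+
    then show "\<exists>(g, p, q) \<in> (\<lambda>g. (g, s g)) ` T. g x \<noteq> \<zero>" by (intro bexI[of _ "(g, s g)"]) auto
  next
    fix x g p q assume x: "x \<in> W" and "(g, p, q) \<in> (\<lambda>g. (g, s g)) ` T" and nz: "g x \<noteq> \<zero>"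
    then have "good (g, p, q)" using s by auto
    then show "q x \<noteq> \<zero> \<and> f x = p x \<otimes> inv q x" using x nz unfolding good_def by simp
  qed
qed

text \<open>Inverses are not terms, so the value p / q is expressed by an equation t q = p. The
  quotients agree where several apply, so any of them may be used.\<close>

lemma kdef_regular:
  fixes t :: "(nat \<Rightarrow> 'i \<Rightarrow> 'f) \<Rightarrow> 'f"
  assumes "regular_fun k n W f" "W \<subseteq> affine_space k n" "kdef (\<lambda>w. val vs w \<in> W)"
    "\<forall>t \<in> set vs. kterm t" "length vs = n" "kterm t"
  shows "kdef (\<lambda>w. val vs w \<in> W \<and> f (val vs w) = t w)"
proof -
  obtain Q where Q: "finite Q"
    "\<And>g p q. (g, p, q) \<in> Q \<Longrightarrow> g \<in> poly_funs k n \<and> p \<in> poly_funs k n \<and> q \<in> poly_funs k n"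
    "\<And>x. x \<in> W \<Longrightarrow> \<exists>(g, p, q) \<in> Q. g x \<noteq> \<zero>"
    "\<And>x g p q. x \<in> W \<Longrightarrow> (g, p, q) \<in> Q \<Longrightarrow> g x \<noteq> \<zero> \<Longrightarrow> q x \<noteq> \<zero> \<and> f x = p x \<otimes> inv q x"
    using regular_fun_finite_cover[OF assms(1,2)] by blast
  have "kdef (\<lambda>w. val vs w \<in> W \<and> (\<exists>r \<in> Q. \<not> fst r (val vs w) = \<zero> \<and>
      t w \<otimes> snd (snd r) (val vs w) = fst (snd r) (val vs w)))"
  proof (intro kdef_conj assms(3) kdef_Bex[OF Q(1)] kdef_neg)
    fix r assume "r \<in> Q"
    then have "fst r \<in> poly_funs k n" "fst (snd r) \<in> poly_funs k n" "snd (snd r) \<in> poly_funs k n"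
      using Q(2)[of "fst r" "fst (snd r)" "snd (snd r)"] by simp_all
    then have *: "kterm (\<lambda>w. fst r (val vs w))" "kterm (\<lambda>w. fst (snd r) (val vs w))"
        "kterm (\<lambda>w. snd (snd r) (val vs w))"
      using kterm_poly assms(4,5) by blast+
    show "kdef (\<lambda>w. fst r (val vs w) = \<zero>)" by (intro kdef_eq * kterm_const) simp
    show "kdef (\<lambda>w. t w \<otimes> snd (snd r) (val vs w) = fst (snd r) (val vs w))"
      by (intro kdef_eq kterm_mult * assms(6))
  qed
  then show ?thesis
  proof (rule kdef_cong)
    fix w :: "nat \<Rightarrow> 'i \<Rightarrow> 'f" assume w: "ok w"
    have tc: "t w \<in> carrier k" by (rule kterm_closed[OF assms(6) w])
    have "t w \<otimes> q (val vs w) = p (val vs w) \<longleftrightarrow> f (val vs w) = t w"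
      if "(g, p, q) \<in> Q" "val vs w \<in> W" "g (val vs w) \<noteq> \<zero>" for g p q
    proof -
      have f: "q (val vs w) \<noteq> \<zero>" "f (val vs w) = p (val vs w) \<otimes> inv q (val vs w)"
        using Q(4)[OF that(2,1,3)] by blast+
      have pq: "p (val vs w) \<in> carrier k" "q (val vs w) \<in> carrier k"
        using Q(2)[OF that(1)] kterm_closed[OF kterm_poly[OF _ assms(4,5)] w] by blast+
      then have i: "inv q (val vs w) \<in> carrier k" "q (val vs w) \<otimes> inv q (val vs w) = \<one>"
        using f(1) by (auto simp: field_Units)
      show ?thesis
      proof
        assume "t w \<otimes> q (val vs w) = p (val vs w)"
        then show "f (val vs w) = t w" unfolding f(2) using tc pq i by (metis m_assoc r_one)
      next
        assume "f (val vs w) = t w"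
        then have "t w = p (val vs w) \<otimes> inv q (val vs w)" unfolding f(2) by simp
        then show "t w \<otimes> q (val vs w) = p (val vs w)" using pq i by (metis m_assoc m_comm r_one)
      qed
    qed
    then have eq: "t w \<otimes> snd (snd r) (val vs w) = fst (snd r) (val vs w) \<longleftrightarrow> f (val vs w) = t w"
      if "r \<in> Q" "val vs w \<in> W" "fst r (val vs w) \<noteq> \<zero>" for r
      using that by (cases r) simp
    show "(val vs w \<in> W \<and> (\<exists>r \<in> Q. \<not> fst r (val vs w) = \<zero> \<and>
        t w \<otimes> snd (snd r) (val vs w) = fst (snd r) (val vs w))) = (val vs w \<in> W \<and> f (val vs w) = t w)"
    proof (intro conj_cong refl)
      assume W: "val vs w \<in> W"
      obtain r where r: "r \<in> Q" "fst r (val vs w) \<noteq> \<zero>"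
        using Q(3)[OF W] by (auto simp: case_prod_unfold)
      show "(\<exists>r \<in> Q. \<not> fst r (val vs w) = \<zero> \<and>
        t w \<otimes> snd (snd r) (val vs w) = fst (snd r) (val vs w)) = (f (val vs w) = t w)"
        using eq[OF _ W] r by blast
    qed
  qed
qed

end

section \<open>Coding the points of a group variety\<close>

lemma morphismD:
  assumes "morphism k A B f" "(U, n, \<phi>) \<in> A" "(V, m, \<psi>) \<in> B"
  shows "zariski_open_in k n (\<phi> ` U) (\<phi> ` (U \<inter> f -` V))"
    and "i < m \<Longrightarrow> regular_fun k n (\<phi> ` (U \<inter> f -` V)) (\<lambda>z. \<psi> (f (inv_into U \<phi> z)) ! i)"
  using assms unfolding morphism_def by fast+

text \<open>A point is coded by the family of its coordinates in all charts, together with flags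
  telling which charts contain it; so the code is injective and does not depend on choices.\<close>

locale coded_group = coded_field k h + H: group H
  for k :: "'f ring" (structure) and h :: "'f \<Rightarrow> 'c" and H :: "'x monoid" +
  fixes A :: "('x, 'f) chart set"
  assumes variety_H: "variety k (carrier H) A"
    and mult_morphism: "morphism k (product_atlas A A) A (\<lambda>(x, y). x \<otimes>\<^bsub>H\<^esub> y)"
begin

text \<open>A chart of dimension n receives n + 1 indices: 0 is the flag, and \<open>Suc l\<close>
  is the coordinate l.\<close>

definition ix :: "(('x, 'f) chart \<times> nat) set" where
  "ix = (SIGMA (U, n, \<phi>):A. {..n})"

definition code :: "'x \<Rightarrow> ('x, 'f) chart \<times> nat \<Rightarrow> 'f" where
  "code x = (\<lambda>((U, n, \<phi>), l). if (U, n, \<phi>) \<in> A \<and> l \<le> n \<and> x \<in> U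
      then (case l of 0 \<Rightarrow> \<one> | Suc l \<Rightarrow> \<phi> x ! l) else \<zero>)"

definition crd :: "('x, 'f) chart \<Rightarrow> nat \<Rightarrow> ((nat \<Rightarrow> ('x, 'f) chart \<times> nat \<Rightarrow> 'f) \<Rightarrow> 'f) list" where
  "crd C j = map (\<lambda>l w. w j (C, Suc l)) [0..<fst (snd C)]"

lemma finite_A: "finite A"
  and chart_cover: "x \<in> carrier H \<Longrightarrow> \<exists>(U, n, \<phi>) \<in> A. x \<in> U"
  and chart_sub: "(U, n, \<phi>) \<in> A \<Longrightarrow> U \<subseteq> carrier H"
  and chart_inj: "(U, n, \<phi>) \<in> A \<Longrightarrow> inj_on \<phi> U"
  and chart_algebraic: "(U, n, \<phi>) \<in> A \<Longrightarrow> algebraic_set k n (\<phi> ` U)"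
  and id_morphism: "morphism k A A (\<lambda>x. x)"
  using variety_H unfolding variety_def by fast+

lemma finite_ix: "finite ix"
  unfolding ix_def using finite_A by (intro finite_SigmaI) auto

lemma chart_affine: "(U, n, \<phi>) \<in> A \<Longrightarrow> x \<in> U \<Longrightarrow> \<phi> x \<in> affine_space k n"
  using chart_algebraic unfolding algebraic_set_def by blast

lemma chart_nth: "(U, n, \<phi>) \<in> A \<Longrightarrow> x \<in> U \<Longrightarrow> l < n \<Longrightarrow> \<phi> x ! l \<in> carrier k"
  using chart_affine[of U n \<phi> x] by (auto simp: affine_space_def)

lemma chart_length: "(U, n, \<phi>) \<in> A \<Longrightarrow> x \<in> U \<Longrightarrow> length (\<phi> x) = n"
  using chart_affine[of U n \<phi> x] by (auto simp: affine_space_def)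

lemma code_flag: "(U, n, \<phi>) \<in> A \<Longrightarrow> code x ((U, n, \<phi>), 0) = (if x \<in> U then \<one> else \<zero>)"
  by (simp add: code_def)

lemma code_coord:
  "(U, n, \<phi>) \<in> A \<Longrightarrow> l < n \<Longrightarrow> code x ((U, n, \<phi>), Suc l) = (if x \<in> U then \<phi> x ! l else \<zero>)"
  by (simp add: code_def)

lemma code_outside: "i \<notin> ix \<Longrightarrow> code x i = \<zero>"
  unfolding code_def ix_def by (cases i) (auto split: prod.splits)

lemma code_closed: "code x i \<in> carrier k"
  unfolding code_def by (cases i) (auto split: nat.splits intro!: chart_nth)

lemma code_inj: "inj_on code (carrier H)"
proof (rule inj_onI)
  fix x y assume xy: "x \<in> carrier H" "y \<in> carrier H" "code x = code y"
  obtain U n \<phi> where C: "(U, n, \<phi>) \<in> A" "x \<in> U" using chart_cover[OF xy(1)] by blast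
  have y: "y \<in> U" using fun_cong[OF xy(3), of "((U, n, \<phi>), 0)"] C by (auto simp: code_flag split: if_splits)
  have "\<phi> x = \<phi> y"
  proof (rule nth_equalityI)
    show "length (\<phi> x) = length (\<phi> y)" using chart_length[OF C] chart_length[OF C(1) y] by simp
    fix l assume "l < length (\<phi> x)"
    then have "l < n" using chart_length[OF C] by simp
    then show "\<phi> x ! l = \<phi> y ! l"
      using fun_cong[OF xy(3), of "((U, n, \<phi>), Suc l)"] C y by (simp add: code_coord)
  qed
  then show "x = y" using inj_onD[OF chart_inj[OF C(1)]] C(2) y by blast
qed

lemma crd_kterm: "\<forall>t \<in> set (crd C j). kterm t"
  unfolding crd_def by (auto intro: kterm_coord)

lemma length_crd: "length (crd (U, n, \<phi>) j) = n"
  by (simp add: crd_def)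

lemma val_crd:
  assumes "(U, n, \<phi>) \<in> A" "x \<in> U" "w j = code x" shows "val (crd (U, n, \<phi>) j) w = \<phi> x"
  by (rule nth_equalityI) (use assms chart_length in \<open>auto simp: crd_def code_coord\<close>)

text \<open>A set flag names a chart in whose coordinates the point can be read off. All remaining
  entries are then prescribed by the coordinate changes, which are regular because the identity is a
  morphism.\<close>

lemma code_image_kdef:
  "\<exists>P. kdef P \<and> (\<forall>w. ok w \<longrightarrow> (\<forall>i. i \<notin> ix \<longrightarrow> w 0 i = \<zero>) \<longrightarrow> P w = (w 0 \<in> code ` carrier H))"
proof -
  define W where "W C C' = snd (snd C) ` (fst C \<inter> fst C')" for C C' :: "('x, 'f) chart"
  define v where "v C = (\<lambda>w. val (crd C 0) w)" for C
  define R where "R C C' l w \<longleftrightarrow> v C w \<in> W C C' \<and>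
      snd (snd C') (inv_into (fst C) (snd (snd C)) (v C w)) ! l = w 0 (C', Suc l)" for C C' l w
  \<comment> \<open>Two alternatives for a second chart: the point lies in the overlap and the
    entries are its new coordinates, or it does not and all entries are zero.\<close>
  define B where "B C C' w \<longleftrightarrow>
      (w 0 (C', 0) = \<one> \<and> v C w \<in> W C C' \<and> (\<forall>l<fst (snd C'). R C C' l w)) \<or>
      (\<not> v C w \<in> W C C' \<and> w 0 (C', 0) = \<zero> \<and> (\<forall>l<fst (snd C'). w 0 (C', Suc l) = \<zero>))" for C C' w
  define P where "P w \<longleftrightarrow> (\<exists>C \<in> A. w 0 (C, 0) = \<one> \<and> v C w \<in> snd (snd C) ` fst C \<and>
    (\<forall>C' \<in> A. B C C' w))" for w
  have W: "zariski_open_in k n (\<phi> ` U) (W (U, n, \<phi>) (V, m, \<psi>))"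
    "l < m \<Longrightarrow> regular_fun k n (W (U, n, \<phi>) (V, m, \<psi>)) (\<lambda>z. \<psi> (inv_into U \<phi> z) ! l)"
    if "(U, n, \<phi>) \<in> A" "(V, m, \<psi>) \<in> A" for U n \<phi> V m \<psi> l
    using morphismD[OF id_morphism that] unfolding W_def by (simp_all add: vimage_def)
  have Wk: "kdef (\<lambda>w. v C w \<in> W C C')" if "C \<in> A" "C' \<in> A" for C C'
  proof -
    obtain U n \<phi> V m \<psi> where C: "C = (U, n, \<phi>)" "C' = (V, m, \<psi>)" by (cases C, cases C') auto
    note CA = that[unfolded C]
    show ?thesis unfolding v_def C
      by (rule kdef_open_in[OF W(1)[OF CA] kdef_algebraic[OF chart_algebraic[OF CA(1)] crd_kterm length_crd]
        crd_kterm length_crd])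
  qed
  have "kdef P"
    unfolding P_def B_def
  proof (intro kdef_Bex[OF finite_A] kdef_Ball[OF finite_A] kdef_conj kdef_disj kdef_neg kdef_all_less)
    fix C C' l assume C: "C \<in> A"
    show "kdef (\<lambda>w. w 0 (C, 0) = \<one>)" by (intro kdef_eq kterm_coord kterm_const) simp
    obtain U n \<phi> where Ce: "C = (U, n, \<phi>)" by (cases C) auto
    show "kdef (\<lambda>w. v C w \<in> snd (snd C) ` fst C)"
      unfolding v_def Ce fst_conv snd_conv
      by (rule kdef_algebraic[OF chart_algebraic[OF C[unfolded Ce]] crd_kterm length_crd])
    assume C': "C' \<in> A"
    show "kdef (\<lambda>w. w 0 (C', 0) = \<one>)" "kdef (\<lambda>w. w 0 (C', 0) = \<zero>)" "kdef (\<lambda>w. w 0 (C', Suc l) = \<zero>)"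
      by (intro kdef_eq kterm_coord kterm_const; simp)+
    show "kdef (\<lambda>w. v C w \<in> W C C')" by (rule Wk[OF C C'])
    assume l: "l < fst (snd C')"
    obtain V m \<psi> where C'e: "C' = (V, m, \<psi>)" by (cases C') auto
    have sub: "W C C' \<subseteq> affine_space k n"
      using chart_affine C unfolding Ce C'e W_def by auto
    show "kdef (R C C' l)"
      using kdef_regular[OF W(2)[OF C[unfolded Ce] C'[unfolded C'e]] sub[unfolded Ce C'e]
          Wk[OF C C', unfolded v_def Ce C'e] crd_kterm length_crd kterm_coord] l
      unfolding v_def R_def Ce C'e by simp
  qed (rule Wk; assumption)
  moreover have "P w = (w 0 \<in> code ` carrier H)" if w: "ok w" "\<forall>i. i \<notin> ix \<longrightarrow> w 0 i = \<zero>" for w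
  proof
    assume "P w"
    then obtain C where C0: "C \<in> A" "w 0 (C, 0) = \<one> \<and> v C w \<in> snd (snd C) ` fst C \<and> (\<forall>C' \<in> A. B C C' w)"
      unfolding P_def by (rule bexE)
    have C: "C \<in> A" "w 0 (C, 0) = \<one>" "v C w \<in> snd (snd C) ` fst C" "\<And>C'. C' \<in> A \<Longrightarrow> B C C' w"
      using C0 by (elim conjE, simp)+
    obtain U n \<phi> where Ce: "C = (U, n, \<phi>)" by (cases C) auto
    define x where "x = inv_into U \<phi> (v C w)"
    have x: "x \<in> U" "\<phi> x = v C w" using C(3) unfolding x_def Ce by (auto simp: inv_into_into f_inv_into_f)
    have "\<phi> x \<in> W (U, n, \<phi>) (V, m, \<psi>) \<longleftrightarrow> x \<in> V" for V m \<psi>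
      using x(1) inj_on_eq_iff[OF chart_inj[OF C(1)[unfolded Ce]]] unfolding W_def by auto
    then have Wx: "v C w \<in> W C (V, m, \<psi>) \<longleftrightarrow> x \<in> V" for V m \<psi>
      unfolding x(2) Ce .
    have "w 0 i = code x i" for i
    proof (cases "i \<in> ix")
      case False
      then have "w 0 i = \<zero>" using w(2) by blast
      then show ?thesis using code_outside[OF False] by simp
    next
      case True
      then obtain V m \<psi> l where i: "i = ((V, m, \<psi>), l)" "(V, m, \<psi>) \<in> A" "l \<le> m" unfolding ix_def by auto
      have B: "(w 0 ((V, m, \<psi>), 0) = \<one> \<and> x \<in> V \<and> (\<forall>l<m. \<psi> x ! l = w 0 ((V, m, \<psi>), Suc l))) \<or>
          (x \<notin> V \<and> w 0 ((V, m, \<psi>), 0) = \<zero> \<and> (\<forall>l<m. w 0 ((V, m, \<psi>), Suc l) = \<zero>))"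
        using C(4)[OF i(2)] unfolding B_def R_def Wx fst_conv snd_conv
        by (auto simp: x_def Ce)
      show ?thesis
        using B i(3) unfolding i(1)
        by (cases l) (auto simp: code_flag[OF i(2)] code_coord[OF i(2)])
    qed
    moreover have "x \<in> carrier H" using x(1) chart_sub C(1) Ce by blast
    ultimately show "w 0 \<in> code ` carrier H" by blast
  next
    assume "w 0 \<in> code ` carrier H"
    then obtain x where x: "x \<in> carrier H" "w 0 = code x" by blast
    obtain U n \<phi> where C: "(U, n, \<phi>) \<in> A" "x \<in> U" using chart_cover[OF x(1)] by blast
    have v: "v (U, n, \<phi>) w = \<phi> x" unfolding v_def using C x(2) by (intro val_crd)
    have iv: "inv_into U \<phi> (\<phi> x) = x" using C chart_inj by simp
    have Wx: "\<phi> x \<in> W (U, n, \<phi>) (V, m, \<psi>) \<longleftrightarrow> x \<in> V" for V m \<psi>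
      using C(2) inj_on_eq_iff[OF chart_inj[OF C(1)]] unfolding W_def by auto
    show "P w" unfolding P_def
    proof (rule bexI[OF _ C(1)], intro conjI ballI)
      show "w 0 ((U, n, \<phi>), 0) = \<one>" using C by (simp add: x(2) code_flag)
      show "v (U, n, \<phi>) w \<in> snd (snd (U, n, \<phi>)) ` fst (U, n, \<phi>)" using C(2) by (simp add: v)
      fix C' assume "C' \<in> A"
      moreover obtain V m \<psi> where "C' = (V, m, \<psi>)" by (cases C') auto
      ultimately show "B (U, n, \<phi>) C' w" unfolding B_def R_def
        by (simp add: v x(2) Wx iv code_flag code_coord)
    qed
  qed
  ultimately show ?thesis by blast
qed

text \<open>The graph of the multiplication is a finite union over triples of charts. In each triple
  the product is a regular function of the concatenated coordinates of the two factors, on an open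
  part of the product chart.\<close>

lemma code_mult_kdef:
  "\<exists>P. kdef P \<and> (\<forall>w x y z. ok w \<longrightarrow> x \<in> carrier H \<longrightarrow> y \<in> carrier H \<longrightarrow> z \<in> carrier H \<longrightarrow>
     w 0 = code x \<longrightarrow> w 1 = code y \<longrightarrow> w 2 = code z \<longrightarrow> P w = (z = x \<otimes>\<^bsub>H\<^esub> y))"
proof -
  let ?m = "\<lambda>(x, y). x \<otimes>\<^bsub>H\<^esub> y"
  define pr where "pr C D = (\<lambda>(x, y). snd (snd C) x @ snd (snd D) y :: 'f list)"
    for C D :: "('x, 'f) chart"
  define W where "W C D B = pr C D ` ((fst C \<times> fst D) \<inter> ?m -` fst B)" for C D B :: "('x, 'f) chart"
  define g where "g C D B l z = snd (snd B) (?m (inv_into (fst C \<times> fst D) (pr C D) z)) ! l"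
    for C D B :: "('x, 'f) chart" and l z
  define v where "v C D = crd C 0 @ crd D 1" for C D
  define R where "R C D B l w \<longleftrightarrow> val (v C D) w \<in> W C D B \<and> g C D B l (val (v C D) w) = w 2 (B, Suc l)"
    for C D B l w
  define P where "P w \<longleftrightarrow> (\<exists>C \<in> A. \<exists>D \<in> A. \<exists>B \<in> A. w 0 (C, 0) = \<one> \<and> w 1 (D, 0) = \<one> \<and> w 2 (B, 0) = \<one> \<and>
     val (v C D) w \<in> W C D B \<and>
     (\<forall>l<fst (snd B). R C D B l w))" for w
  have W: "zariski_open_in k (n + m) (pr C D ` (fst C \<times> fst D)) (W C D B)"
    "l < q \<Longrightarrow> regular_fun k (n + m) (W C D B) (g C D B l)"
    if "C \<in> A" "D \<in> A" "B \<in> A" "C = (U, n, \<phi>)" "D = (V, m, \<psi>)" "B = (B\<^sub>0, q, \<chi>)"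
    for C D B U n \<phi> V m \<psi> B\<^sub>0 q \<chi> l
  proof -
    have "(U \<times> V, n + m, pr C D) \<in> product_atlas A A"
      using that(1,2) unfolding product_atlas_def pr_def that(4,5) by force
    note * = morphismD[OF mult_morphism this, of B\<^sub>0 q \<chi>, OF that(3)[unfolded that(6)]]
    show "zariski_open_in k (n + m) (pr C D ` (fst C \<times> fst D)) (W C D B)"
      using *(1) unfolding W_def by (simp add: that(4-6))
    show "l < q \<Longrightarrow> regular_fun k (n + m) (W C D B) (g C D B l)"
      using *(2)[of l] unfolding W_def g_def[abs_def] by (simp add: that(4-6))
  qed
  have sub: "W C D B \<subseteq> affine_space k (fst (snd C) + fst (snd D))" if "C \<in> A" "D \<in> A" for C D B
  proof -
    obtain U n \<phi> V m \<psi> where e: "C = (U, n, \<phi>)" "D = (V, m, \<psi>)" by (cases C, cases D) auto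
    show ?thesis
      using chart_affine[OF that(1)[unfolded e]] chart_affine[OF that(2)[unfolded e]]
      unfolding W_def pr_def e by (fastforce simp: affine_space_def)
  qed
  have prk: "kdef (\<lambda>w. val (v C D) w \<in> pr C D ` (fst C \<times> fst D))" if "C \<in> A" "D \<in> A" for C D
  proof -
    obtain U n \<phi> V m \<psi> where e: "C = (U, n, \<phi>)" "D = (V, m, \<psi>)" by (cases C, cases D) auto
    have "kdef (\<lambda>w. val (crd C 0) w \<in> \<phi> ` U \<and> val (crd D 1) w \<in> \<psi> ` V)"
      using that e by (intro kdef_conj kdef_algebraic[OF chart_algebraic] crd_kterm) (auto simp: length_crd)
    then show ?thesis
    proof (rule kdef_cong)
      fix w :: "nat \<Rightarrow> ('x, 'f) chart \<times> nat \<Rightarrow> 'f"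
      show "(val (crd C 0) w \<in> \<phi> ` U \<and> val (crd D 1) w \<in> \<psi> ` V) =
          (val (v C D) w \<in> pr C D ` (fst C \<times> fst D))"
      proof
        assume "val (v C D) w \<in> pr C D ` (fst C \<times> fst D)"
        then obtain x y where xy: "x \<in> U" "y \<in> V" "val (crd C 0) w @ val (crd D 1) w = \<phi> x @ \<psi> y"
          unfolding v_def pr_def e by auto
        then have "val (crd C 0) w = \<phi> x" "val (crd D 1) w = \<psi> y"
          using chart_length that e by (auto simp: length_crd append_eq_append_conv)
        then show "val (crd C 0) w \<in> \<phi> ` U \<and> val (crd D 1) w \<in> \<psi> ` V" using xy by blast
      next
        assume "val (crd C 0) w \<in> \<phi> ` U \<and> val (crd D 1) w \<in> \<psi> ` V"
        then obtain x y where xy: "x \<in> U" "y \<in> V" "val (crd C 0) w = \<phi> x" "val (crd D 1) w = \<psi> y"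
          by blast
        then have "val (v C D) w = pr C D (x, y)" by (simp add: v_def pr_def e)
        then show "val (v C D) w \<in> pr C D ` (fst C \<times> fst D)" using xy(1,2) e by (intro image_eqI) auto
      qed
    qed
  qed
  have Wk: "kdef (\<lambda>w. val (v C D) w \<in> W C D B)" if "C \<in> A" "D \<in> A" "B \<in> A" for C D B
  proof -
    obtain U n \<phi> V m \<psi> B\<^sub>0 q \<chi> where e: "C = (U, n, \<phi>)" "D = (V, m, \<psi>)" "B = (B\<^sub>0, q, \<chi>)"
      by (cases C, cases D, cases B) auto
    show ?thesis
    proof (rule kdef_open_in)
      show "zariski_open_in k (n + m) (pr C D ` (fst C \<times> fst D)) (W C D B)" by (rule W(1)[OF that e])
      show "kdef (\<lambda>w. val (v C D) w \<in> pr C D ` (fst C \<times> fst D))" by (rule prk[OF that(1,2)])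
      show "\<forall>t \<in> set (v C D). kterm t" unfolding v_def using crd_kterm[of C 0] crd_kterm[of D 1] by auto
      show "length (v C D) = n + m" unfolding v_def by (simp add: e length_crd)
    qed
  qed
  have "kdef P"
    unfolding P_def
  proof (intro kdef_Bex[OF finite_A] kdef_conj kdef_all_less)
    fix C D B l assume *: "C \<in> A" "D \<in> A" "B \<in> A"
    show "kdef (\<lambda>w. val (v C D) w \<in> W C D B)" by (rule Wk[OF *])
    assume l: "l < fst (snd B)"
    obtain U n \<phi> V m \<psi> B\<^sub>0 q \<chi> where e: "C = (U, n, \<phi>)" "D = (V, m, \<psi>)" "B = (B\<^sub>0, q, \<chi>)"
      by (cases C, cases D, cases B) auto
    show "kdef (R C D B l)" unfolding R_def[abs_def]
    proof (rule kdef_regular)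
      show "regular_fun k (n + m) (W C D B) (g C D B l)" using W(2)[OF * e] l e(3) by simp
      show "W C D B \<subseteq> affine_space k (n + m)" using sub[OF *(1,2), of B] e by simp
      show "kdef (\<lambda>w. val (v C D) w \<in> W C D B)" by (rule Wk[OF *])
      show "\<forall>t \<in> set (v C D). kterm t" unfolding v_def using crd_kterm[of C 0] crd_kterm[of D 1] by auto
      show "length (v C D) = n + m" unfolding v_def by (simp add: e length_crd)
    qed (rule kterm_coord)
  qed (intro kdef_eq kterm_coord kterm_const; simp)+
  moreover have "P w = (z = x \<otimes>\<^bsub>H\<^esub> y)"
    if w: "w 0 = code x" "w 1 = code y" "w 2 = code z"
      and xyz: "x \<in> carrier H" "y \<in> carrier H" "z \<in> carrier H" for w x y z
  proof -
    have pr_inj: "inj_on (pr C D) (fst C \<times> fst D)" if "C \<in> A" "D \<in> A" for C D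
    proof -
      obtain U n \<phi> V m \<psi> where e: "C = (U, n, \<phi>)" "D = (V, m, \<psi>)" by (cases C, cases D) auto
      show ?thesis unfolding e pr_def
      proof (rule inj_onI, clarsimp)
        fix a b a' b' assume ab: "a \<in> U" "b \<in> V" "a' \<in> U" "b' \<in> V" "\<phi> a @ \<psi> b = \<phi> a' @ \<psi> b'"
        \<comment> \<open>Equal lengths of the first parts allow the concatenation to be
          split.\<close>
        have "length (\<phi> a) = length (\<phi> a')" using ab chart_length that(1) e(1) by metis
        then have "\<phi> a = \<phi> a'" "\<psi> b = \<psi> b'" using ab(5) by auto
        then show "a = a' \<and> b = b'"
          using ab chart_inj that e by (metis inj_onD)
      qed
    qed
    have key: "val (v C D) w = pr C D (x, y)"
        "val (v C D) w \<in> W C D B \<longleftrightarrow> x \<otimes>\<^bsub>H\<^esub> y \<in> fst B"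
        "g C D B l (val (v C D) w) = snd (snd B) (x \<otimes>\<^bsub>H\<^esub> y) ! l"
      if "C \<in> A" "D \<in> A" "x \<in> fst C" "y \<in> fst D" for C D B l
    proof -
      obtain U n \<phi> V m \<psi> where e: "C = (U, n, \<phi>)" "D = (V, m, \<psi>)" by (cases C, cases D) auto
      show v: "val (v C D) w = pr C D (x, y)"
        unfolding v_def pr_def using that e w by (simp add: val_crd)
      show "val (v C D) w \<in> W C D B \<longleftrightarrow> x \<otimes>\<^bsub>H\<^esub> y \<in> fst B"
        unfolding v W_def using that(3,4) inj_on_eq_iff[OF pr_inj[OF that(1,2)]] by auto
      show "g C D B l (val (v C D) w) = snd (snd B) (x \<otimes>\<^bsub>H\<^esub> y) ! l"
        unfolding v g_def using that(3,4) inv_into_f_f[OF pr_inj[OF that(1,2)]] by simp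
    qed
    have flag: "code u (C, 0) = \<one> \<longleftrightarrow> u \<in> fst C" if "C \<in> A" for C u
      using that code_flag[of "fst C" "fst (snd C)" "snd (snd C)" u] by auto
    show ?thesis
    proof
      assume "P w"
      then obtain C D B where CDB: "C \<in> A" "D \<in> A" "B \<in> A" "w 0 (C, 0) = \<one>" "w 1 (D, 0) = \<one>"
        "w 2 (B, 0) = \<one>" "val (v C D) w \<in> W C D B"
        "\<forall>l<fst (snd B). g C D B l (val (v C D) w) = w 2 (B, Suc l)" unfolding P_def R_def by blast
      have in': "x \<in> fst C" "y \<in> fst D" "z \<in> fst B" using CDB w flag by auto
      note k = key[OF CDB(1,2) in'(1,2)]
      obtain U n \<phi> where B: "B = (U, n, \<phi>)" by (cases B) auto
      have m: "x \<otimes>\<^bsub>H\<^esub> y \<in> U" "z \<in> U" using CDB(7) k(2) in'(3) B by auto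
      have "\<phi> (x \<otimes>\<^bsub>H\<^esub> y) = \<phi> z"
      proof (rule nth_equalityI)
        show "length (\<phi> (x \<otimes>\<^bsub>H\<^esub> y)) = length (\<phi> z)" using m chart_length CDB(3) B by metis
        fix l assume "l < length (\<phi> (x \<otimes>\<^bsub>H\<^esub> y))"
        then have "l < n" using m(1) chart_length CDB(3) B by metis
        then show "\<phi> (x \<otimes>\<^bsub>H\<^esub> y) ! l = \<phi> z ! l"
          using CDB(3,8) k(3) w(3) m(2) B by (simp add: code_coord)
      qed
      then show "z = x \<otimes>\<^bsub>H\<^esub> y" using m chart_inj CDB(3) B by (metis inj_onD)
    next
      assume z: "z = x \<otimes>\<^bsub>H\<^esub> y"
      obtain C D B where CDB: "C \<in> A" "D \<in> A" "B \<in> A" "x \<in> fst C" "y \<in> fst D" "z \<in> fst B"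
        using chart_cover[OF xyz(1)] chart_cover[OF xyz(2)] chart_cover[OF xyz(3)] by fastforce
      note k = key[OF CDB(1,2,4,5)]
      obtain U n \<phi> where B: "B = (U, n, \<phi>)" by (cases B) auto
      have "g C D B l (val (v C D) w) = w 2 (B, Suc l)" if "l < fst (snd B)" for l
        using that CDB(3,6) z k(3) w(3) B by (simp add: code_coord)
      then show "P w" unfolding P_def R_def
        using CDB k(2) z w flag by (intro bexI[of _ C] bexI[of _ D] bexI[of _ B]) auto
    qed
  qed
  ultimately show ?thesis by (intro exI[of _ P]) simp
qed

end

section \<open>Separation in relational form\<close>

text \<open>Only the graph of the multiplication is definable, so the group axioms are put in terms
  of a ternary relation, with quantifiers bounded by \<open>C\<close>. The relation \<open>E\<close>
  stands for equality, so that a formula can be supplied for it.\<close>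

definition rel_group :: "'t set \<Rightarrow> ('t \<Rightarrow> 't \<Rightarrow> 't \<Rightarrow> bool) \<Rightarrow> ('t \<Rightarrow> 't \<Rightarrow> bool) \<Rightarrow> 't \<Rightarrow> bool" where
  "rel_group C M E e \<longleftrightarrow> e \<in> C \<and>
     (\<forall>x \<in> C. \<forall>y \<in> C. \<exists>z \<in> C. M x y z) \<and>
     (\<forall>x \<in> C. \<forall>y \<in> C. \<forall>z \<in> C. \<forall>z' \<in> C. M x y z \<and> M x y z' \<longrightarrow> E z z') \<and>
     (\<forall>x \<in> C. \<forall>y \<in> C. \<forall>z \<in> C. \<forall>u \<in> C. \<forall>v \<in> C. \<forall>w \<in> C.
        M x y u \<and> M u z w \<and> M y z v \<longrightarrow> M x v w) \<and>
     (\<forall>x \<in> C. M e x x) \<and> (\<forall>x \<in> C. \<exists>y \<in> C. M y x e)"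

definition rel_monoid :: "'t set \<Rightarrow> ('t \<Rightarrow> 't \<Rightarrow> 't \<Rightarrow> bool) \<Rightarrow> 't \<Rightarrow> 't monoid" where
  "rel_monoid C M e = \<lparr>carrier = C, monoid.mult = (\<lambda>x y. THE z. z \<in> C \<and> M x y z), one = e\<rparr>"

text \<open>The defect s = c(g) c(h) c(gh)^-1 without inverses: s c(gh) and c(g) c(h) have a common
  value u. Members of \<open>J\<close> are the triples (g, h, gh).\<close>

definition rel_defect ::
    "'t set \<Rightarrow> ('t \<Rightarrow> 't \<Rightarrow> 't \<Rightarrow> bool) \<Rightarrow> ('g \<Rightarrow> 't) \<Rightarrow> ('g \<times> 'g \<times> 'g) set \<Rightarrow> 't \<Rightarrow> bool" where
  "rel_defect C M c J s \<longleftrightarrow>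
     (\<exists>p \<in> J. \<exists>u \<in> C. M (c (fst p)) (c (fst (snd p))) u \<and> M s (c (snd (snd p))) u)"

text \<open>Everything is expressed by the graph alone: w e = e means that w is the unit, x y = e
  that y is the inverse of x, and g v = u = x g that v is the conjugate of x by g.\<close>

primrec rel_prod ::
    "'t set \<Rightarrow> ('t \<Rightarrow> 't \<Rightarrow> 't \<Rightarrow> bool) \<Rightarrow> 't \<Rightarrow> ('t \<Rightarrow> bool) \<Rightarrow> nat \<Rightarrow> 't \<Rightarrow> bool" where
  "rel_prod C M e S 0 w \<longleftrightarrow> M w e e"
| "rel_prod C M e S (Suc n) w \<longleftrightarrow> (\<exists>x \<in> C. \<exists>g \<in> C. (S x \<or> (\<exists>y \<in> C. M x y e \<and> S y)) \<and>
     (\<exists>u \<in> C. \<exists>v \<in> C. M g v u \<and> M x g u \<and> (\<exists>r \<in> C. rel_prod C M e S n r \<and> M v r w)))"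

lemma rel_monoid_group:
  assumes "rel_group C M E e" and E: "\<And>z z'. z \<in> C \<Longrightarrow> z' \<in> C \<Longrightarrow> E z z' \<longleftrightarrow> z = z'"
  shows "group (rel_monoid C M e)"
    and "\<And>x y z. x \<in> C \<Longrightarrow> y \<in> C \<Longrightarrow> z \<in> C \<Longrightarrow> M x y z \<longleftrightarrow> z = x \<otimes>\<^bsub>rel_monoid C M e\<^esub> y"
proof -
  let ?G = "rel_monoid C M e"
  have e: "e \<in> C" and ex: "\<And>x y. x \<in> C \<Longrightarrow> y \<in> C \<Longrightarrow> \<exists>z \<in> C. M x y z"
    and uniq: "\<And>x y z z'. x \<in> C \<Longrightarrow> y \<in> C \<Longrightarrow> z \<in> C \<Longrightarrow> z' \<in> C \<Longrightarrow> M x y z \<Longrightarrow> M x y z' \<Longrightarrow> z = z'"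
    and assoc: "\<And>x y z u v w. x \<in> C \<Longrightarrow> y \<in> C \<Longrightarrow> z \<in> C \<Longrightarrow> u \<in> C \<Longrightarrow> v \<in> C \<Longrightarrow> w \<in> C \<Longrightarrow>
        M x y u \<Longrightarrow> M u z w \<Longrightarrow> M y z v \<Longrightarrow> M x v w"
    and one: "\<And>x. x \<in> C \<Longrightarrow> M e x x" and inv: "\<And>x. x \<in> C \<Longrightarrow> \<exists>y \<in> C. M y x e"
    using assms(1) E unfolding rel_group_def by meson+
  have mult: "x \<otimes>\<^bsub>?G\<^esub> y \<in> C" "M x y (x \<otimes>\<^bsub>?G\<^esub> y)" if xy: "x \<in> C" "y \<in> C" for x y
  proof -
    have "\<exists>!z. z \<in> C \<and> M x y z" using ex[OF xy] uniq[OF xy] by blast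
    from theI'[OF this] show "x \<otimes>\<^bsub>?G\<^esub> y \<in> C" "M x y (x \<otimes>\<^bsub>?G\<^esub> y)"
      unfolding rel_monoid_def by simp_all
  qed
  show M: "M x y z \<longleftrightarrow> z = x \<otimes>\<^bsub>?G\<^esub> y" if "x \<in> C" "y \<in> C" "z \<in> C" for x y z
    using mult[OF that(1,2)] uniq[OF that(1,2)] that(3) by blast
  show "group ?G"
  proof (rule groupI)
    fix x y z assume "x \<in> carrier ?G" "y \<in> carrier ?G" "z \<in> carrier ?G"
    then have xyz: "x \<in> C" "y \<in> C" "z \<in> C" by (simp_all add: rel_monoid_def)
    have "M x (y \<otimes>\<^bsub>?G\<^esub> z) (x \<otimes>\<^bsub>?G\<^esub> y \<otimes>\<^bsub>?G\<^esub> z)"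
      using mult(1)[OF xyz(1,2)] mult(1)[OF xyz(2,3)] mult(1)[OF mult(1)[OF xyz(1,2)] xyz(3)]
        mult(2)[OF xyz(1,2)] mult(2)[OF mult(1)[OF xyz(1,2)] xyz(3)] mult(2)[OF xyz(2,3)]
      by (rule assoc[OF xyz])
    then show "x \<otimes>\<^bsub>?G\<^esub> y \<otimes>\<^bsub>?G\<^esub> z = x \<otimes>\<^bsub>?G\<^esub> (y \<otimes>\<^bsub>?G\<^esub> z)"
      using M[OF xyz(1) mult(1)[OF xyz(2,3)] mult(1)[OF mult(1)[OF xyz(1,2)] xyz(3)]] by blast
  next
    fix x assume "x \<in> carrier ?G"
    then have x: "x \<in> C" by (simp add: rel_monoid_def)
    show "\<one>\<^bsub>?G\<^esub> \<otimes>\<^bsub>?G\<^esub> x = x" using M[OF e x x] one[OF x] by (simp add: rel_monoid_def)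
    obtain y where y: "y \<in> C" "M y x e" using inv[OF x] by blast
    then have "y \<otimes>\<^bsub>?G\<^esub> x = \<one>\<^bsub>?G\<^esub>" using M[OF y(1) x e] by (simp add: rel_monoid_def)
    then show "\<exists>y \<in> carrier ?G. y \<otimes>\<^bsub>?G\<^esub> x = \<one>\<^bsub>?G\<^esub>" using y(1) by (intro bexI[of _ y]) (simp_all add: rel_monoid_def)
  qed (use mult(1) e in \<open>simp_all add: rel_monoid_def\<close>)
qed

section \<open>From the relation back to the group\<close>

text \<open>Applied twice: to the given algebraic group with its coding by coordinates, and to the
  group defined over the new field, where the coding is the identity. The same relational formula
  thus means separation in both.\<close>

locale group_coding = group H for H :: "'h monoid" (structure) +
  fixes \<gamma> :: "'h \<Rightarrow> 't" and C :: "'t set" and M :: "'t \<Rightarrow> 't \<Rightarrow> 't \<Rightarrow> bool"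
  assumes image: "C = \<gamma> ` carrier H"
    and inj: "inj_on \<gamma> (carrier H)"
    and M_iff: "x \<in> carrier H \<Longrightarrow> y \<in> carrier H \<Longrightarrow> z \<in> carrier H \<Longrightarrow>
      M (\<gamma> x) (\<gamma> y) (\<gamma> z) \<longleftrightarrow> z = x \<otimes> y"
begin

lemma Bex_C: "(\<exists>x \<in> C. P x) \<longleftrightarrow> (\<exists>x \<in> carrier H. P (\<gamma> x))"
  unfolding image by blast

lemma rel_group:
  assumes "\<And>z z'. z \<in> C \<Longrightarrow> z' \<in> C \<Longrightarrow> E z z' \<longleftrightarrow> z = z'" shows "rel_group C M E (\<gamma> \<one>)"
proof -
  have "\<exists>y \<in> carrier H. \<one> = y \<otimes> x" if "x \<in> carrier H" for x
    using that by (intro bexI[of _ "inv x"]) auto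
  then show ?thesis
    unfolding rel_group_def image using assms inj_on_eq_iff[OF inj]
    by (simp add: M_iff image m_assoc)
qed

lemma rel_defect_iff:
  assumes "\<phi> \<in> \<Phi> \<rightarrow> carrier H" "s \<in> carrier H"
    and J: "J = {(g, h, g \<otimes>\<^bsub>G\<^esub> h) | g h. g \<in> \<Phi> \<and> h \<in> \<Phi> \<and> g \<otimes>\<^bsub>G\<^esub> h \<in> \<Phi>}"
  shows "rel_defect C M (\<lambda>g. \<gamma> (\<phi> g)) J (\<gamma> s) \<longleftrightarrow> s \<in> defects G H \<Phi> \<phi>"
proof -
  have *: "(\<exists>u \<in> C. M (\<gamma> x) (\<gamma> y) u \<and> M (\<gamma> s) (\<gamma> z) u) \<longleftrightarrow> s = x \<otimes> y \<otimes> inv z"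
    if "x \<in> carrier H" "y \<in> carrier H" "z \<in> carrier H" for x y z
  proof -
    have "(\<exists>u \<in> C. M (\<gamma> x) (\<gamma> y) u \<and> M (\<gamma> s) (\<gamma> z) u) \<longleftrightarrow> x \<otimes> y = s \<otimes> z"
      unfolding image using that assms(2) by (simp add: M_iff)
    also have "\<dots> \<longleftrightarrow> s = x \<otimes> y \<otimes> inv z"
      using inv_solve_right[of s "x \<otimes> y" z] that assms(2) by auto
    finally show ?thesis .
  qed
  have cl: "\<phi> g \<in> carrier H" if "g \<in> \<Phi>" for g using assms(1) that by blast
  have "rel_defect C M (\<lambda>g. \<gamma> (\<phi> g)) J (\<gamma> s) \<longleftrightarrow> (\<exists>g h. g \<in> \<Phi> \<and> h \<in> \<Phi> \<and> g \<otimes>\<^bsub>G\<^esub> h \<in> \<Phi> \<and>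
     (\<exists>u \<in> C. M (\<gamma> (\<phi> g)) (\<gamma> (\<phi> h)) u \<and> M (\<gamma> s) (\<gamma> (\<phi> (g \<otimes>\<^bsub>G\<^esub> h))) u))"
    unfolding rel_defect_def J by auto
  also have "\<dots> \<longleftrightarrow> (\<exists>g h. g \<in> \<Phi> \<and> h \<in> \<Phi> \<and> g \<otimes>\<^bsub>G\<^esub> h \<in> \<Phi> \<and> s = \<phi> g \<otimes> \<phi> h \<otimes> inv \<phi> (g \<otimes>\<^bsub>G\<^esub> h))"
    using *[OF cl cl cl] by blast
  also have "\<dots> \<longleftrightarrow> s \<in> defects G H \<Phi> \<phi>" unfolding defects_def by blast
  finally show ?thesis .
qed

lemma conj_products_Suc:
  "w \<in> conj_products H (Suc n) S \<longleftrightarrow> (\<exists>x \<in> carrier H. \<exists>g \<in> carrier H. \<exists>r \<in> conj_products H n S.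
     (x \<in> S \<or> inv x \<in> S) \<and> w = inv g \<otimes> x \<otimes> g \<otimes> r)"
proof
  assume "w \<in> conj_products H (Suc n) S"
  then obtain ps where ps: "w = foldr (\<otimes>) (map (\<lambda>(x, g). inv g \<otimes> x \<otimes> g) ps) \<one>" "length ps = Suc n"
    "\<forall>(x, g) \<in> set ps. x \<in> carrier H \<and> g \<in> carrier H \<and> (x \<in> S \<or> inv x \<in> S)"
    unfolding conj_products_def by blast
  then obtain x g qs where "ps = (x, g) # qs" by (cases ps) auto
  then show "\<exists>x \<in> carrier H. \<exists>g \<in> carrier H. \<exists>r \<in> conj_products H n S.
     (x \<in> S \<or> inv x \<in> S) \<and> w = inv g \<otimes> x \<otimes> g \<otimes> r"
    using ps unfolding conj_products_def by auto
next
  assume "\<exists>x \<in> carrier H. \<exists>g \<in> carrier H. \<exists>r \<in> conj_products H n S.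
     (x \<in> S \<or> inv x \<in> S) \<and> w = inv g \<otimes> x \<otimes> g \<otimes> r"
  then obtain x g qs where "x \<in> carrier H" "g \<in> carrier H" "x \<in> S \<or> inv x \<in> S" "length qs = n"
    "w = inv g \<otimes> x \<otimes> g \<otimes> foldr (\<otimes>) (map (\<lambda>(x, g). inv g \<otimes> x \<otimes> g) qs) \<one>"
    "\<forall>(x, g) \<in> set qs. x \<in> carrier H \<and> g \<in> carrier H \<and> (x \<in> S \<or> inv x \<in> S)"
    unfolding conj_products_def by blast
  then show "w \<in> conj_products H (Suc n) S" unfolding conj_products_def
    by (intro CollectI exI[of _ "(x, g) # qs"]) auto
qed

lemma conj_products_0: "conj_products H 0 S = {\<one>}"
  unfolding conj_products_def by auto

lemma conj_products_closed: "conj_products H n S \<subseteq> carrier H"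
proof (induction n)
  case (Suc n)
  show ?case
  proof
    fix w assume "w \<in> conj_products H (Suc n) S"
    then show "w \<in> carrier H" using Suc unfolding conj_products_Suc by blast
  qed
qed (simp add: conj_products_0)

lemma rel_prod_iff:
  assumes D: "\<And>s. s \<in> carrier H \<Longrightarrow> D (\<gamma> s) \<longleftrightarrow> s \<in> S" and w: "w \<in> carrier H"
  shows "rel_prod C M (\<gamma> \<one>) D n (\<gamma> w) \<longleftrightarrow> w \<in> conj_products H n S"
  using w
proof (induction n arbitrary: w)
  case 0
  then show ?case by (auto simp: conj_products_0 M_iff)
next
  case (Suc n)
  have inv: "(\<exists>y \<in> C. M (\<gamma> x) y (\<gamma> \<one>) \<and> D y) \<longleftrightarrow> inv x \<in> S" if x: "x \<in> carrier H" for x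
  proof -
    have "(\<exists>y \<in> C. M (\<gamma> x) y (\<gamma> \<one>) \<and> D y) \<longleftrightarrow> (\<exists>y \<in> carrier H. \<one> = x \<otimes> y \<and> y \<in> S)"
      unfolding image using x by (simp add: M_iff D)
    also have "\<dots> \<longleftrightarrow> (\<exists>y \<in> carrier H. y = inv x \<and> y \<in> S)"
      using inv_solve_left[of _ x \<one>] x by (intro bex_cong refl) simp
    finally show ?thesis using x by simp
  qed
  have conj: "(\<exists>u \<in> C. \<exists>v \<in> C. M (\<gamma> g) v u \<and> M (\<gamma> x) (\<gamma> g) u \<and> Q v) \<longleftrightarrow> Q (\<gamma> (inv g \<otimes> x \<otimes> g))"
    if "x \<in> carrier H" "g \<in> carrier H" for x g Q
  proof -
    have "(\<exists>u \<in> C. \<exists>v \<in> C. M (\<gamma> g) v u \<and> M (\<gamma> x) (\<gamma> g) u \<and> Q v) \<longleftrightarrow>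
        (\<exists>u \<in> carrier H. \<exists>v \<in> carrier H. M (\<gamma> g) (\<gamma> v) (\<gamma> u) \<and> M (\<gamma> x) (\<gamma> g) (\<gamma> u) \<and> Q (\<gamma> v))"
      by (simp only: Bex_C)
    also have "\<dots> \<longleftrightarrow> (\<exists>u \<in> carrier H. \<exists>v \<in> carrier H. u = g \<otimes> v \<and> u = x \<otimes> g \<and> Q (\<gamma> v))"
      using that by (intro bex_cong refl) (simp add: M_iff)
    also have "\<dots> \<longleftrightarrow> (\<exists>v \<in> carrier H. x \<otimes> g = g \<otimes> v \<and> Q (\<gamma> v))"
      using m_closed[OF that] by metis
    also have "\<dots> \<longleftrightarrow> (\<exists>v \<in> carrier H. v = inv g \<otimes> x \<otimes> g \<and> Q (\<gamma> v))"
      using that inv_solve_left[of _ g "x \<otimes> g"] by (intro bex_cong refl) (auto simp: m_assoc)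
    finally show ?thesis using that by simp
  qed
  have "rel_prod C M (\<gamma> \<one>) D (Suc n) (\<gamma> w) \<longleftrightarrow> (\<exists>x \<in> C. \<exists>g \<in> C.
      (D x \<or> (\<exists>y \<in> C. M x y (\<gamma> \<one>) \<and> D y)) \<and>
      (\<exists>u \<in> C. \<exists>v \<in> C. M g v u \<and> M x g u \<and> (\<exists>r \<in> C. rel_prod C M (\<gamma> \<one>) D n r \<and> M v r (\<gamma> w))))"
    by (rule rel_prod.simps)
  also have "\<dots> \<longleftrightarrow> (\<exists>x \<in> carrier H. \<exists>g \<in> carrier H. (x \<in> S \<or> inv x \<in> S) \<and>
      (\<exists>r \<in> C. rel_prod C M (\<gamma> \<one>) D n r \<and> M (\<gamma> (inv g \<otimes> x \<otimes> g)) r (\<gamma> w)))"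
  proof -
    have "(\<exists>x \<in> C. \<exists>g \<in> C. Q x g) \<longleftrightarrow> (\<exists>x \<in> carrier H. \<exists>g \<in> carrier H. Q (\<gamma> x) (\<gamma> g))" for Q
      by (simp only: Bex_C)
    note two = this
    show ?thesis
    proof (subst two, rule bex_cong[OF refl], rule bex_cong[OF refl], rule conj_cong)
      fix x g assume xg: "x \<in> carrier H" "g \<in> carrier H"
      show "(D (\<gamma> x) \<or> (\<exists>y \<in> C. M (\<gamma> x) y (\<gamma> \<one>) \<and> D y)) = (x \<in> S \<or> inv x \<in> S)"
        using xg(1) by (simp only: inv D)
      show "(\<exists>u \<in> C. \<exists>v \<in> C. M (\<gamma> g) v u \<and> M (\<gamma> x) (\<gamma> g) u \<and>
          (\<exists>r \<in> C. rel_prod C M (\<gamma> \<one>) D n r \<and> M v r (\<gamma> w)))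
        = (\<exists>r \<in> C. rel_prod C M (\<gamma> \<one>) D n r \<and> M (\<gamma> (inv g \<otimes> x \<otimes> g)) r (\<gamma> w))"
        by (rule conj[OF xg])
    qed
  qed
  also have "\<dots> \<longleftrightarrow> (\<exists>x \<in> carrier H. \<exists>g \<in> carrier H. (x \<in> S \<or> inv x \<in> S) \<and>
      (\<exists>r \<in> carrier H. r \<in> conj_products H n S \<and> w = inv g \<otimes> x \<otimes> g \<otimes> r))"
    using Suc.IH Suc.prems unfolding Bex_C by (simp add: M_iff cong: bex_cong conj_cong)
  also have "\<dots> \<longleftrightarrow> w \<in> conj_products H (Suc n) S"
    unfolding conj_products_Suc using conj_products_closed by blast
  finally show ?case .
qed

end

text \<open>A homomorphism carries defects to defects and products of n conjugates to such products,
  so a violation in \<open>K\<close> would be one in \<open>H\<close>. This is how separation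
  descends to a subgroup.\<close>

lemma separated_pullback:
  assumes "group K" "group H" and f: "f \<in> hom K H" and \<phi>: "\<phi> \<in> \<Phi> \<rightarrow> carrier K" "Y \<subseteq> \<Phi>"
    and sep: "separated H n ((\<lambda>g. f (\<phi> g)) ` Y) (defects G H \<Phi> (\<lambda>g. f (\<phi> g)))"
  shows "separated K n (\<phi> ` Y) (defects G K \<Phi> \<phi>)"
proof -
  interpret K: group K by fact
  interpret H: group H by fact
  interpret group_hom K H f using f by unfold_locales
  have cl: "\<phi> g \<in> carrier K" if "g \<in> \<Phi>" for g using \<phi>(1) that by blast
  have d: "f s \<in> defects G H \<Phi> (\<lambda>g. f (\<phi> g))" if "s \<in> defects G K \<Phi> \<phi>" for s
    using that cl unfolding defects_def by fastforce
  have "f w \<in> conj_products H n (defects G H \<Phi> (\<lambda>g. f (\<phi> g)))"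
    if "w \<in> conj_products K n (defects G K \<Phi> \<phi>)" for w
  proof -
    obtain ps where ps: "w = foldr (\<otimes>\<^bsub>K\<^esub>) (map (\<lambda>(x, g). inv\<^bsub>K\<^esub> g \<otimes>\<^bsub>K\<^esub> x \<otimes>\<^bsub>K\<^esub> g) ps) \<one>\<^bsub>K\<^esub>"
      "length ps = n" "\<forall>(x, g) \<in> set ps. x \<in> carrier K \<and> g \<in> carrier K \<and>
        (x \<in> defects G K \<Phi> \<phi> \<or> inv\<^bsub>K\<^esub> x \<in> defects G K \<Phi> \<phi>)"
      using \<open>w \<in> _\<close> unfolding conj_products_def by blast
    let ?qs = "map (\<lambda>(x, g). (f x, f g)) ps"
    have "f (foldr (\<otimes>\<^bsub>K\<^esub>) (map (\<lambda>(x, g). inv\<^bsub>K\<^esub> g \<otimes>\<^bsub>K\<^esub> x \<otimes>\<^bsub>K\<^esub> g) ps) \<one>\<^bsub>K\<^esub>)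
       = foldr (\<otimes>\<^bsub>H\<^esub>) (map (\<lambda>(x, g). inv\<^bsub>H\<^esub> g \<otimes>\<^bsub>H\<^esub> x \<otimes>\<^bsub>H\<^esub> g) (map (\<lambda>(x, g). (f x, f g)) ps)) \<one>\<^bsub>H\<^esub> \<and>
       foldr (\<otimes>\<^bsub>K\<^esub>) (map (\<lambda>(x, g). inv\<^bsub>K\<^esub> g \<otimes>\<^bsub>K\<^esub> x \<otimes>\<^bsub>K\<^esub> g) ps) \<one>\<^bsub>K\<^esub> \<in> carrier K"
      if "\<forall>(x, g) \<in> set ps. x \<in> carrier K \<and> g \<in> carrier K" for ps
      using that by (induction ps) auto
    moreover have "\<forall>(x, g) \<in> set ps. x \<in> carrier K \<and> g \<in> carrier K" using ps(3) by auto
    ultimately have "f w = foldr (\<otimes>\<^bsub>H\<^esub>) (map (\<lambda>(x, g). inv\<^bsub>H\<^esub> g \<otimes>\<^bsub>H\<^esub> x \<otimes>\<^bsub>H\<^esub> g) ?qs) \<one>\<^bsub>H\<^esub>"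
      unfolding ps(1) by blast
    moreover have "\<forall>(x, g) \<in> set ?qs. x \<in> carrier H \<and> g \<in> carrier H \<and>
        (x \<in> defects G H \<Phi> (\<lambda>g. f (\<phi> g)) \<or> inv\<^bsub>H\<^esub> x \<in> defects G H \<Phi> (\<lambda>g. f (\<phi> g)))"
      using ps(3) d by (auto simp flip: hom_inv)
    ultimately show ?thesis using ps(2) unfolding conj_products_def
      by (intro CollectI exI[of _ ?qs]) simp
  qed
  then show ?thesis using sep unfolding separated_def by blast
qed

section \<open>Quantification over tuples\<close>

definition par :: "('f + nat \<times> 'i \<Rightarrow> 'c) \<Rightarrow> 'f \<Rightarrow> 'c" where
  "par e = (\<lambda>c. e (Inl c))"

definition tup :: "('f + nat \<times> 'i \<Rightarrow> 'c) \<Rightarrow> nat \<Rightarrow> 'i \<Rightarrow> 'c" where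
  "tup e j = (\<lambda>i. e (Inr (j, i)))"

definition set_tup :: "('f + nat \<times> 'i \<Rightarrow> 'c) \<Rightarrow> nat \<Rightarrow> ('i \<Rightarrow> 'c) \<Rightarrow> 'f + nat \<times> 'i \<Rightarrow> 'c" where
  "set_tup e j x = case_sum (par e) (\<lambda>(j', i). if j' = j then x i else tup e j' i)"

lemma par_set_tup [simp]: "par (set_tup e j x) = par e"
  by (simp add: par_def set_tup_def)

lemma tup_set_tup [simp]: "tup (set_tup e j x) j' = (if j' = j then x else tup e j')"
  by (auto simp: tup_def set_tup_def)

text \<open>The value zero outside \<open>I\<close> makes a tuple determined by its finitely many
  coordinates in \<open>I\<close>, so equality of tuples is a formula.\<close>

definition tuples :: "'c ring \<Rightarrow> 'i set \<Rightarrow> ('i \<Rightarrow> 'c) set" where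
  "tuples F I = {x. (\<forall>i \<in> I. x i \<in> carrier F) \<and> (\<forall>i. i \<notin> I \<longrightarrow> x i = \<zero>\<^bsub>F\<^esub>)}"

text \<open>Slot j of the environment holds the bound tuple; \<open>indep\<close> says that
  \<open>B\<close> reads this slot only through its last argument.\<close>

lemma upred_ex_tuple:
  fixes B :: "'c ring \<Rightarrow> ('f + nat \<times> 'i \<Rightarrow> 'c) \<Rightarrow> ('i \<Rightarrow> 'c) \<Rightarrow> bool"
  assumes "finite I" and up: "upred (\<lambda>F e. B F e (tup e j))"
    and indep: "\<And>F e x y. B F (set_tup e j x) y = B F e y"
  shows "upred (\<lambda>F e. \<exists>x \<in> tuples F I. B F e x)"
proof -
  define V where "V = (\<lambda>i. Inr (j, i) :: 'f + nat \<times> 'i) ` I"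
  \<comment> \<open>Quantifying the variables in \<open>V\<close> leaves the rest of slot j as it
    was; the substitution overwrites it by zero, as \<open>tuples\<close> demands.\<close>
  define s :: "'f + nat \<times> 'i \<Rightarrow> 'c ring \<Rightarrow> ('f + nat \<times> 'i \<Rightarrow> 'c) \<Rightarrow> 'c" where
    "s v = (case v of Inl c \<Rightarrow> (\<lambda>F e. e v)
      | Inr (j', i) \<Rightarrow> if j' = j \<and> i \<notin> I then (\<lambda>F e. \<zero>\<^bsub>F\<^esub>) else (\<lambda>F e. e v))" for v
  have V: "Inl c \<notin> V" "Inr (j', i) \<in> V \<longleftrightarrow> j' = j \<and> i \<in> I" for c j' i
    unfolding V_def by auto
  define Q where "Q F e \<longleftrightarrow> B F (\<lambda>v. s v F e) (tup (\<lambda>v. s v F e) j)" for F e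
  have "upred Q" unfolding Q_def[abs_def]
    by (rule upred_subst[OF up, of s]) (auto simp: s_def intro: uterm.intros split: sum.split)
  then have "upred (\<lambda>F e. \<exists>e'. range e' \<subseteq> carrier F \<and> (\<forall>v. v \<notin> V \<longrightarrow> e' v = e v) \<and> Q F e')"
    using assms(1) by (intro upred_exs) (simp add: V_def)
  then show ?thesis
  proof (rule upred.cong)
    fix F :: "'c ring" and e :: "'f + nat \<times> 'i \<Rightarrow> 'c" assume v: "valid F e"
    interpret acf F using v by (rule validD)
    have Q: "Q F e' = B F e x" if "\<forall>v. v \<notin> V \<longrightarrow> e' v = e v" "\<forall>i \<in> I. e' (Inr (j, i)) = x i"
      "x \<in> tuples F I" for e' x
    proof -
      have "(\<lambda>v. s v F e') = set_tup e j x"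
      proof
        fix v
        show "s v F e' = set_tup e j x v"
        proof (cases v)
          case (Inl c)
          then show ?thesis using that(1) V(1) by (simp add: s_def set_tup_def par_def)
        next
          case (Inr p)
          obtain j' i where p: "p = (j', i)" by (cases p)
          show ?thesis
          proof (cases "j' = j")
            case True
            then show ?thesis using that(2,3) unfolding Inr p
              by (simp add: s_def set_tup_def tuples_def)
          next
            case False
            then have "Inr (j', i) \<notin> V" using V(2) by blast
            then show ?thesis using that(1) False unfolding Inr p
              by (simp add: s_def set_tup_def tup_def)
          qed
        qed
      qed
      then show ?thesis unfolding Q_def by (simp add: indep)
    qed
    show "(\<exists>e'. range e' \<subseteq> carrier F \<and> (\<forall>v. v \<notin> V \<longrightarrow> e' v = e v) \<and> Q F e') = (\<exists>x \<in> tuples F I. B F e x)"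
    proof
      assume "\<exists>e'. range e' \<subseteq> carrier F \<and> (\<forall>v. v \<notin> V \<longrightarrow> e' v = e v) \<and> Q F e'"
      then obtain e' where e': "range e' \<subseteq> carrier F" "\<forall>v. v \<notin> V \<longrightarrow> e' v = e v" "Q F e'" by blast
      define x where "x i = (if i \<in> I then e' (Inr (j, i)) else \<zero>\<^bsub>F\<^esub>)" for i
      have x: "x \<in> tuples F I" using e'(1) by (auto simp: tuples_def x_def)
      have "B F e x" using Q[OF e'(2) _ x] e'(3) by (simp add: x_def)
      then show "\<exists>x \<in> tuples F I. B F e x" using x by blast
    next
      assume "\<exists>x \<in> tuples F I. B F e x"
      then obtain x where x: "x \<in> tuples F I" "B F e x" by blast
      define e' where "e' v = (if v \<in> V then (case v of Inl c \<Rightarrow> \<zero>\<^bsub>F\<^esub> | Inr (j, i) \<Rightarrow> x i) else e v)" for v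
      have "range e' \<subseteq> carrier F"
        using x(1) validD(3)[OF v] by (auto simp: e'_def V_def tuples_def)
      moreover have off: "\<forall>v. v \<notin> V \<longrightarrow> e' v = e v" by (simp add: e'_def)
      moreover have "\<forall>i \<in> I. e' (Inr (j, i)) = x i" by (simp add: e'_def V)
      then have "Q F e'" using Q[OF off _ x(1)] x(2) by blast
      ultimately show "\<exists>e'. range e' \<subseteq> carrier F \<and> (\<forall>v. v \<notin> V \<longrightarrow> e' v = e v) \<and> Q F e'" by blast
    qed
  qed
qed

text \<open>A uniformly definable set \<open>D\<close> of tuples with a uniformly definable ternary relation
  \<open>M\<close>, the graph of a multiplication in the fields of interest.\<close>

locale rel_system =
  fixes I :: "'i set" and D :: "'c ring \<Rightarrow> ('f \<Rightarrow> 'c) \<Rightarrow> ('i \<Rightarrow> 'c) \<Rightarrow> bool"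
    and M :: "'c ring \<Rightarrow> ('f \<Rightarrow> 'c) \<Rightarrow> ('i \<Rightarrow> 'c) \<Rightarrow> ('i \<Rightarrow> 'c) \<Rightarrow> ('i \<Rightarrow> 'c) \<Rightarrow> bool"
  assumes finite_I: "finite I"
    and D_upred: "upred (\<lambda>F e. D F (par e) (tup e 0))"
    and M_upred: "upred (\<lambda>F e. M F (par e) (tup e 0) (tup e 1) (tup e 2))"
begin

definition CC :: "'c ring \<Rightarrow> ('f \<Rightarrow> 'c) \<Rightarrow> ('i \<Rightarrow> 'c) set" where
  "CC F a = {x \<in> tuples F I. D F a x}"

text \<open>Elements of k serve as names of parameters: \<kappa> assigns a name to each coordinate,
  and \<open>a\<close> interprets the names in the field \<open>F\<close>. A point of the original
  group thus names a tuple in every field.\<close>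

definition const_tup :: "('i \<Rightarrow> 'f) \<Rightarrow> 'c ring \<Rightarrow> ('f \<Rightarrow> 'c) \<Rightarrow> 'i \<Rightarrow> 'c" where
  "const_tup \<kappa> F a = (\<lambda>i. if i \<in> I then a (\<kappa> i) else \<zero>\<^bsub>F\<^esub>)"

definition tterm :: "('c ring \<Rightarrow> ('f + nat \<times> 'i \<Rightarrow> 'c) \<Rightarrow> 'i \<Rightarrow> 'c) \<Rightarrow> bool" where
  "tterm \<tau> \<longleftrightarrow> (\<forall>i. (\<lambda>F e. \<tau> F e i) \<in> uterm)"

lemma tterm_tup: "tterm (\<lambda>F e. tup e j)"
  unfolding tterm_def tup_def by (auto intro: uterm.intros)

lemma tterm_const: "tterm (\<lambda>F e. const_tup \<kappa> F (par e))"
  unfolding tterm_def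
proof
  fix i
  show "(\<lambda>F e. const_tup \<kappa> F (par e) i) \<in> uterm"
    unfolding const_tup_def par_def by (cases "i \<in> I") (auto intro: uterm.intros)
qed

lemma M_tterm:
  assumes "tterm \<tau>\<^sub>0" "tterm \<tau>\<^sub>1" "tterm \<tau>\<^sub>2"
  shows "upred (\<lambda>F e. M F (par e) (\<tau>\<^sub>0 F e) (\<tau>\<^sub>1 F e) (\<tau>\<^sub>2 F e))"
proof -
  define s :: "'f + nat \<times> 'i \<Rightarrow> 'c ring \<Rightarrow> ('f + nat \<times> 'i \<Rightarrow> 'c) \<Rightarrow> 'c" where
    "s v = (case v of Inl c \<Rightarrow> (\<lambda>F e. e v)
      | Inr (j, i) \<Rightarrow> (\<lambda>F e. (if j = 0 then \<tau>\<^sub>0 else if j = 1 then \<tau>\<^sub>1 else \<tau>\<^sub>2) F e i))" for v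
  have "s v \<in> uterm" for v
    using assms unfolding s_def tterm_def by (auto intro: uterm.intros split: sum.split)
  from upred_subst[OF M_upred, where s = s, OF this] show ?thesis
    by (simp add: s_def par_def tup_def)
qed

lemma D_tterm:
  assumes "tterm \<tau>" shows "upred (\<lambda>F e. D F (par e) (\<tau> F e))"
proof -
  define s :: "'f + nat \<times> 'i \<Rightarrow> 'c ring \<Rightarrow> ('f + nat \<times> 'i \<Rightarrow> 'c) \<Rightarrow> 'c" where
    "s v = (case v of Inl c \<Rightarrow> (\<lambda>F e. e v) | Inr (j, i) \<Rightarrow> (\<lambda>F e. \<tau> F e i))" for v
  have "s v \<in> uterm" for v
    using assms unfolding s_def tterm_def by (auto intro: uterm.intros split: sum.split)
  from upred_subst[OF D_upred, where s = s, OF this] show ?thesis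
    by (simp add: s_def par_def tup_def)
qed

lemma upred_ex_CC:
  assumes "upred (\<lambda>F e. B F e (tup e j))" "\<And>F e x y. B F (set_tup e j x) y = B F e y"
  shows "upred (\<lambda>F e. \<exists>x \<in> CC F (par e). B F e x)"
proof -
  have "upred (\<lambda>F e. \<exists>x \<in> tuples F I. D F (par e) x \<and> B F e x)"
    using assms by (intro upred_ex_tuple[where j = j] finite_I upred.conj D_tterm tterm_tup) auto
  then show ?thesis unfolding CC_def by (simp add: Bex_def conj_assoc)
qed

lemma upred_all_CC:
  assumes "upred (\<lambda>F e. B F e (tup e j))" "\<And>F e x y. B F (set_tup e j x) y = B F e y"
  shows "upred (\<lambda>F e. \<forall>x \<in> CC F (par e). B F e x)"
  using upred.neg[OF upred_ex_CC[of "\<lambda>F e x. \<not> B F e x" j, OF upred.neg]] assms by simp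

lemma tuples_closed: "x \<in> tuples F I \<Longrightarrow> acf F \<Longrightarrow> x i \<in> carrier F"
proof -
  assume x: "x \<in> tuples F I" and "acf F"
  then interpret acf F by simp
  show ?thesis using x unfolding tuples_def by (cases "i \<in> I") auto
qed

definition tup_eq :: "('i \<Rightarrow> 'c) \<Rightarrow> ('i \<Rightarrow> 'c) \<Rightarrow> bool" where
  "tup_eq x y \<longleftrightarrow> (\<forall>i \<in> I. x i = y i)"

lemma tup_eq_iff: "x \<in> CC F a \<Longrightarrow> y \<in> CC F a \<Longrightarrow> tup_eq x y \<longleftrightarrow> x = y"
  unfolding tup_eq_def CC_def tuples_def by (auto intro!: ext)

lemma upred_const_mem: "upred (\<lambda>F (e :: 'f + nat \<times> 'i \<Rightarrow> 'c). const_tup \<kappa> F (par e) \<in> CC F (par e))"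
proof (rule upred.cong[OF D_tterm[OF tterm_const[of \<kappa>]]])
  fix F :: "'c ring" and e :: "'f + nat \<times> 'i \<Rightarrow> 'c" assume "valid F e"
  then have "const_tup \<kappa> F (par e) \<in> tuples F I"
    using validD(3) unfolding const_tup_def tuples_def par_def by auto
  then show "D F (par e) (const_tup \<kappa> F (par e)) = (const_tup \<kappa> F (par e) \<in> CC F (par e))"
    unfolding CC_def by simp
qed

lemma upred_tup_eq: "upred (\<lambda>F e. tup_eq (tup e i) (tup e j))"
  unfolding tup_eq_def tup_def by (intro upred_Ball finite_I upred_eq uterm.var)

lemma upred_rel_group:
  "upred (\<lambda>F (e :: 'f + nat \<times> 'i \<Rightarrow> 'c). rel_group (CC F (par e)) (M F (par e)) tup_eq (const_tup \<kappa> F (par e)))"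
proof -
  note M = M_tterm[OF tterm_tup tterm_tup tterm_tup] and Mc = M_tterm[OF tterm_const tterm_tup tterm_tup]
    M_tterm[OF tterm_tup tterm_tup tterm_const]
  have 1: "upred (\<lambda>F (e :: 'f + nat \<times> 'i \<Rightarrow> 'c). \<forall>x \<in> CC F (par e). \<forall>y \<in> CC F (par e). \<exists>z \<in> CC F (par e). M F (par e) x y z)"
    by (rule upred_all_CC[where j = 0], rule upred_all_CC[where j = 1], rule upred_ex_CC[where j = 2])
      (rule M, simp_all)
  have 2: "upred (\<lambda>F (e :: 'f + nat \<times> 'i \<Rightarrow> 'c). \<forall>x \<in> CC F (par e). \<forall>y \<in> CC F (par e). \<forall>z \<in> CC F (par e). \<forall>z' \<in> CC F (par e).
      M F (par e) x y z \<and> M F (par e) x y z' \<longrightarrow> tup_eq z z')"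
    by (rule upred_all_CC[where j = 0], rule upred_all_CC[where j = 1], rule upred_all_CC[where j = 2],
        rule upred_all_CC[where j = 3])
      (intro upred_imp upred.conj M upred_tup_eq, simp_all)
  have 3: "upred (\<lambda>F (e :: 'f + nat \<times> 'i \<Rightarrow> 'c). \<forall>x \<in> CC F (par e). \<forall>y \<in> CC F (par e). \<forall>z \<in> CC F (par e). \<forall>u \<in> CC F (par e).
      \<forall>v \<in> CC F (par e). \<forall>w \<in> CC F (par e).
      M F (par e) x y u \<and> M F (par e) u z w \<and> M F (par e) y z v \<longrightarrow> M F (par e) x v w)"
    by (rule upred_all_CC[where j = 0], rule upred_all_CC[where j = 1], rule upred_all_CC[where j = 2],
        rule upred_all_CC[where j = 3], rule upred_all_CC[where j = 4], rule upred_all_CC[where j = 5])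
      (intro upred_imp upred.conj M, simp_all)
  have 4: "upred (\<lambda>F (e :: 'f + nat \<times> 'i \<Rightarrow> 'c). \<forall>x \<in> CC F (par e). M F (par e) (const_tup \<kappa> F (par e)) x x)"
    by (rule upred_all_CC[where j = 0]) (rule Mc, simp_all)
  have 5: "upred (\<lambda>F (e :: 'f + nat \<times> 'i \<Rightarrow> 'c). \<forall>x \<in> CC F (par e). \<exists>y \<in> CC F (par e). M F (par e) y x (const_tup \<kappa> F (par e)))"
    by (rule upred_all_CC[where j = 0], rule upred_ex_CC[where j = 1]) (rule Mc, simp_all)
  show ?thesis unfolding rel_group_def
    by (intro upred.conj upred_const_mem 1 2 3 4 5)
qed

lemma upred_rel_defect:
  assumes "finite J" "tterm \<tau>" "\<And>F e x. \<tau> F (set_tup e 0 x) = \<tau> F e"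
  shows "upred (\<lambda>F e. rel_defect (CC F (par e)) (M F (par e)) (\<lambda>g. const_tup (c g) F (par e)) J (\<tau> F e))"
  unfolding rel_defect_def
proof (rule upred_Bex[OF assms(1)])
  fix p
  show "upred (\<lambda>F e. \<exists>u \<in> CC F (par e).
      M F (par e) (const_tup (c (fst p)) F (par e)) (const_tup (c (fst (snd p))) F (par e)) u \<and>
      M F (par e) (\<tau> F e) (const_tup (c (snd (snd p))) F (par e)) u)"
    by (rule upred_ex_CC[where j = 0])
      (intro upred.conj M_tterm tterm_const tterm_tup assms(2), simp add: assms(3))
qed

lemma upred_rel_prod:
  assumes J: "finite J"
  shows "upred (\<lambda>F e. rel_prod (CC F (par e)) (M F (par e)) (const_tup \<kappa> F (par e))
     (rel_defect (CC F (par e)) (M F (par e)) (\<lambda>g. const_tup (c g) F (par e)) J) n (tup e j))"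
proof (induction n arbitrary: j)
  case 0
  show ?case unfolding rel_prod.simps by (intro M_tterm tterm_tup tterm_const)
next
  case (Suc n)
  let ?D = "\<lambda>F e. rel_defect (CC F (par e)) (M F (par e)) (\<lambda>g. const_tup (c g) F (par e)) J"
  have D: "upred (\<lambda>F e. ?D F e (tup e (Suc i)))" for i
    by (rule upred_rel_defect[OF J tterm_tup]) simp
  \<comment> \<open>Fresh slots are taken above j, so that the argument in slot j survives. They are
    positive because slot 0 is occupied by the quantifier inside \<open>rel_defect\<close>.\<close>
  define m where "m = Suc j"
  have m: "j < m" "0 < m" unfolding m_def by simp_all
  show ?case unfolding rel_prod.simps
  proof (rule upred_ex_CC[where j = m], rule upred_ex_CC[where j = "m + 1"], intro upred.conj upred_disj)
    show "upred (\<lambda>F e. ?D F e (tup e m))" using D[of j] unfolding m_def .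
    show "upred (\<lambda>F e. \<exists>y \<in> CC F (par e). M F (par e) (tup e m) y (const_tup \<kappa> F (par e)) \<and> ?D F e y)"
      by (rule upred_ex_CC[where j = "m + 2"])
        (intro upred.conj M_tterm tterm_tup tterm_const, use D[of "m + 1"] m in \<open>simp_all\<close>)
    show "upred (\<lambda>F e. \<exists>u \<in> CC F (par e). \<exists>v \<in> CC F (par e).
        M F (par e) (tup e (m + 1)) v u \<and> M F (par e) (tup e m) (tup e (m + 1)) u \<and>
        (\<exists>r \<in> CC F (par e). rel_prod (CC F (par e)) (M F (par e)) (const_tup \<kappa> F (par e)) (?D F e) n r \<and>
          M F (par e) v r (tup e j)))"
    proof (rule upred_ex_CC[where j = "m + 2"], rule upred_ex_CC[where j = "m + 3"], intro upred.conj)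
      show "upred (\<lambda>F e. M F (par e) (tup e (m + 1)) (tup e (m + 3)) (tup e (m + 2)))"
        "upred (\<lambda>F e. M F (par e) (tup e m) (tup e (m + 1)) (tup e (m + 2)))"
        by (intro M_tterm tterm_tup)+
      show "upred (\<lambda>F e. \<exists>r \<in> CC F (par e). rel_prod (CC F (par e)) (M F (par e)) (const_tup \<kappa> F (par e)) (?D F e) n r \<and>
          M F (par e) (tup e (m + 3)) r (tup e j))"
        by (rule upred_ex_CC[where j = "m + 4"])
          (intro upred.conj M_tterm tterm_tup Suc.IH, use m in simp_all)
    qed (use m in simp_all)
  qed (use m in simp_all)
qed

lemma M_hom:
  assumes "acf F" "range a \<subseteq> carrier F" "x \<in> tuples F I" "y \<in> tuples F I" "z \<in> tuples F I"
    and "\<sigma> \<in> ring_hom F F"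
  shows "M F (\<sigma> \<circ> a) (\<sigma> \<circ> x) (\<sigma> \<circ> y) (\<sigma> \<circ> z) = M F a x y z"
proof -
  define e where "e = case_sum a (\<lambda>(j :: nat, i). (if j = 0 then x else if j = 1 then y else z) i)"
  have "valid F e" unfolding valid_def e_def
    using assms tuples_closed[OF _ assms(1)] range_subsetD[OF assms(2)] by (auto split: sum.splits)
  from upred_hom[OF M_upred this assms(1,6)] show ?thesis
    by (simp add: e_def par_def tup_def comp_def)
qed

lemma D_hom:
  assumes "acf F" "range a \<subseteq> carrier F" "x \<in> tuples F I" "\<sigma> \<in> ring_hom F F"
  shows "D F (\<sigma> \<circ> a) (\<sigma> \<circ> x) = D F a x"
proof -
  define e where "e = case_sum a (\<lambda>(j :: nat, i). x i)"
  have "valid F e" unfolding valid_def e_def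
    using assms tuples_closed[OF _ assms(1)] range_subsetD[OF assms(2)] by (auto split: sum.splits)
  from upred_hom[OF D_upred this assms(1,4)] show ?thesis
    by (simp add: e_def par_def tup_def comp_def)
qed

end

section \<open>Finite models\<close>

text \<open>The formulas may mention any slot. Renaming all slots to 0, or to 0, 1 and 2, leaves
  predicates of exactly one tuple and of exactly three tuples.\<close>

lemma (in coded_group) rel_system_of_kdef:
  assumes "kdef PD" "kdef PM"
  obtains D M where "rel_system ix D M"
    "\<And>w :: nat \<Rightarrow> _. ok w \<Longrightarrow> D k' base_par (\<lambda>i. h (w 0 i)) = PD (\<lambda>_. w 0)"
    "\<And>w :: nat \<Rightarrow> _. ok w \<Longrightarrow> M k' base_par (\<lambda>i. h (w 0 i)) (\<lambda>i. h (w 1 i)) (\<lambda>i. h (w 2 i)) =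
       PM (\<lambda>j. if j = 0 then w 0 else if j = 1 then w 1 else w 2)"
proof -
  obtain RD where RD: "upred RD" "\<And>w. ok w \<Longrightarrow> RD k' (kenv w) = PD w"
    using assms(1) unfolding kdef_def by blast
  obtain RM where RM: "upred RM" "\<And>w. ok w \<Longrightarrow> RM k' (kenv w) = PM w"
    using assms(2) unfolding kdef_def by blast
  define D where "D F a x = RD F (case_sum a (\<lambda>(j :: nat, i). x i))"
    for F :: "'c ring" and a :: "'f \<Rightarrow> 'c" and x
  define M where "M F a x y z = RM F (case_sum a (\<lambda>(j :: nat, i). (if j = 0 then x else if j = 1 then y else z) i))"
    for F :: "'c ring" and a :: "'f \<Rightarrow> 'c" and x y z
  have up: "upred (\<lambda>F (e :: 'f + nat \<times> ('x, 'f) chart \<times> nat \<Rightarrow> 'c). RD F (\<lambda>v. e (case v of Inl c \<Rightarrow> Inl c | Inr (j, i) \<Rightarrow> Inr (0, i))))"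
    by (rule upred_subst[OF RD(1)]) (rule uterm.var)
  have eq: "(\<lambda>v. e (case v of Inl c \<Rightarrow> Inl c | Inr (j, i) \<Rightarrow> Inr (0, i))) =
      case_sum (par e) (\<lambda>(j :: nat, i). tup e 0 i)" for e :: "'f + nat \<times> ('x, 'f) chart \<times> nat \<Rightarrow> 'c"
    by (rule ext) (auto simp: par_def tup_def split: sum.split)
  have D: "upred (\<lambda>F e. D F (par e) (tup e 0))" unfolding D_def using up[unfolded eq] .
  have up: "upred (\<lambda>F (e :: 'f + nat \<times> ('x, 'f) chart \<times> nat \<Rightarrow> 'c). RM F (\<lambda>v. e (case v of Inl c \<Rightarrow> Inl c
      | Inr (j, i) \<Rightarrow> Inr (if j = 0 then 0 else if j = 1 then 1 else 2, i))))"
    by (rule upred_subst[OF RM(1)]) (rule uterm.var)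
  have eq: "(\<lambda>v. e (case v of Inl c \<Rightarrow> Inl c
      | Inr (j, i) \<Rightarrow> Inr (if j = 0 then 0 else if j = 1 then 1 else 2, i))) =
      case_sum (par e) (\<lambda>(j :: nat, i). (if j = 0 then tup e 0 else if j = 1 then tup e 1 else tup e 2) i)"
    for e :: "'f + nat \<times> ('x, 'f) chart \<times> nat \<Rightarrow> 'c"
    by (rule ext) (auto simp: par_def tup_def split: sum.split)
  have M: "upred (\<lambda>F e. M F (par e) (tup e 0) (tup e 1) (tup e 2))" unfolding M_def using up[unfolded eq] .
  show ?thesis
  proof (rule that)
    show "rel_system ix D M" by unfold_locales (rule finite_ix, rule D, rule M)
  next
    fix w :: "nat \<Rightarrow> ('x, 'f) chart \<times> nat \<Rightarrow> 'f" assume w: "ok w"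
    have "ok (\<lambda>_. w 0)" using w by (simp add: ok_def)
    from RD(2)[OF this] show "D k' base_par (\<lambda>i. h (w 0 i)) = PD (\<lambda>_. w 0)"
      by (simp add: D_def kenv_def)
    let ?w = "\<lambda>j. if j = 0 then w 0 else if j = 1 then w 1 else w 2"
    have "ok ?w" using w by (simp add: ok_def)
    from RM(2)[OF this] have "RM k' (kenv ?w) = PM ?w" .
    moreover have "kenv ?w =
      case_sum base_par (\<lambda>(j :: nat, i). (if j = 0 then (\<lambda>i. h (w 0 i)) else if j = 1 then (\<lambda>i. h (w 1 i)) else (\<lambda>i. h (w 2 i))) i)"
      by (rule ext) (auto simp: kenv_def split: sum.split)
    ultimately show "M k' base_par (\<lambda>i. h (w 0 i)) (\<lambda>i. h (w 1 i)) (\<lambda>i. h (w 2 i)) = PM ?w"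
      unfolding M_def by (simp only:)
  qed
qed

lemma (in coded_group) exists_rel_system:
  obtains D M where "rel_system ix D M"
    "rel_system.CC ix D k' base_par = (\<lambda>x i. h (code x i)) ` carrier H"
    "\<And>x y z. x \<in> carrier H \<Longrightarrow> y \<in> carrier H \<Longrightarrow> z \<in> carrier H \<Longrightarrow>
      M k' base_par (\<lambda>i. h (code x i)) (\<lambda>i. h (code y i)) (\<lambda>i. h (code z i)) \<longleftrightarrow> z = x \<otimes>\<^bsub>H\<^esub> y"
proof -
  obtain PD where PD: "kdef PD" "\<forall>w. ok w \<longrightarrow> (\<forall>i. i \<notin> ix \<longrightarrow> w 0 i = \<zero>) \<longrightarrow> PD w = (w 0 \<in> code ` carrier H)"
    using code_image_kdef by blast
  obtain PM where PM: "kdef PM" "\<forall>w x y z. ok w \<longrightarrow> x \<in> carrier H \<longrightarrow> y \<in> carrier H \<longrightarrow> z \<in> carrier H \<longrightarrow>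
     w 0 = code x \<longrightarrow> w 1 = code y \<longrightarrow> w 2 = code z \<longrightarrow> PM w = (z = x \<otimes>\<^bsub>H\<^esub> y)"
    using code_mult_kdef by blast
  obtain D M where sys: "rel_system ix D M"
    and D: "\<And>w :: nat \<Rightarrow> _. ok w \<Longrightarrow> D k' base_par (\<lambda>i. h (w 0 i)) = PD (\<lambda>_. w 0)"
    and M: "\<And>w :: nat \<Rightarrow> _. ok w \<Longrightarrow> M k' base_par (\<lambda>i. h (w 0 i)) (\<lambda>i. h (w 1 i)) (\<lambda>i. h (w 2 i)) =
       PM (\<lambda>j. if j = 0 then w 0 else if j = 1 then w 1 else w 2)"
    using rel_system_of_kdef[OF PD(1) PM(1)] by blast
  interpret rel_system ix D M by (rule sys)
  have D': "D k' base_par (\<lambda>i. h (u i)) \<longleftrightarrow> u \<in> code ` carrier H"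
    if "\<And>i. u i \<in> carrier k" "\<And>i. i \<notin> ix \<Longrightarrow> u i = \<zero>" for u
  proof -
    have ok: "ok (\<lambda>_. u)" using that(1) by (simp add: ok_def)
    show ?thesis using D[OF ok] PD(2) ok that(2) by simp
  qed
  have code_ok: "D k' base_par (\<lambda>i. h (code x i))" if "x \<in> carrier H" for x
    using D'[of "code x"] code_closed code_outside that by blast
  have "CC k' base_par = (\<lambda>x i. h (code x i)) ` carrier H"
  proof
    show "CC k' base_par \<subseteq> (\<lambda>x i. h (code x i)) ` carrier H"
    proof
      fix t assume "t \<in> CC k' base_par"
      then have t: "t \<in> tuples k' ix" "D k' base_par t" unfolding CC_def by blast+
      define u where "u i = inv_into (carrier k) h (t i)" for i
      have ti: "t i \<in> h ` carrier k" for i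
        using tuples_closed[OF t(1) k'_facts(1)] k'_facts(3) by simp
      have tu: "t = (\<lambda>i. h (u i))" unfolding u_def using ti by (simp add: f_inv_into_f)
      have uc: "u i \<in> carrier k" for i unfolding u_def using ti by (rule inv_into_into)
      have uz: "u i = \<zero>" if "i \<notin> ix" for i
      proof -
        have "t i = h \<zero>" using t(1) that unfolding tuples_def h_zero(1) by blast
        then show ?thesis unfolding u_def by (simp only: inv_into_f_f[OF inj_h zero_closed])
      qed
      have "u \<in> code ` carrier H" using D'[OF uc uz] t(2) unfolding tu by simp
      then show "t \<in> (\<lambda>x i. h (code x i)) ` carrier H" unfolding tu by blast
    qed
    show "(\<lambda>x i. h (code x i)) ` carrier H \<subseteq> CC k' base_par"
    proof
      fix t assume "t \<in> (\<lambda>x i. h (code x i)) ` carrier H"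
      then obtain x where x: "x \<in> carrier H" "t = (\<lambda>i. h (code x i))" by blast
      have "t \<in> tuples k' ix" unfolding x(2) tuples_def
        using code_closed code_outside k'_facts(3) h_zero by auto
      then show "t \<in> CC k' base_par" unfolding CC_def using code_ok x by simp
    qed
  qed
  moreover have "M k' base_par (\<lambda>i. h (code x i)) (\<lambda>i. h (code y i)) (\<lambda>i. h (code z i)) \<longleftrightarrow> z = x \<otimes>\<^bsub>H\<^esub> y"
    if xyz: "x \<in> carrier H" "y \<in> carrier H" "z \<in> carrier H" for x y z
  proof -
    let ?w = "\<lambda>j :: nat. if j = 0 then code x else if j = 1 then code y else code z"
    have ok: "ok ?w" using code_closed by (simp add: ok_def)
    have "PM ?w = (z = x \<otimes>\<^bsub>H\<^esub> y)" using PM(2)[rule_format, OF ok xyz] by simp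
    then show ?thesis using M[OF ok] by simp
  qed
  ultimately show ?thesis using that sys by blast
qed

context rel_system
begin

lemma rel_monoid_CC:
  assumes grp: "rel_group (CC F a) (M F a) tup_eq e"
  shows "group (rel_monoid (CC F a) (M F a) e)"
    and "\<And>x y z. x \<in> CC F a \<Longrightarrow> y \<in> CC F a \<Longrightarrow> z \<in> CC F a \<Longrightarrow>
      M F a x y z \<longleftrightarrow> z = x \<otimes>\<^bsub>rel_monoid (CC F a) (M F a) e\<^esub> y"
proof -
  show "group (rel_monoid (CC F a) (M F a) e)"
    by (rule rel_monoid_group(1)[OF grp]) (rule tup_eq_iff)
  show "M F a x y z \<longleftrightarrow> z = x \<otimes>\<^bsub>rel_monoid (CC F a) (M F a) e\<^esub> y"
    if "x \<in> CC F a" "y \<in> CC F a" "z \<in> CC F a" for x y z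
    by (rule rel_monoid_group(2)[OF grp _ that]) (rule tup_eq_iff)
qed

text \<open>As \<sigma> fixes the parameters, it preserves the definable set and the graph of its
  multiplication, and so acts on the group by a homomorphism. Coordinates of a fixed point lie in
  the finite fixed set of \<sigma>, and tuples of parameters are fixed.\<close>

lemma fixed_subgroup:
  assumes F: "acf F" and a: "range a \<subseteq> carrier F" and \<sigma>: "\<sigma> \<in> ring_hom F F" "\<sigma> \<circ> a = a"
    and fin: "finite {x \<in> carrier F. \<sigma> x = x}"
    and grp: "rel_group (CC F a) (M F a) tup_eq (const_tup \<kappa> F a)"
  defines "G \<equiv> rel_monoid (CC F a) (M F a) (const_tup \<kappa> F a)"
    and "U \<equiv> {x \<in> CC F a. \<sigma> \<circ> x = x}"
  shows "group G" "subgroup U G" "finite U" "\<And>\<mu>. const_tup \<mu> F a \<in> CC F a \<Longrightarrow> const_tup \<mu> F a \<in> U"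
proof -
  interpret acf F by fact
  note G = rel_monoid_CC[OF grp, folded G_def]
  show "group G" by (rule G(1))
  interpret G: group G by (rule G(1))
  have carG: "carrier G = CC F a" and oneG: "\<one>\<^bsub>G\<^esub> = const_tup \<kappa> F a"
    unfolding G_def rel_monoid_def by simp_all
  have \<sigma>0: "\<sigma> \<zero>\<^bsub>F\<^esub> = \<zero>\<^bsub>F\<^esub>" by (rule ring_hom_zero[OF \<sigma>(1) ring_axioms ring_axioms])
  have \<sigma>c: "\<sigma> \<circ> x \<in> CC F a" if "x \<in> CC F a" for x
  proof -
    have x: "x \<in> tuples F I" "D F a x" using that unfolding CC_def by blast+
    have "\<sigma> \<circ> x \<in> tuples F I" using x(1) \<sigma>0 ring_hom_closed[OF \<sigma>(1)] unfolding tuples_def by simp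
    then show ?thesis using D_hom[OF F a x(1) \<sigma>(1)] x(2) unfolding CC_def \<sigma>(2) by simp
  qed
  have \<sigma>M: "M F a (\<sigma> \<circ> x) (\<sigma> \<circ> y) (\<sigma> \<circ> z) = M F a x y z"
    if "x \<in> CC F a" "y \<in> CC F a" "z \<in> CC F a" for x y z
    using M_hom[OF F a _ _ _ \<sigma>(1), of x y z] that unfolding CC_def \<sigma>(2) by simp
  have \<sigma>mult: "\<sigma> \<circ> (x \<otimes>\<^bsub>G\<^esub> y) = (\<sigma> \<circ> x) \<otimes>\<^bsub>G\<^esub> (\<sigma> \<circ> y)" if xy: "x \<in> CC F a" "y \<in> CC F a" for x y
  proof -
    have z: "x \<otimes>\<^bsub>G\<^esub> y \<in> CC F a" using G.m_closed xy carG by simp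
    have "M F a x y (x \<otimes>\<^bsub>G\<^esub> y)" using G(2)[OF xy z] by simp
    then have "M F a (\<sigma> \<circ> x) (\<sigma> \<circ> y) (\<sigma> \<circ> (x \<otimes>\<^bsub>G\<^esub> y))" using \<sigma>M[OF xy z] by simp
    then show ?thesis using G(2)[OF \<sigma>c[OF xy(1)] \<sigma>c[OF xy(2)] \<sigma>c[OF z]] by simp
  qed
  show const: "const_tup \<mu> F a \<in> U" if "const_tup \<mu> F a \<in> CC F a" for \<mu>
  proof -
    have "\<sigma> (a c) = a c" for c using fun_cong[OF \<sigma>(2), of c] by simp
    then have "\<sigma> \<circ> const_tup \<mu> F a = const_tup \<mu> F a"
      using \<sigma>0 by (auto simp: const_tup_def)
    then show ?thesis using that unfolding U_def by simp
  qed
  show "subgroup U G"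
  proof (rule G.subgroupI)
    show "U \<subseteq> carrier G" unfolding U_def carG by blast
    have "\<one>\<^bsub>G\<^esub> \<in> U" using const[of \<kappa>] G.one_closed unfolding oneG carG by blast
    then show "U \<noteq> {}" by blast
    fix x assume x: "x \<in> U"
    then have xC: "x \<in> CC F a" "\<sigma> \<circ> x = x" unfolding U_def by blast+
    show "inv\<^bsub>G\<^esub> x \<in> U"
    proof -
      have i: "inv\<^bsub>G\<^esub> x \<in> CC F a" using G.inv_closed[of x] xC carG by simp
      have "(\<sigma> \<circ> inv\<^bsub>G\<^esub> x) \<otimes>\<^bsub>G\<^esub> x = \<sigma> \<circ> (inv\<^bsub>G\<^esub> x \<otimes>\<^bsub>G\<^esub> x)"
        using \<sigma>mult[OF i xC(1)] xC(2) by simp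
      also have "\<dots> = \<one>\<^bsub>G\<^esub>" using \<open>\<one>\<^bsub>G\<^esub> \<in> U\<close> xC(1) carG unfolding U_def by simp
      \<comment> \<open>The image of the inverse of x is also a left inverse of x, and inverses are
        unique.\<close>
      finally have "inv\<^bsub>G\<^esub> x = \<sigma> \<circ> inv\<^bsub>G\<^esub> x"
        using G.inv_equality[of "\<sigma> \<circ> inv\<^bsub>G\<^esub> x" x] \<sigma>c[OF i] xC(1) carG by simp
      then show ?thesis using i unfolding U_def by simp
    qed
    fix y assume "y \<in> U"
    then have yC: "y \<in> CC F a" "\<sigma> \<circ> y = y" unfolding U_def by blast+
    show "x \<otimes>\<^bsub>G\<^esub> y \<in> U"
      using \<sigma>mult[OF xC(1) yC(1)] xC yC G.m_closed[of x y] carG unfolding U_def by simp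
  qed
  have "U \<subseteq> {x. \<forall>i. (i \<in> I \<longrightarrow> x i \<in> {x \<in> carrier F. \<sigma> x = x}) \<and> (i \<notin> I \<longrightarrow> x i = \<zero>\<^bsub>F\<^esub>)}"
    unfolding U_def CC_def tuples_def by (auto dest: fun_cong)
  then show "finite U"
    using finite_set_of_finite_funs[OF finite_I fin] by (rule finite_subset)
qed

end

text \<open>One given approximation in an algebraic group is described by one formula
  \<open>S\<close>; a model of it over a locally finite field yields a finite group with a map from
  \<Phi> that has the same properties.\<close>

lemma algebraic_group_finite_model:
  fixes k :: "'f ring" and H :: "'h monoid" and G :: "'g monoid"
  assumes k: "algebraically_closed k" and H: "algebraic_group k H"
    and \<Phi>: "finite \<Phi>" and \<phi>: "\<phi> \<in> \<Phi> \<rightarrow> carrier H" "\<one>\<^bsub>G\<^esub> \<in> \<Phi> \<longrightarrow> \<phi> \<one>\<^bsub>G\<^esub> = \<one>\<^bsub>H\<^esub>"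
    and sep: "separated H n (\<phi> ` (\<Phi> - {\<one>\<^bsub>G\<^esub>})) (defects G H \<Phi> \<phi>)"
  shows "\<exists>K \<in> Fin. \<exists>\<psi>. \<psi> \<in> \<Phi> \<rightarrow> carrier K \<and> (\<one>\<^bsub>G\<^esub> \<in> \<Phi> \<longrightarrow> \<psi> \<one>\<^bsub>G\<^esub> = \<one>\<^bsub>K\<^esub>) \<and>
           separated K n (\<psi> ` (\<Phi> - {\<one>\<^bsub>G\<^esub>})) (defects G K \<Phi> \<psi>)"
proof -
  obtain A where A: "variety k (carrier H) A" "morphism k (product_atlas A A) A (\<lambda>(x, y). x \<otimes>\<^bsub>H\<^esub> y)"
    and grpH: "group H" using H unfolding algebraic_group_def by blast
  interpret acf k using k by (rule algebraically_closed_imp_acf)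
  interpret H: group H by fact
  \<comment> \<open>The field k occupies the left summand of the common type; the right summand is
    reserved for the closures of prime fields.\<close>
  interpret coded_group k "Inl :: 'f \<Rightarrow> 'f + ((int list \<times> nat) multiset \<Rightarrow> int)" H A
    by unfold_locales (use A in \<open>auto simp: inj_on_def\<close>)
  define \<gamma> where "\<gamma> x = (\<lambda>i. Inl (code x i) :: 'f + ((int list \<times> nat) multiset \<Rightarrow> int))" for x
  obtain D M where sys: "rel_system ix D M"
    and C: "rel_system.CC ix D k' base_par = \<gamma> ` carrier H"
    and M: "\<And>x y z. x \<in> carrier H \<Longrightarrow> y \<in> carrier H \<Longrightarrow> z \<in> carrier H \<Longrightarrow>
      M k' base_par (\<gamma> x) (\<gamma> y) (\<gamma> z) \<longleftrightarrow> z = x \<otimes>\<^bsub>H\<^esub> y"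
    using exists_rel_system unfolding \<gamma>_def by blast
  interpret rel_system ix D M by (rule sys)
  have inj_\<gamma>: "inj_on \<gamma> (carrier H)"
    using code_inj unfolding inj_on_def \<gamma>_def by (auto simp: fun_eq_iff)
  interpret gc: group_coding H \<gamma> "CC k' base_par" "M k' base_par"
    by unfold_locales (rule C, rule inj_\<gamma>, rule M)
  \<comment> \<open>Over k itself every parameter is interpreted by its own value, so the tuple
    named by the code of x is the code of x.\<close>
  have const: "const_tup (code x) k' base_par = \<gamma> x" for x
    unfolding const_tup_def \<gamma>_def using code_closed code_outside h_zero
    by (auto simp: base_par_def)
  define J where "J = {(g, h, g \<otimes>\<^bsub>G\<^esub> h) | g h. g \<in> \<Phi> \<and> h \<in> \<Phi> \<and> g \<otimes>\<^bsub>G\<^esub> h \<in> \<Phi>}"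
  have "J \<subseteq> \<Phi> \<times> \<Phi> \<times> \<Phi>" unfolding J_def by blast
  then have J: "finite J" using \<Phi> by (meson finite_SigmaI finite_subset)
  let ?e = "code \<one>\<^bsub>H\<^esub>" and ?c = "\<lambda>g. code (\<phi> g)"
  define bad where "bad F a = rel_prod (CC F a) (M F a) (const_tup ?e F a)
     (rel_defect (CC F a) (M F a) (\<lambda>g. const_tup (?c g) F a) J) n" for F a
  \<comment> \<open>The clauses say that the relation is a group law with the named unit, that the
    named elements belong to the group, and that the names of non-identity elements of \<Phi> avoid
    \<open>bad\<close>. The last clause goes through a bound tuple x equal to the named one, because
    \<open>bad\<close> is known to be a formula in the slots of the environment.\<close>
  define S where "S = (\<lambda>F (e :: 'f + nat \<times> ('h, 'f) chart \<times> nat \<Rightarrow> 'f + ((int list \<times> nat) multiset \<Rightarrow> int)).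
     rel_group (CC F (par e)) (M F (par e)) tup_eq (const_tup ?e F (par e)) \<and>
     (\<forall>g \<in> \<Phi>. const_tup (?c g) F (par e) \<in> CC F (par e)) \<and>
     (\<forall>g \<in> \<Phi> - {\<one>\<^bsub>G\<^esub>}. \<forall>x \<in> CC F (par e). tup_eq x (const_tup (?c g) F (par e)) \<longrightarrow> \<not> bad F (par e) x))"
  have "upred S"
    unfolding S_def
  proof (intro upred.conj upred_rel_group upred_Ball[OF \<Phi>] upred_const_mem)
    have "upred (\<lambda>F e. tup_eq (tup e 0) (const_tup (?c g) F (par e)))" for g
      unfolding tup_eq_def
      using tterm_tup tterm_const unfolding tterm_def by (intro upred_Ball finite_I upred_eq) blast+
    then show "upred (\<lambda>F (e :: 'f + nat \<times> ('h, 'f) chart \<times> nat \<Rightarrow> 'f + ((int list \<times> nat) multiset \<Rightarrow> int)).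
        \<forall>g \<in> \<Phi> - {\<one>\<^bsub>G\<^esub>}. \<forall>x \<in> CC F (par e). tup_eq x (const_tup (?c g) F (par e)) \<longrightarrow> \<not> bad F (par e) x)"
      unfolding bad_def using \<Phi> J
      by (intro upred_Ball upred_all_CC[where j = 0] upred_imp upred.neg upred_rel_prod) simp_all
  qed
  have bad_k: "bad k' base_par (\<gamma> x) \<longleftrightarrow> x \<in> conj_products H n (defects G H \<Phi> \<phi>)" if "x \<in> carrier H" for x
    unfolding bad_def const using that
    by (intro gc.rel_prod_iff gc.rel_defect_iff[OF \<phi>(1) _ J_def])
  define e0 where "e0 = kenv (\<lambda>_ (_ :: ('h, 'f) chart \<times> nat). \<zero>\<^bsub>k\<^esub>)"
  have e0: "valid k' e0" "par e0 = base_par"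
    unfolding e0_def by (rule valid_kenv, simp add: ok_def) (simp add: kenv_def par_def)
  have "S k' e0"
    unfolding S_def e0(2) const
  proof (intro conjI ballI impI)
    show "rel_group (CC k' base_par) (M k' base_par) tup_eq (\<gamma> \<one>\<^bsub>H\<^esub>)"
      by (rule gc.rel_group) (rule tup_eq_iff)
    show \<gamma>C: "\<gamma> (\<phi> g) \<in> CC k' base_par" if "g \<in> \<Phi>" for g unfolding C using that \<phi>(1) by blast
    fix g x assume g: "g \<in> \<Phi> - {\<one>\<^bsub>G\<^esub>}" and x: "x \<in> CC k' base_par" "tup_eq x (\<gamma> (\<phi> g))"
    then have "x = \<gamma> (\<phi> g)" using tup_eq_iff[OF x(1) \<gamma>C] by blast
    moreover have "\<phi> g \<notin> conj_products H n (defects G H \<Phi> \<phi>)"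
      using sep g unfolding separated_def by blast
    moreover have "\<phi> g \<in> carrier H" using \<phi>(1) g by blast
    ultimately show "\<not> bad k' base_par x" using bad_k by simp
  qed
  then obtain L e \<sigma> where L: "valid L e" "S L e" "\<sigma> \<in> ring_hom L L" "\<sigma> \<circ> e = e"
    "finite {x \<in> carrier L. \<sigma> x = x}"
    using transfer_to_locally_finite[OF \<open>upred S\<close> e0(1) _ inj_Inr] by blast
  define a where "a = par e"
  have a: "range a \<subseteq> carrier L" "\<sigma> \<circ> a = a"
    using validD(3)[OF L(1)] fun_cong[OF L(4)] unfolding a_def par_def by (auto simp: fun_eq_iff)
  have grp: "rel_group (CC L a) (M L a) tup_eq (const_tup ?e L a)"
    and c_mem: "\<And>g. g \<in> \<Phi> \<Longrightarrow> const_tup (?c g) L a \<in> CC L a"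
    and not_bad: "\<And>g x. g \<in> \<Phi> - {\<one>\<^bsub>G\<^esub>} \<Longrightarrow> x \<in> CC L a \<Longrightarrow> tup_eq x (const_tup (?c g) L a) \<Longrightarrow> \<not> bad L a x"
    using L(2) unfolding S_def a_def by blast+
  define N where "N = rel_monoid (CC L a) (M L a) (const_tup ?e L a)"
  define U where "U = {x \<in> CC L a. \<sigma> \<circ> x = x}"
  define c where "c g = const_tup (?c g) L a" for g
  note fs = fixed_subgroup[OF validD(1)[OF L(1)] a(1) L(3) a(2) L(5) grp, folded N_def U_def]
  interpret N: group N by (rule fs(1))
  have N_simps: "carrier N = CC L a" "\<one>\<^bsub>N\<^esub> = const_tup ?e L a"
    unfolding N_def rel_monoid_def by simp_all
  interpret nc: group_coding N "\<lambda>x. x" "CC L a" "M L a"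
    by unfold_locales (use rel_monoid_CC(2)[OF grp, folded N_def] N_simps in auto)
  have cU: "c g \<in> U" if "g \<in> \<Phi>" for g unfolding c_def by (rule fs(4)[OF c_mem[OF that]])
  have c_car: "c \<in> \<Phi> \<rightarrow> carrier N" using c_mem unfolding c_def N_simps by blast
  have bad_L: "bad L a x \<longleftrightarrow> x \<in> conj_products N n (defects G N \<Phi> c)" if "x \<in> carrier N" for x
    unfolding bad_def N_simps(2)[symmetric] c_def[symmetric] using that
    by (intro nc.rel_prod_iff nc.rel_defect_iff[OF c_car _ J_def])
  have sepN: "separated N n (c ` (\<Phi> - {\<one>\<^bsub>G\<^esub>})) (defects G N \<Phi> c)"
  proof -
    have "c g \<notin> conj_products N n (defects G N \<Phi> c)" if g: "g \<in> \<Phi> - {\<one>\<^bsub>G\<^esub>}" for g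
    proof -
      have "c g \<in> CC L a" using g c_mem unfolding c_def by blast
      then show ?thesis
        using not_bad[OF g, of "c g"] bad_L[of "c g"] N_simps unfolding tup_eq_def c_def by simp
    qed
    then show ?thesis unfolding separated_def by blast
  qed
  interpret U: group "N\<lparr>carrier := U\<rparr>" using fs(2) by (rule N.subgroup_imp_group)
  \<comment> \<open>The members of \<open>Fin\<close> are carried by natural numbers, so the finite
    subgroup is renumbered.\<close>
  obtain \<nu> :: "_ \<Rightarrow> nat" where \<nu>: "inj_on \<nu> U" using finite_imp_inj_to_nat_seg[OF fs(3)] by blast
  define K where "K = image_group \<nu> (N\<lparr>carrier := U\<rparr>)"
  have K: "group K" unfolding K_def using \<nu> by (intro U.inj_imp_image_group_is_group) simp
  have carK: "carrier K = \<nu> ` U" unfolding K_def image_group_def by simp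
  let ?f = "inv_into U \<nu>"
  have f: "?f \<in> hom K N"
  proof (rule homI)
    fix x assume "x \<in> carrier K"
    then show "?f x \<in> carrier N"
      unfolding carK using subgroup.subset[OF fs(2)] inv_into_into[of x \<nu> U] by blast
  next
    fix x y assume "x \<in> carrier K" "y \<in> carrier K"
    then have "?f x \<in> U" "?f y \<in> U" unfolding carK by (auto intro: inv_into_into)
    then show "?f (x \<otimes>\<^bsub>K\<^esub> y) = ?f x \<otimes>\<^bsub>N\<^esub> ?f y"
      using \<nu> subgroup.m_closed[OF fs(2)] unfolding K_def image_group_def by simp
  qed
  define \<psi> where "\<psi> g = \<nu> (c g)" for g
  have \<psi>: "\<psi> \<in> \<Phi> \<rightarrow> carrier K" unfolding \<psi>_def carK using cU by blast
  have f\<psi>: "?f (\<psi> g) = c g" if "g \<in> \<Phi>" for g unfolding \<psi>_def using \<nu> cU[OF that] by simp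
  have "K \<in> Fin" unfolding Fin_def using K fs(3) carK by simp
  \<comment> \<open>Since \<phi> maps the unit to the unit, both sides are named by the same code
    and so coincide over the new field too.\<close>
  moreover have "\<one>\<^bsub>G\<^esub> \<in> \<Phi> \<longrightarrow> \<psi> \<one>\<^bsub>G\<^esub> = \<one>\<^bsub>K\<^esub>"
    using \<phi>(2) unfolding \<psi>_def c_def K_def image_group_def by (simp add: N_simps)
  moreover have "separated K n (\<psi> ` (\<Phi> - {\<one>\<^bsub>G\<^esub>})) (defects G K \<Phi> \<psi>)"
  proof (rule separated_pullback[OF K fs(1) f \<psi>])
    show "\<Phi> - {\<one>\<^bsub>G\<^esub>} \<subseteq> \<Phi>" by blast
    have "(\<lambda>g. ?f (\<psi> g)) ` (\<Phi> - {\<one>\<^bsub>G\<^esub>}) = c ` (\<Phi> - {\<one>\<^bsub>G\<^esub>})" using f\<psi> by auto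
    moreover have "defects G N \<Phi> (\<lambda>g. ?f (\<psi> g)) = defects G N \<Phi> c"
      unfolding defects_def using f\<psi> by (intro Collect_cong) metis
    ultimately show "separated N n ((\<lambda>g. ?f (\<psi> g)) ` (\<Phi> - {\<one>\<^bsub>G\<^esub>})) (defects G N \<Phi> (\<lambda>g. ?f (\<psi> g)))"
      using sepN by simp
  qed
  ultimately show ?thesis using \<psi> by blast
qed

text \<open>Each pair of \<Phi> and n asks for a single group in the class, so only the field of
  that group enters, and the fields of different members need not be related.\<close>

theorem corollary22:
  fixes K :: "'h monoid set" and G :: "'g monoid"
  assumes "\<And>H. H \<in> K \<Longrightarrow> \<exists>k :: 'f ring. algebraically_closed k \<and> algebraic_group k H"
    and "group G"
    and "approximable K G"
  shows "weakly_sofic G"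
  unfolding weakly_sofic_def approximable_def
proof (intro allI impI)
  fix \<Phi> n assume \<Phi>: "finite \<Phi> \<and> \<Phi> \<subseteq> carrier G"
  then obtain H \<phi> where H: "H \<in> K" "\<phi> \<in> \<Phi> \<rightarrow> carrier H" "\<one>\<^bsub>G\<^esub> \<in> \<Phi> \<longrightarrow> \<phi> \<one>\<^bsub>G\<^esub> = \<one>\<^bsub>H\<^esub>"
    "separated H n (\<phi> ` (\<Phi> - {\<one>\<^bsub>G\<^esub>})) (defects G H \<Phi> \<phi>)"
    using assms(3) unfolding approximable_def by meson
  obtain k :: "'f ring" where "algebraically_closed k" "algebraic_group k H"
    using assms(1)[OF H(1)] by blast
  then show "\<exists>H \<in> Fin. \<exists>\<phi>. \<phi> \<in> \<Phi> \<rightarrow> carrier H \<and> (\<one>\<^bsub>G\<^esub> \<in> \<Phi> \<longrightarrow> \<phi> \<one>\<^bsub>G\<^esub> = \<one>\<^bsub>H\<^esub>) \<and>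
      separated H n (\<phi> ` (\<Phi> - {\<one>\<^bsub>G\<^esub>})) (defects G H \<Phi> \<phi>)"
    using \<Phi> H(2-4) by (intro algebraic_group_finite_model) auto
qed

end
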